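(* Let $f$ be the meromorphic function on $\mathbb{C}$ given by $f(z)=\tan z + z$. Then there is an infinite sequence $(U_j)_{j=1}^{\infty}$ of pairwise disjoint simply-connected domains $U_j\subset\mathbb{C}$ such that $f^{-1}(U_j)$ is connected for all $j$.
   Context: A domain is a non-empty connected open subset of $\mathbb{C}$. Here $f^{-1}(U)$ denotes the set of all $z\in\mathbb{C}$, not poles of $f$, with $f(z)\in U$. *)

theory Defs
  imports "HOL-Complex_Analysis.Complex_Analysis"
begin

definition complex_domain :: "complex set \<Rightarrow> bool" where
  "complex_domain U \<longleftrightarrow> U \<noteq> {} \<and> connected U \<and> open U"

(* A HOL function is total, so a meromorphic function carries an arbitrary value at
   each of its poles (for example tan z = 0 whenever cos z = 0); poles are therefore
   removed explicitly instead of using the ordinary preimage f -` U. *)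
definition mero_preimage :: "(complex \<Rightarrow> complex) \<Rightarrow> complex set \<Rightarrow> complex set" where
  "mero_preimage f U = {z. \<not> is_pole f z \<and> f z \<in> U}"

end

theory Submission
  imports Defs "HOL-Combinatorics.Transposition"
begin

text \<open>Let \<open>f z = tan z + z\<close>. Its poles are the points \<open>p k = (k + 1/2) \<pi>\<close>, its
critical points are the solutions of \<open>cos z ^ 2 = -1\<close>, and its critical values are \<open>p k
\<plusminus> i c\<close> with \<open>c = arsinh 1 + sqrt 2\<close>. Off the critical values \<open>f\<close>
is a covering map (\<open>tanid_covering\<close>), with infinitely many sheets. A small disc has infinitely
many preimage components; to make a preimage connected, the domain has to contain so many critical values,
in such a winding way, that all sheets get joined. Infinitely many disjoint domains have to do this at the
same time, so the domains are built like the lakes of Wada: each \<open>U j\<close> is the union of an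
increasing sequence of topological squares, called lakes here, which are dug out in turn.

There are only countably many requirements: for each \<open>j\<close> fix a point \<open>w j\<close> of the
first lake of class \<open>j\<close>, and for any two points of the fibre of \<open>f\<close> over \<open>w
j\<close> demand that some lake of class \<open>j\<close> has a preimage in which they are joined. If every
requirement is met, the preimage of \<open>U j\<close> is connected, because each of its points can be
joined within it to the fibre over \<open>w j\<close>. As an increasing union of simply connected open sets
\<open>U j\<close> is simply connected, and disjointness is clear at every stage. What has to be shown is
that at any stage a single requirement can be met by enlarging one lake without touching the others
(\<open>connect_in_lake\<close>).

This is a matter of bookkeeping with permutations. At each stage a homeomorphism \<open>\<phi>\<close> of
the plane, a frame, parametrises the picture so that all lakes and all critical values sit in small squares
centred at the integers of the real axis. What lies above these squares, together with the gaps between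
neighbouring squares, is contractible and free of critical values; so there are sheets \<open>t y\<close>
over this upper side, labelled by integers \<open>y\<close>, and likewise sheets \<open>s x\<close> over the
lower side. Over the gap \<open>k\<close> between the squares \<open>k\<close> and \<open>k + 1\<close> they
are matched by a permutation: \<open>s x = t (\<pi> k x)\<close>. If the square \<open>i\<close> is a lake,
then walking once around its rim joins sheet \<open>y\<close> to sheet \<open>\<pi> i (inv (\<pi> (i - 1))
y)\<close> inside the preimage of the lake (\<open>ring\<close>). So a lake joins all the labels in a common
orbit of this permutation, and it has to be arranged that two given labels are in the same orbit.

Two changes of the frame are used. A half twist interchanges the squares \<open>k\<close> and \<open>k +
1\<close> and leaves all lakes as they are; it replaces \<open>\<pi> k\<close> by \<open>\<pi> (k + 1)
\<circ> inv (\<pi> k) \<circ> \<pi> (k - 1)\<close> (\<open>frame_twist\<close>). A merge lets the lake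
\<open>i\<close> swallow the square \<open>i + 1\<close>; it replaces \<open>\<pi> i\<close> by \<open>\<pi>
(i + 1)\<close> (\<open>frame_merge\<close>). In the initial frame the critical values \<open>p m
\<plusminus> i c\<close> form a pair of neighbouring squares with a transposition \<open>(0 a)\<close> in
the gap between them, where \<open>a\<close> depends on \<open>m\<close> and is fixed by all other
\<open>\<pi> k\<close> (\<open>start_frame\<close>). Since every stage changes the picture only within
finitely many columns, there is always a fresh pair far out. The combinatorial heart
(\<open>absorb_slit\<close>, \<open>connect_labels\<close>) is that a lake which does not yet join
\<open>y\<close> to \<open>y'\<close> can fetch a fresh pair, lead one of its two critical values around a
loop of suitable squares, and swallow the pair; this adds to the orbit of \<open>y\<close> a further one of
the finitely many labels on which the disturbed part of the picture acts.\<close>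

section \<open>Tangent plus identity as a covering map\<close>

text \<open>Sections over a ball of a radius that depends on the centre only already give an evenly covered
neighbourhood, whatever the size of the fibre: the images of the sections are open by invariance of domain,
and two sections which agree somewhere agree everywhere because the map is locally injective, so distinct
images are disjoint.\<close>

lemma covering_space_from_sections:
  fixes f :: "complex \<Rightarrow> complex"
  assumes "open M" "continuous_on M f" "f ` M = S" "open S"
    and inj: "\<And>z. z \<in> M \<Longrightarrow> \<exists>O'. open O' \<and> z \<in> O' \<and> inj_on f O'"
    and sec: "\<And>w. w \<in> S \<Longrightarrow> \<exists>r>0. ball w r \<subseteq> S \<and> (\<forall>z\<in>M. f z \<in> ball w r \<longrightarrow>
       (\<exists>g. continuous_on (ball w r) g \<and> g ` ball w r \<subseteq> M \<and> (\<forall>u\<in>ball w r. f (g u) = u) \<and> g (f z) = z))"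
  shows "covering_space M f S"
  unfolding covering_space_def
proof (intro conjI ballI)
  show "continuous_on M f" "f ` M = S" by fact+
  fix w assume "w \<in> S"
  with sec obtain r where r: "r > 0" "ball w r \<subseteq> S"
    "\<And>z. z \<in> M \<Longrightarrow> f z \<in> ball w r \<Longrightarrow> \<exists>g. continuous_on (ball w r) g \<and> g ` ball w r \<subseteq> M \<and> (\<forall>u\<in>ball w r. f (g u) = u) \<and> g (f z) = z"
    by metis
  define G where "G = {g. continuous_on (ball w r) g \<and> g ` ball w r \<subseteq> M \<and> (\<forall>u\<in>ball w r. f (g u) = u)}"
  define V where "V = (\<lambda>g. g ` ball w r) ` G"
  have op: "open (g ` ball w r)" if "g \<in> G" for g
  proof (rule invariance_of_domain)
    have "f (g x) = x" if "x \<in> ball w r" for x using \<open>g \<in> G\<close> that by (simp add: G_def)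
    then show "inj_on g (ball w r)" by (rule inj_on_inverseI)
  qed (use that in \<open>auto simp: G_def\<close>)
  have agree: "g1 u = g2 u" if "g1 \<in> G" "g2 \<in> G" "v \<in> ball w r" "g1 v = g2 v" "u \<in> ball w r" for g1 g2 u v
  proof -
    define A where "A = {u \<in> ball w r. g1 u = g2 u}"
    have c: "continuous_on (ball w r) g1" "continuous_on (ball w r) g2" using that by (auto simp: G_def)
    have "closedin (top_of_set (ball w r)) A"
    proof -
      have "A = ball w r \<inter> (\<lambda>u. g1 u - g2 u) -` {0}" by (auto simp: A_def)
      moreover have "continuous_on (ball w r) (\<lambda>u. g1 u - g2 u)" using c by (intro continuous_intros)
      ultimately show ?thesis using continuous_closedin_preimage[of "ball w r" _ "{0}"] by auto
    qed
    moreover have "open A"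
      unfolding open_subopen[of A]
    proof
      fix x assume x: "x \<in> A"
      then have "g1 x \<in> M" using that by (auto simp: A_def G_def)
      then obtain O' where O': "open O'" "g1 x \<in> O'" "inj_on f O'" using inj by blast
      let ?T = "(ball w r \<inter> g1 -` O') \<inter> (ball w r \<inter> g2 -` O')"
      have "open ?T" by (intro open_Int continuous_open_preimage c O' open_ball)
      moreover have "x \<in> ?T" using x O' by (auto simp: A_def)
      moreover have "?T \<subseteq> A"
      proof
        fix u assume u: "u \<in> ?T"
        then have "f (g1 u) = f (g2 u)" using that by (auto simp: G_def)
        then show "u \<in> A" using u O'(3) by (auto simp: A_def dest: inj_onD)
      qed
      ultimately show "\<exists>T. open T \<and> x \<in> T \<and> T \<subseteq> A" by blast
    qed
    then have "openin (top_of_set (ball w r)) A" by (simp add: openin_open_eq) (auto simp: A_def)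
    ultimately have "A = {} \<or> A = ball w r"
      using connected_ball[of w r] unfolding connected_clopen by blast
    moreover have "v \<in> A" using that(3,4) unfolding A_def by blast
    ultimately have "u \<in> A" using that(5) by blast
    then show ?thesis unfolding A_def by blast
  qed
  show "\<exists>T. w \<in> T \<and> openin (top_of_set S) T \<and>
     (\<exists>v. \<Union>v = M \<inter> f -` T \<and> (\<forall>u\<in>v. openin (top_of_set M) u) \<and> pairwise disjnt v \<and>
          (\<forall>u\<in>v. Ex (homeomorphism u T f)))"
  proof (intro exI conjI)
    show "w \<in> ball w r" using r by simp
    show "openin (top_of_set S) (ball w r)" using r by (simp add: openin_open_eq \<open>open S\<close>)
    show "\<Union>V = M \<inter> f -` ball w r"
    proof
      show "\<Union>V \<subseteq> M \<inter> f -` ball w r" by (auto simp: V_def G_def)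
      show "M \<inter> f -` ball w r \<subseteq> \<Union>V"
      proof
        fix z assume z: "z \<in> M \<inter> f -` ball w r"
        then obtain g where "g \<in> G" "g (f z) = z" using r(3)[of z] by (auto simp: G_def)
        then have "z \<in> g ` ball w r" using z by force
        then show "z \<in> \<Union>V" using \<open>g \<in> G\<close> by (auto simp: V_def)
      qed
    qed
    show "\<forall>u\<in>V. openin (top_of_set M) u"
      using op by (auto simp: V_def G_def openin_open_eq \<open>open M\<close>)
    show "pairwise disjnt V"
    proof (rule pairwiseI)
      fix a b assume "a \<in> V" "b \<in> V" "a \<noteq> b"
      then obtain g1 g2 where g: "g1 \<in> G" "g2 \<in> G" "a = g1 ` ball w r" "b = g2 ` ball w r" by (auto simp: V_def)
      show "disjnt a b"
      proof (rule ccontr)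
        assume "\<not> disjnt a b"
        then obtain u1 u2 where u: "u1 \<in> ball w r" "u2 \<in> ball w r" "g1 u1 = g2 u2" unfolding g disjnt_def by auto
        have "f (g1 u1) = u1" using g(1) u(1) unfolding G_def by blast
        moreover have "f (g2 u2) = u2" using g(2) u(2) unfolding G_def by blast
        ultimately have "u1 = u2" unfolding u(3) by (rule trans[OF sym])
        then have "g1 x = g2 x" if "x \<in> ball w r" for x using agree[OF g(1,2) u(1) _ that] u by simp
        then show False using \<open>a \<noteq> b\<close> unfolding g by (auto simp: image_def)
      qed
    qed
    show "\<forall>u\<in>V. Ex (homeomorphism u (ball w r) f)"
    proof
      fix u assume "u \<in> V"
      then obtain g where g: "g \<in> G" "u = g ` ball w r" by (auto simp: V_def)
      have "homeomorphism u (ball w r) f g"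
      proof (rule homeomorphismI)
        have "u \<subseteq> M" using g by (auto simp: G_def)
        then show "continuous_on u f" using \<open>continuous_on M f\<close> by (rule continuous_on_subset[rotated])
        have fg: "f (g x) = x" if "x \<in> ball w r" for x using g(1) that by (simp add: G_def)
        then show "f ` u \<subseteq> ball w r" "\<And>y. y \<in> ball w r \<Longrightarrow> f (g y) = y" "\<And>x. x \<in> u \<Longrightarrow> g (f x) = x"
          unfolding g(2) by auto
        show "continuous_on (ball w r) g" using g(1) by (simp add: G_def)
        show "g ` ball w r \<subseteq> u" using g(2) by simp
      qed
      then show "Ex (homeomorphism u (ball w r) f)" by blast
    qed
  qed
qed

definition tanid :: "complex \<Rightarrow> complex" where "tanid z = tan z + z"

definition pole :: "int \<Rightarrow> complex" where "pole k = of_real ((of_int k + 1 / 2) * pi)"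

text \<open>The derivative of \<open>tanid\<close> is \<open>1 + 1 / cos z ^ 2\<close>, so these are the images of its
zeros.\<close>

definition crit_vals :: "complex set" where "crit_vals = tanid ` {z. (cos z)\<^sup>2 = - 1}"

definition regular_pts :: "complex set" where "regular_pts = {z. cos z \<noteq> 0 \<and> tanid z \<notin> crit_vals}"

lemma cos_0_iff_pole: "cos z = 0 \<longleftrightarrow> z \<in> range pole"
  by (auto simp: cos_eq_0 pole_def algebra_simps)

lemma tanid_shift: "tanid (z + of_int k * of_real pi) = tanid z + of_int k * of_real pi"
proof -
  have "tan (z + of_int k * of_real pi) = tan z"
  proof -
    have e: "of_int k * of_real pi = (of_real (pi * of_int k) :: complex)" by simp
    have "sin (of_int k * of_real pi :: complex) = 0" unfolding e sin_of_real sin_npi_int by simp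
    moreover have "cos (of_int k * of_real pi :: complex) \<noteq> 0" unfolding e cos_of_real cos_npi_int by simp
    ultimately show ?thesis by (simp add: tan_def sin_add cos_add)
  qed
  then show ?thesis by (simp add: tanid_def)
qed

lemma tanid_deriv: "cos z \<noteq> 0 \<Longrightarrow> (tanid has_field_derivative (1 + 1 / (cos z)\<^sup>2)) (at z)"
  unfolding tanid_def by (auto intro!: derivative_eq_intros simp: field_simps)

lemma open_cos_nz: "open {z::complex. cos z \<noteq> 0}"
  by (intro open_Collect_neq continuous_intros)

lemma tanid_holo: "tanid holomorphic_on {z. cos z \<noteq> 0}"
  using tanid_deriv by (auto simp: holomorphic_on_open[OF open_cos_nz])

lemma tanid_cont: "continuous_on {z. cos z \<noteq> 0} tanid"
  using tanid_holo by (rule holomorphic_on_imp_continuous_on)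

text \<open>In the coordinate \<open>u = z - pole k\<close> the reciprocal of \<open>tanid z - pole k\<close> extends to
a holomorphic function with a simple zero at \<open>u = 0\<close>. It is the same function for all poles,
because \<open>tanid\<close> commutes with the translation by \<open>\<pi>\<close>; hence the radius
\<open>\<delta>\<close> and the bound \<open>A\<close> do not depend on the pole.\<close>

lemma tanid_near_pole:
  obtains \<delta> A where "\<delta> > 0" "\<And>k. inj_on tanid (ball (pole k) \<delta> - {pole k})"
    "\<And>k z. z \<in> ball (pole k) \<delta> - {pole k} \<Longrightarrow> cos z \<noteq> 0"
    "\<And>k w. dist w (pole k) > A \<Longrightarrow> w \<in> tanid ` (ball (pole k) \<delta> - {pole k})"
proof -
  define D where "D u = u * sin u - cos u" for u :: complex
  \<comment> \<open>\<open>\<psi> u\<close> is the reciprocal of \<open>u - cot u = tanid (pole k + u) - pole k\<close>.\<close>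
  define \<psi> where "\<psi> u = sin u / D u" for u :: complex
  have D: "open {u. D u \<noteq> 0}" unfolding D_def by (intro open_Collect_neq continuous_intros)
  have "(\<psi> has_field_derivative (-1)) (at 0)"
    unfolding \<psi>_def D_def by (auto intro!: derivative_eq_intros)
  moreover have hol: "\<psi> holomorphic_on {u. D u \<noteq> 0}"
    unfolding \<psi>_def by (auto simp: D_def intro!: holomorphic_intros)
  ultimately obtain r where r: "r > 0" "ball 0 r \<subseteq> {u. D u \<noteq> 0}" "inj_on \<psi> (ball 0 r)"
    using has_complex_derivative_locally_injective[OF hol, of 0] D DERIV_imp_deriv[of \<psi> "-1" 0]
    by (auto simp: D_def)
  define \<delta> where "\<delta> = min r 1"
  have \<delta>: "\<delta> > 0" "ball 0 \<delta> \<subseteq> {u. D u \<noteq> 0}" "inj_on \<psi> (ball 0 \<delta>)" "\<delta> \<le> 1"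
    using r by (auto simp: \<delta>_def intro: inj_on_subset)
  have sinnz: "sin u \<noteq> 0" if u: "u \<in> ball 0 \<delta> - {0}" for u :: complex
  proof
    assume "sin u = 0"
    then have "\<psi> u = \<psi> 0" by (simp add: \<psi>_def)
    then show False using \<delta>(1,3) u by (auto dest: inj_onD)
  qed
  have coskey: "cos (pole k + u) \<noteq> 0 \<longleftrightarrow> sin u \<noteq> 0" for u k
  proof -
    have c: "cos (pole k) = 0" by (simp add: cos_0_iff_pole)
    have "sin (pole k) \<noteq> 0" using c sin_cos_squared_add[of "pole k"] by auto
    then show ?thesis using c by (simp add: cos_add)
  qed
  have key: "tanid (pole k + u) = pole k + 1 / \<psi> u" if u: "u \<in> ball 0 \<delta> - {0}" for k u
  proof -
    have c: "cos (pole k) = 0" by (simp add: cos_0_iff_pole)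
    have s: "sin (pole k) \<noteq> 0" using c sin_cos_squared_add[of "pole k"] by auto
    have "tan (pole k + u) = - (cos u / sin u)"
      using s c by (simp add: tan_def sin_add cos_add)
    moreover have "1 / \<psi> u = u - cos u / sin u"
      using sinnz[OF u] u \<delta>(2) by (auto simp: \<psi>_def D_def field_simps)
    ultimately show ?thesis by (simp add: tanid_def)
  qed
  have "open (\<psi> ` ball 0 \<delta>)"
    using hol \<delta> by (intro invariance_of_domain holomorphic_on_imp_continuous_on) (auto intro: holomorphic_on_subset)
  moreover have "0 \<in> \<psi> ` ball 0 \<delta>" using \<delta>(1) by (intro image_eqI[of _ _ 0]) (auto simp: \<psi>_def)
  ultimately obtain e where e: "e > 0" "ball 0 e \<subseteq> \<psi> ` ball 0 \<delta>" using openE by blast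
  have shift: "z \<in> ball (pole k) \<delta> - {pole k} \<longleftrightarrow> z - pole k \<in> ball 0 \<delta> - {0}" for z k
    by (auto simp: dist_norm norm_minus_commute)
  show ?thesis
  proof
    show "\<delta> > 0" by fact
    fix k
    show "inj_on tanid (ball (pole k) \<delta> - {pole k})"
    proof (rule inj_onI)
      fix x y assume xy: "x \<in> ball (pole k) \<delta> - {pole k}" "y \<in> ball (pole k) \<delta> - {pole k}" "tanid x = tanid y"
      then have "1 / \<psi> (x - pole k) = 1 / \<psi> (y - pole k)"
        using key[of "x - pole k" k] key[of "y - pole k" k] unfolding shift by simp
      then have "\<psi> (x - pole k) = \<psi> (y - pole k)" by simp
      then show "x = y" using xy \<delta>(3) unfolding shift by (auto dest: inj_onD)
    qed
    show "cos z \<noteq> 0" if "z \<in> ball (pole k) \<delta> - {pole k}" for z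
      using coskey[of k "z - pole k"] sinnz[of "z - pole k"] that unfolding shift by simp
    show "w \<in> tanid ` (ball (pole k) \<delta> - {pole k})" if "dist w (pole k) > 1 / e" for w
    proof -
      define v where "v = 1 / (w - pole k)"
      have n: "norm (w - pole k) > 1 / e" using that by (simp add: dist_norm)
      have "0 < 1 / e" using e by simp
      then have wnz: "w - pole k \<noteq> 0" using n by force
      have "norm v < e" using n e wnz by (simp add: v_def norm_divide field_simps)
      then obtain u where u: "u \<in> ball 0 \<delta>" "\<psi> u = v" using e by auto
      have "u \<noteq> 0" using u wnz by (auto simp: v_def \<psi>_def)
      then have "tanid (pole k + u) = w" using key[of u k] u by (auto simp: v_def)
      moreover have "pole k + u \<in> ball (pole k) \<delta> - {pole k}" unfolding shift using u \<open>u \<noteq> 0\<close> by simp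
      ultimately show ?thesis by blast
    qed
  qed
qed

text \<open>Up to periodicity, the part with \<open>\<bar>Im z\<bar> \<le> 1\<close> is compact; on the rest \<open>cos
z ^ 2\<close> is bounded away from zero, which bounds \<open>tan z ^ 2 = 1 / cos z ^ 2 - 1\<close>.\<close>

lemma tan_bounded_off_poles:
  assumes "\<delta> > 0"
  obtains B where "\<And>z. (\<forall>k. dist z (pole k) \<ge> \<delta>) \<Longrightarrow> norm (tan z) \<le> B"
proof -
  define K where "K = cbox (Complex 0 (-1)) (Complex pi 1) - ball (pole 0) \<delta>"
  have K: "compact K" unfolding K_def by (intro compact_diff compact_cbox open_ball)
  have Knz: "cos z \<noteq> 0" if z: "z \<in> K" for z
  proof
    assume "cos z = 0"
    then obtain k where k: "z = pole k" by (auto simp: cos_0_iff_pole)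
    have "0 \<le> (real_of_int k + 1/2) * pi" "(real_of_int k + 1/2) * pi \<le> 1 * pi"
      using z unfolding K_def k pole_def by (auto simp: in_cbox_complex_iff)
    then have "0 \<le> real_of_int k + 1/2" "real_of_int k + 1/2 \<le> 1"
      using pi_gt_zero by (auto simp: zero_le_mult_iff mult_le_cancel_right)
    then have "k = 0" by linarith
    then show False using z assms by (auto simp: K_def k)
  qed
  have "compact (tan ` K)"
    using K Knz by (intro compact_continuous_image continuous_intros) auto
  then obtain B where B: "\<And>z. z \<in> K \<Longrightarrow> norm (tan z) \<le> B"
    unfolding compact_eq_bounded_closed bounded_iff by auto
  have big: "norm (tan z) \<le> 2" if y: "\<bar>Im z\<bar> \<ge> 1" for z
  proof -
    have e2: "exp t \<ge> 2" if "t \<ge> 1" for t :: real using exp_ge_add_one_self[of t] that by linarith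
    define t where "t = exp (Im z)"
    have t: "t > 0" by (simp add: t_def)
    have "t \<ge> 2 \<or> inverse t \<ge> 2"
    proof (cases "Im z \<ge> 0")
      case True then show ?thesis using e2[of "Im z"] y by (simp add: t_def)
    next
      case False then show ?thesis using e2[of "- Im z"] y by (simp add: t_def exp_minus)
    qed
    then have "\<bar>t - inverse t\<bar> \<ge> 3 / 2"
    proof
      assume "t \<ge> 2"
      then have "inverse t \<le> inverse 2" by (intro le_imp_inverse_le) auto
      then show ?thesis using \<open>t \<ge> 2\<close> by simp
    next
      assume *: "inverse t \<ge> 2"
      then have "inverse (inverse t) \<le> inverse 2" by (intro le_imp_inverse_le) auto
      then show ?thesis using * by simp
    qed
    then have "(3 / 2)\<^sup>2 \<le> (t - inverse t)\<^sup>2" using abs_le_square_iff[of "3/2" "t - inverse t"] by simp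
    then have c: "norm (cos z) ^ 2 \<ge> 1 / 2"
      using norm_cos_squared[of z] by (simp add: t_def power2_eq_square add_increasing)
    then have nz: "cos z \<noteq> 0" by auto
    have "norm (sin z) ^ 2 = norm (1 - (cos z)\<^sup>2)" by (simp add: norm_power[symmetric] sin_squared_eq)
    also have "\<dots> \<le> 1 + norm (cos z) ^ 2" using norm_triangle_ineq4[of 1 "(cos z)\<^sup>2"] by (simp add: norm_power)
    also have "\<dots> \<le> (2 * norm (cos z)) ^ 2" using c by (simp add: power_mult_distrib)
    finally have "norm (sin z) \<le> 2 * norm (cos z)" by (rule power2_le_imp_le) simp
    then show ?thesis using nz by (simp add: tan_def norm_divide field_simps)
  qed
  show ?thesis
  proof
    fix z assume z: "\<forall>k. dist z (pole k) \<ge> \<delta>"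
    show "norm (tan z) \<le> max B 2"
    proof (cases "\<bar>Im z\<bar> \<ge> 1")
      case True then show ?thesis using big by (simp add: max.coboundedI2)
    next
      case False
      define k where "k = \<lfloor>Re z / pi\<rfloor>"
      define u where "u = z - of_int k * of_real pi"
      have "of_int k \<le> Re z / pi" "Re z / pi \<le> of_int k + 1" unfolding k_def by linarith+
      then have "0 \<le> Re u" "Re u \<le> pi" by (simp_all add: u_def field_simps)
      moreover have "dist u (pole 0) = dist z (pole k)" by (simp add: u_def pole_def dist_norm algebra_simps)
      ultimately have "u \<in> K" using False z[rule_format, of k] by (auto simp: K_def u_def in_cbox_complex_iff dist_commute)
      moreover have "tan z = tan u" using tanid_shift[of u k] by (simp add: tanid_def u_def)
      ultimately show ?thesis using B by (simp add: max.coboundedI1)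
    qed
  qed
qed

lemma dist_pole_lower: "dist w (pole k) \<ge> \<bar>Re w - (of_int k + 1/2) * pi\<bar>"
  using abs_Re_le_cmod[of "w - pole k"] by (simp add: dist_norm pole_def)

text \<open>\<open>cos (x + i y) = \<plusminus> i\<close> forces \<open>cos x = 0\<close> and \<open>sinh y =
\<plusminus> 1\<close>, and at such points \<open>tan z = \<plusminus> i sqrt 2\<close>.\<close>

lemma crit_pt_eqs:
  assumes "(cos z)\<^sup>2 = - 1"
  obtains k s where "s = 1 \<or> s = -1" "z = Complex ((of_int k + 1 / 2) * pi) (s * arsinh 1)"
    "tanid z = Complex ((of_int k + 1 / 2) * pi) (s * (arsinh 1 + sqrt 2))"
proof -
  obtain x y where z: "z = Complex x y" by (cases z)
  have cz: "cos z = Complex (cos x * cosh y) (- (sin x * sinh y))"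
    by (simp add: complex_eq_iff Re_cos Im_cos z sinh_field_def cosh_field_def exp_minus algebra_simps diff_divide_distrib)
  have "(cos z - \<i>) * (cos z + \<i>) = 0" using assms by (simp add: algebra_simps power2_eq_square)
  then have "cos z = \<i> \<or> cos z = - \<i>" by (auto simp: eq_neg_iff_add_eq_0)
  then have *: "cos x * cosh y = 0" "\<bar>sin x * sinh y\<bar> = 1" unfolding cz by (auto simp: complex_eq_iff)
  then have cx: "cos x = 0" by (metis cosh_real_nonzero mult_eq_0_iff)
  have sx: "\<bar>sin x\<bar> = 1" using cx sin_cos_squared_add[of x] by (simp add: abs_square_eq_1)
  have shy: "\<bar>sinh y\<bar> = 1" using * sx by (simp add: abs_mult)
  obtain k where x: "x = (of_int k + 1 / 2) * pi" using cx cos_zero_iff_int2[of x] by (auto simp: algebra_simps)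
  define s where "s = sinh y"
  have s: "s = 1 \<or> s = -1" "sinh y = s" using shy by (auto simp: s_def abs_if split: if_splits)
  have "y = arsinh s" by (simp add: s_def arsinh_sinh_real)
  then have y: "y = s * arsinh 1" using s(1) by (auto simp: arsinh_minus_real)
  have "cosh y ^ 2 = 2" using s cosh_square_eq[of y] by auto
  then have chy: "cosh y = sqrt 2" using real_sqrt_abs[of "cosh y"] cosh_real_nonneg[of y] by simp
  have "sin z = Complex (sin x * cosh y) (cos x * sinh y)"
    by (simp add: complex_eq_iff Re_sin Im_sin z sinh_field_def cosh_field_def exp_minus algebra_simps diff_divide_distrib)
  then have "tan z = Complex (sin x * cosh y) 0 / Complex 0 (- (sin x * s))"
    using cx s by (simp add: tan_def cz)
  also have "\<dots> = Complex 0 (s * sqrt 2)"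
    using sx s chy by (auto simp: complex_eq_iff Re_divide Im_divide power2_eq_square)
  finally have "tanid z = Complex x (s * (arsinh 1 + sqrt 2))" by (simp add: tanid_def z y complex_eq_iff algebra_simps)
  then show ?thesis using that[of s k] s(1) unfolding z x y by blast
qed

definition crit_height :: real where "crit_height = arsinh 1 + sqrt 2"

lemma crit_vals_form: "v \<in> crit_vals \<Longrightarrow> \<exists>k s. (s = 1 \<or> s = -1) \<and> v = Complex ((of_int k + 1 / 2) * pi) (s * crit_height)"

proof -
  assume "v \<in> crit_vals"
  then obtain z where z: "v = tanid z" "(cos z)\<^sup>2 = - 1" by (auto simp: crit_vals_def)
  show ?thesis using crit_pt_eqs[OF z(2)] unfolding z(1) crit_height_def by metis
qed

lemma closed_crit_vals: "closed crit_vals"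
proof (rule discrete_imp_closed[of "min pi crit_height"])
  have "arsinh (1::real) > 0" using arsinh_real_strict_mono by (metis arsinh_0 strict_monoD zero_less_one)
  then have cp: "crit_height > 0" by (simp add: crit_height_def add_pos_nonneg)
  then show "0 < min pi crit_height" by simp
  show "\<forall>x\<in>crit_vals. \<forall>y\<in>crit_vals. dist y x < min pi crit_height \<longrightarrow> y = x"
  proof (intro ballI impI)
    fix x y assume xy: "x \<in> crit_vals" "y \<in> crit_vals" and d: "dist y x < min pi crit_height"
    obtain k s where x: "x = Complex ((of_int k + 1 / 2) * pi) (s * crit_height)" "s = 1 \<or> s = -1" using crit_vals_form[OF xy(1)] by blast
    obtain l t where y: "y = Complex ((of_int l + 1 / 2) * pi) (t * crit_height)" "t = 1 \<or> t = -1" using crit_vals_form[OF xy(2)] by blast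
    have "\<bar>Re (y - x)\<bar> < pi" "\<bar>Im (y - x)\<bar> < crit_height"
      using d[unfolded dist_norm] abs_Re_le_cmod[of "y - x"] abs_Im_le_cmod[of "y - x"] by linarith+
    moreover have "Re (y - x) = of_int (l - k) * pi" by (simp add: x y algebra_simps)
    moreover have "Im (y - x) = (t - s) * crit_height" by (simp add: x y algebra_simps)
    ultimately have "\<bar>of_int (l - k)\<bar> * pi < 1 * pi" "\<bar>t - s\<bar> * crit_height < 1 * crit_height" using cp by (simp_all add: abs_mult)
    then have "\<bar>real_of_int (l - k)\<bar> < 1" "\<bar>t - s\<bar> < 1"
      using cp pi_gt_zero unfolding mult_less_cancel_right by auto
    then show "y = x" using x y by auto
  qed
qed

lemma tanid_pole_infinity:
  assumes "cos p = 0" shows "filterlim tanid at_infinity (at p)"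
proof -
  have s: "sin p \<noteq> 0" using assms sin_cos_squared_add[of p] by auto
  have "filterlim (\<lambda>z. sin z / cos z) at_infinity (at p)"
  proof (rule filterlim_divide_at_infinity)
    show "(sin \<longlongrightarrow> sin p) (at p)" by (intro tendsto_intros)
    show "filterlim cos (at 0) (at p)"
    proof -
      have "\<forall>\<^sub>F z in at p. cos z \<noteq> 0"
      proof -
        have "(cos has_field_derivative - sin p) (at p)" by (auto intro!: derivative_eq_intros)
        then have "((\<lambda>z. (cos z - cos p) / (z - p)) \<longlongrightarrow> - sin p) (at p)" by (simp add: has_field_derivative_iff)
        then have "\<forall>\<^sub>F z in at p. (cos z - cos p) / (z - p) \<noteq> 0" using s by (intro tendsto_imp_eventually_ne[where c = "- sin p"]) auto
        then show ?thesis by eventually_elim (auto simp: assms)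
      qed
      moreover have "(cos \<longlongrightarrow> 0) (at p)" using tendsto_cos[OF tendsto_ident_at[of p UNIV]] assms by simp
      ultimately show ?thesis by (simp add: filterlim_at)
    qed
  qed (use s in auto)
  then have "filterlim (\<lambda>z. z + sin z / cos z) at_infinity (at p)"
    by (rule tendsto_add_filterlim_at_infinity[OF tendsto_ident_at])
  moreover have "tanid = (\<lambda>z. z + sin z / cos z)" by (simp add: fun_eq_iff tanid_def tan_def)
  ultimately show ?thesis by simp
qed
lemma is_pole_tanid_iff: "is_pole tanid z \<longleftrightarrow> cos z = 0"
proof
  assume "is_pole tanid z"
  then show "cos z = 0" using not_is_pole_holomorphic[OF open_cos_nz _ tanid_holo, of z] by auto
qed (simp add: is_pole_def tanid_pole_infinity)

lemma open_regular_pts: "open regular_pts"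
proof -
  have "regular_pts = {z. cos z \<noteq> 0} \<inter> tanid -` (- crit_vals)" by (auto simp: regular_pts_def)
  then show ?thesis
    using continuous_open_preimage[OF tanid_cont open_cos_nz open_Compl[OF closed_crit_vals]] by simp
qed

lemma tanid_deriv_nonzero:
  assumes "z \<in> regular_pts" shows "deriv tanid z \<noteq> 0"
proof -
  have c: "cos z \<noteq> 0" "(cos z)\<^sup>2 \<noteq> - 1" using assms by (auto simp: regular_pts_def crit_vals_def)
  then have "1 + 1 / (cos z)\<^sup>2 \<noteq> 0" by (simp add: field_simps eq_neg_iff_add_eq_0)
  then show ?thesis using tanid_deriv[OF c(1)] by (simp add: DERIV_imp_deriv)
qed

lemma tanid_locally_injective:
  assumes "z \<in> regular_pts"
  obtains r where "r > 0" "ball z r \<subseteq> {z. cos z \<noteq> 0}" "inj_on tanid (ball z r)"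
  using has_complex_derivative_locally_injective[OF tanid_holo _ open_cos_nz tanid_deriv_nonzero[OF assms]] assms
  by (auto simp: regular_pts_def)

lemma tanid_onto: "tanid ` regular_pts = - crit_vals"
proof
  show "- crit_vals \<subseteq> tanid ` regular_pts"
  proof
    fix w assume w: "w \<in> - crit_vals"
    obtain \<delta> A where dA: "\<delta> > 0"
      "\<And>k z. z \<in> ball (pole k) \<delta> - {pole k} \<Longrightarrow> cos z \<noteq> 0"
      "\<And>k w. dist w (pole k) > A \<Longrightarrow> w \<in> tanid ` (ball (pole k) \<delta> - {pole k})"
      using tanid_near_pole by metis
    define k where "k = \<lceil>\<bar>A\<bar> + \<bar>Re w\<bar>\<rceil>"
    have "real_of_int k \<ge> \<bar>A\<bar> + \<bar>Re w\<bar>" unfolding k_def by (rule le_of_int_ceiling)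
    then have k: "real_of_int k + 1/2 > \<bar>A\<bar> + \<bar>Re w\<bar>" by linarith
    define X where "X = (of_int k + 1/2) * pi"
    have "(real_of_int k + 1/2) * 1 \<le> X"
      unfolding X_def using k pi_ge_two by (intro mult_left_mono) linarith+
    moreover have "dist w (pole k) \<ge> \<bar>Re w - X\<bar>" unfolding X_def by (rule dist_pole_lower)
    moreover have "X - Re w \<le> \<bar>Re w - X\<bar>" "Re w \<le> \<bar>Re w\<bar>" "A \<le> \<bar>A\<bar>" by linarith+
    ultimately have "dist w (pole k) > A" using k unfolding mult_1_right by linarith
    then obtain z where z: "z \<in> ball (pole k) \<delta> - {pole k}" "w = tanid z" using dA(3)[of w k] by blast
    then have "z \<in> regular_pts" using w dA(2) by (simp add: regular_pts_def)
    then show "w \<in> tanid ` regular_pts" using z by blast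
  qed
qed (auto simp: regular_pts_def)

lemma tanid_section:
  assumes P: "open P" "P \<subseteq> {z. cos z \<noteq> 0}" "inj_on tanid P" "ball w r \<subseteq> tanid ` P"
    and "ball w r \<subseteq> - crit_vals" "z \<in> P"
  shows "\<exists>g. continuous_on (ball w r) g \<and> g ` ball w r \<subseteq> regular_pts \<and>
      (\<forall>u\<in>ball w r. tanid (g u) = u) \<and> g (tanid z) = z"
proof -
  have "continuous_on P tanid" using tanid_cont P(2) by (rule continuous_on_subset)
  then obtain g where g: "homeomorphism P (tanid ` P) tanid g"
    using invariance_of_domain_homeomorphism[OF P(1) _ _ P(3)] by auto
  have "g u \<in> regular_pts \<and> tanid (g u) = u" if u: "u \<in> ball w r" for u
  proof -
    obtain p where "p \<in> P" "u = tanid p" using u P(4) by blast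
    moreover have "g (tanid p) = p" using g \<open>p \<in> P\<close> by (auto simp: homeomorphism_def)
    ultimately show ?thesis using u P(2) assms(5) by (auto simp: regular_pts_def)
  qed
  moreover have "continuous_on (ball w r) g" using g P(4) by (auto simp: homeomorphism_def intro: continuous_on_subset)
  moreover have "g (tanid z) = z" using g \<open>z \<in> P\<close> by (auto simp: homeomorphism_def)
  ultimately show ?thesis by (intro exI[of _ g]) auto
qed

text \<open>If no radius works, there are points \<open>z n\<close> whose values converge to \<open>w\<close> and
through which there is no section over the ball of radius \<open>r n\<close>, where \<open>r n\<close> tends
to zero. They are bounded: near a pole far from \<open>w\<close> a section is provided by
\<open>tanid_near_pole\<close>, and far from all poles \<open>z n - w\<close> is bounded because
\<open>tan\<close> is. A limit point is not a pole as the values stay bounded, so it lies over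
\<open>w\<close>; but then the local inverse there is a section through \<open>z n\<close> for large
\<open>n\<close>.\<close>

lemma tanid_uniform_sections:
  assumes w: "w \<notin> crit_vals"
  shows "\<exists>r>0. ball w r \<subseteq> - crit_vals \<and> (\<forall>z\<in>regular_pts. tanid z \<in> ball w r \<longrightarrow>
     (\<exists>g. continuous_on (ball w r) g \<and> g ` ball w r \<subseteq> regular_pts \<and>
      (\<forall>u\<in>ball w r. tanid (g u) = u) \<and> g (tanid z) = z))"
proof (rule ccontr)
  define sec where "sec r z \<longleftrightarrow> (\<exists>g. continuous_on (ball w r) g \<and> g ` ball w r \<subseteq> regular_pts \<and>
      (\<forall>u\<in>ball w r. tanid (g u) = u) \<and> g (tanid z) = z)" for r z
  assume "\<not> ?thesis"
  then have neg: "\<exists>z\<in>regular_pts. tanid z \<in> ball w r \<and> \<not> sec r z" if "r > 0" "ball w r \<subseteq> - crit_vals" for r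
    using that unfolding sec_def by blast
  obtain \<delta> A where dA: "\<delta> > 0" "\<And>k. inj_on tanid (ball (pole k) \<delta> - {pole k})"
    "\<And>k z. z \<in> ball (pole k) \<delta> - {pole k} \<Longrightarrow> cos z \<noteq> 0"
    "\<And>k w. dist w (pole k) > A \<Longrightarrow> w \<in> tanid ` (ball (pole k) \<delta> - {pole k})"
    using tanid_near_pole by metis
  obtain B where B: "\<And>z. (\<forall>k. dist z (pole k) \<ge> \<delta>) \<Longrightarrow> norm (tan z) \<le> B"
    using tan_bounded_off_poles[OF dA(1)] by metis
  have "open (- crit_vals)" using closed_crit_vals by (rule open_Compl)
  then obtain e where e: "e > 0" "ball w e \<subseteq> - crit_vals" using w openE[of "- crit_vals" w] by auto
  define r where "r n = min e 1 / real (Suc n)" for n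
  have r: "0 < r n" "r n \<le> e" "r n \<le> 1" for n
  proof -
    show "0 < r n" using e by (simp add: r_def)
    have "r n \<le> min e 1 / 1" unfolding r_def using e by (intro divide_left_mono) auto
    then show "r n \<le> e" "r n \<le> 1" by auto
  qed
  have rb: "ball w (r n) \<subseteq> - crit_vals" for n using e r by (meson ball_subset_cball order_trans subset_ball)
  have r0: "r \<longlonglongrightarrow> 0"
    unfolding r_def using tendsto_mult_left[OF LIMSEQ_inverse_real_of_nat, of "min e 1"] by (simp add: divide_inverse)
  obtain z where z: "\<And>n. z n \<in> regular_pts" "\<And>n. tanid (z n) \<in> ball w (r n)" "\<And>n. \<not> sec (r n) (z n)"
    using neg[OF r(1) rb] by metis
  have cz: "cos (z n) \<noteq> 0" for n using z(1)[of n] by (simp add: regular_pts_def)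
  have bd: "z n \<in> cball w (1 + \<bar>B\<bar> + \<bar>A\<bar> + \<delta>)" for n
  proof (cases "\<forall>k. dist (z n) (pole k) \<ge> \<delta>")
    case True
    then have "norm (tan (z n)) \<le> B" using B by simp
    moreover have "dist w (tanid (z n)) < 1" using z(2)[of n] r(3)[of n] by simp
    moreover have "dist w (z n) \<le> dist w (tanid (z n)) + dist (tanid (z n)) (z n)" by (rule dist_triangle)
    moreover have "dist (tanid (z n)) (z n) = norm (tan (z n))" by (simp add: tanid_def dist_norm)
    ultimately show ?thesis using dA(1) by simp
  next
    case False
    then obtain k where k: "dist (z n) (pole k) < \<delta>" by (auto simp: not_le)
    have "dist w (pole k) \<le> A + 1"
    proof (rule ccontr)
      assume *: "\<not> dist w (pole k) \<le> A + 1"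
      have "u \<in> tanid ` (ball (pole k) \<delta> - {pole k})" if "u \<in> ball w (r n)" for u
      proof (rule dA(4))
        have "dist w (pole k) \<le> dist w u + dist u (pole k)" by (rule dist_triangle)
        then show "A < dist u (pole k)" using * that r(3)[of n] by simp
      qed
      moreover have "z n \<in> ball (pole k) \<delta> - {pole k}"
        using k cz[of n] cos_0_iff_pole[of "z n"] by (auto simp: dist_commute)
      ultimately have "sec (r n) (z n)" unfolding sec_def
        using dA(2,3) rb by (intro tanid_section[where P = "ball (pole k) \<delta> - {pole k}"]) auto
      then show False using z(3) by blast
    qed
    moreover have "dist w (z n) \<le> dist w (pole k) + dist (pole k) (z n)" by (rule dist_triangle)
    ultimately show ?thesis using k by (simp add: dist_commute)
  qed
  then obtain \<zeta> s where s: "strict_mono s" "(z \<circ> s) \<longlonglongrightarrow> \<zeta>"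
    using compact_cball[of w "1 + \<bar>B\<bar> + \<bar>A\<bar> + \<delta>"] unfolding compact_def by metis
  have fz: "(\<lambda>n. tanid (z n)) \<longlonglongrightarrow> w"
  proof (rule metric_tendsto_imp_tendsto[OF r0])
    have "dist (tanid (z n)) w \<le> dist (r n) 0" for n
    proof -
      have "dist w (tanid (z n)) < r n" using z(2)[of n] by simp
      then show ?thesis using r(1)[of n] by (simp add: dist_commute)
    qed
    then show "\<forall>\<^sub>F n in sequentially. dist (tanid (z n)) w \<le> dist (r n) 0" by simp
  qed
  then have fzs: "(\<lambda>n. tanid ((z \<circ> s) n)) \<longlonglongrightarrow> w"
    using LIMSEQ_subseq_LIMSEQ[OF fz s(1)] by (simp add: o_def)
  show False
  proof (cases "cos \<zeta> = 0")
    case True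
    have "filterlim (z \<circ> s) (at \<zeta>) sequentially"
      using s(2) cz True by (intro filterlim_atI) (auto simp: eventually_sequentially)
    then have "filterlim (\<lambda>n. tanid ((z \<circ> s) n)) at_infinity sequentially"
      by (rule filterlim_compose[OF tanid_pole_infinity[OF True]])
    then show False using not_tendsto_and_filterlim_at_infinity[OF _ fzs] by simp
  next
    case False
    have "isCont tanid \<zeta>" using tanid_deriv[OF False] by (rule DERIV_isCont)
    then have "(\<lambda>n. tanid ((z \<circ> s) n)) \<longlonglongrightarrow> tanid \<zeta>" using s(2) by (rule isCont_tendsto_compose)
    then have fw: "tanid \<zeta> = w" using fzs LIMSEQ_unique by blast
    then have reg: "\<zeta> \<in> regular_pts" using False w by (simp add: regular_pts_def)
    obtain \<rho> where \<rho>: "\<rho> > 0" "ball \<zeta> \<rho> \<subseteq> {z. cos z \<noteq> 0}" "inj_on tanid (ball \<zeta> \<rho>)"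
      using tanid_locally_injective[OF reg] by metis
    have "open (tanid ` ball \<zeta> \<rho>)"
      using \<rho> tanid_cont by (intro invariance_of_domain) (auto intro: continuous_on_subset)
    moreover have "w \<in> tanid ` ball \<zeta> \<rho>" using fw \<rho>(1) by force
    ultimately obtain d where d: "d > 0" "ball w d \<subseteq> tanid ` ball \<zeta> \<rho>" using openE by metis
    have "\<forall>\<^sub>F n in sequentially. (z \<circ> s) n \<in> ball \<zeta> \<rho>"
      using s(2) open_ball[of \<zeta> \<rho>] \<rho>(1) by (intro topological_tendstoD[of "z \<circ> s" \<zeta> sequentially "ball \<zeta> \<rho>"]) auto
    moreover have "\<forall>\<^sub>F n in sequentially. (r \<circ> s) n < d"
      using LIMSEQ_subseq_LIMSEQ[OF r0 s(1)] d(1) by (rule order_tendstoD(2))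
    ultimately have "\<forall>\<^sub>F n in sequentially. (z \<circ> s) n \<in> ball \<zeta> \<rho> \<and> (r \<circ> s) n < d" by (rule eventually_conj)
    then obtain n where n: "z (s n) \<in> ball \<zeta> \<rho>" "r (s n) < d" by (auto simp: eventually_sequentially)
    have "ball w (r (s n)) \<subseteq> ball w d" using n by (intro subset_ball) simp
    then have "sec (r (s n)) (z (s n))" unfolding sec_def
      using \<rho> d n rb by (intro tanid_section[where P = "ball \<zeta> \<rho>"]) blast+
    then show False using z(3) by blast
  qed
qed

theorem tanid_covering: "covering_space regular_pts tanid (- crit_vals)"
proof (rule covering_space_from_sections)
  show "open regular_pts" by (rule open_regular_pts)
  show "continuous_on regular_pts tanid"
    using tanid_cont by (rule continuous_on_subset) (auto simp: regular_pts_def)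
  show "tanid ` regular_pts = - crit_vals" by (rule tanid_onto)
  show "open (- crit_vals)" using closed_crit_vals by (rule open_Compl)
  show "\<exists>O'. open O' \<and> z \<in> O' \<and> inj_on tanid O'" if z: "z \<in> regular_pts" for z
  proof -
    obtain r where "r > 0" "inj_on tanid (ball z r)" using tanid_locally_injective[OF z] by metis
    then show ?thesis by (intro exI[of _ "ball z r"]) simp
  qed
  fix w assume "w \<in> - crit_vals"
  then show "\<exists>r>0. ball w r \<subseteq> - crit_vals \<and> (\<forall>z\<in>regular_pts. tanid z \<in> ball w r \<longrightarrow>
     (\<exists>g. continuous_on (ball w r) g \<and> g ` ball w r \<subseteq> regular_pts \<and>
      (\<forall>u\<in>ball w r. tanid (g u) = u) \<and> g (tanid z) = z))"
    by (intro tanid_uniform_sections) simp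
qed

section \<open>Permutations in the gaps of a row of squares\<close>

abbreviation swap :: "'a \<Rightarrow> 'a \<Rightarrow> 'a \<Rightarrow> 'a" where
  "swap \<equiv> Transposition.transpose"

text \<open>The effect on the gap permutations of a half twist that interchanges the squares \<open>k\<close> and
\<open>k + 1\<close>.\<close>

definition twist :: "int \<Rightarrow> (int \<Rightarrow> 'a \<Rightarrow> 'a) \<Rightarrow> int \<Rightarrow> 'a \<Rightarrow> 'a" where
  "twist k \<pi> = \<pi>(k := \<pi> (k + 1) \<circ> inv (\<pi> k) \<circ> \<pi> (k - 1))"

text \<open>A configuration consists of the permutations \<open>\<pi> k\<close> in the gaps between the squares
\<open>k\<close> and \<open>k + 1\<close>, and of the positions \<open>pos c\<close> of the lakes. Moves are
made on behalf of the lake of class \<open>j\<close>. A twist at \<open>k\<close> moves the square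
\<open>k\<close> below its right neighbour, so that sheets on the upper side lose track of what was at
\<open>k\<close>; this is why \<open>pos j\<close> must not be \<open>k\<close>. Only the lake
\<open>j\<close> itself may grow, and it may not run into another lake.\<close>

inductive move :: "nat \<Rightarrow> (int \<Rightarrow> 'a \<Rightarrow> 'a) \<times> (nat \<Rightarrow> int) \<Rightarrow> (int \<Rightarrow> 'a \<Rightarrow> 'a) \<times> (nat \<Rightarrow> int) \<Rightarrow> bool"
  for j where
  twist: "pos j \<noteq> k \<Longrightarrow> move j (\<pi>, pos) (twist k \<pi>, swap k (k + 1) \<circ> pos)"
| merge: "pos j + 1 \<notin> range pos \<Longrightarrow> move j (\<pi>, pos) (\<pi>(pos j := \<pi> (pos j + 1)), pos)"

abbreviation "moves j \<equiv> (move j)\<^sup>*\<^sup>*"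

text \<open>The row \<open>\<rho>\<close> with two adjacent squares \<open>p + 1\<close> and \<open>p + 2\<close>
inserted into its gap \<open>p\<close>. Passing between them multiplies by the transposition of
\<open>x\<close> and \<open>a\<close>, so each behaves like a simple branch point exchanging these two
sheets. The label \<open>a\<close> is going to be one that occurs nowhere else in the row.\<close>

definition insert_pair :: "(int \<Rightarrow> 'a \<Rightarrow> 'a) \<Rightarrow> int \<Rightarrow> 'a \<Rightarrow> 'a \<Rightarrow> int \<Rightarrow> 'a \<Rightarrow> 'a" where
  "insert_pair \<rho> p x a k = (if k \<le> p then \<rho> k else if k = p + 1 then \<rho> p \<circ> swap x a else \<rho> (k - 2))"

lemma bij_conj_swap:
  assumes "bij g"
  shows "g \<circ> swap x y \<circ> inv g = swap (g x) (g y)"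
proof
  fix u
  have "g (inv g u) = u" using assms by (simp add: bij_is_surj surj_f_inv_f)
  moreover have "inv g u = x \<longleftrightarrow> u = g x" "inv g u = y \<longleftrightarrow> u = g y"
    using assms by (metis bij_inv_eq_iff)+
  ultimately show "(g \<circ> swap x y \<circ> inv g) u = swap (g x) (g y) u"
    by (auto simp: Transposition.transpose_def)
qed

lemma notin_rangeI: "(\<And>c. f c \<noteq> x) \<Longrightarrow> x \<notin> range f"
  by auto

lemma bij_twist: "(\<And>k. bij (\<pi> k)) \<Longrightarrow> bij (twist l \<pi> k)"
  by (simp add: twist_def bij_comp bij_imp_bij_inv)

lemma bij_cancel: "bij g \<Longrightarrow> g (inv g v) = v" "bij g \<Longrightarrow> inv g (g u) = u"
  by (simp_all add: bij_is_surj surj_f_inv_f bij_is_inj)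

lemma inv_comp_swap:
  assumes "bij g"
  shows "inv (g \<circ> swap x y) = swap x y \<circ> inv g"
  by (rule inv_unique_comp) (simp_all add: fun_eq_iff bij_cancel[OF assms])

context
  fixes \<rho> :: "int \<Rightarrow> 'a \<Rightarrow> 'a" and a :: 'a
  assumes bij: "\<And>k. bij (\<rho> k)" and fix_a: "\<And>k. \<rho> k a = a"
begin

lemma inv_a: "inv (\<rho> k) a = a"
  using bij fix_a by (metis bij_cancel(2))

text \<open>A pair that jumps to the left over the square \<open>p\<close> keeps its label on the upper side, and
\<open>x\<close> is a label of the lower side. The new label on the lower side is therefore obtained by
going up through gap \<open>p\<close> and down through gap \<open>p - 1\<close>. A pair that jumps to the
right passes below instead and keeps \<open>x\<close> (\<open>pair_right_gaps\<close>).\<close>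

lemma pair_left_gaps:
  "twist (p + 1) (twist p (insert_pair \<rho> p x a)) = insert_pair \<rho> (p - 1) (inv (\<rho> (p - 1)) (\<rho> p x)) a"
proof -
  let ?g = "inv (\<rho> (p - 1)) \<circ> \<rho> p"
  have bg: "bij ?g" by (intro bij_comp bij_imp_bij_inv bij)
  have ig: "inv ?g = inv (\<rho> p) \<circ> \<rho> (p - 1)"
    by (rule inv_unique_comp) (auto simp: fun_eq_iff bij_cancel[OF bij])
  have c: "?g \<circ> swap x a \<circ> inv ?g = swap (?g x) a"
    using bij_conj_swap[OF bg, of x a] by (simp add: fix_a inv_a)
  have T: "\<rho> (p - 1) \<circ> swap (?g x) a = \<rho> p \<circ> swap x a \<circ> inv (\<rho> p) \<circ> \<rho> (p - 1)"
    unfolding c[symmetric] ig by (auto simp: fun_eq_iff bij_cancel[OF bij])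
  have 1: "twist p (insert_pair \<rho> p x a) =
     (insert_pair \<rho> p x a)(p := \<rho> (p - 1) \<circ> swap (?g x) a)"
    unfolding T twist_def by (auto simp: insert_pair_def fun_eq_iff)
  have 2: "inv (\<rho> p \<circ> swap x a) = swap x a \<circ> inv (\<rho> p)"
    by (rule inv_comp_swap[OF bij])
  have 3: "\<rho> p \<circ> inv (\<rho> p \<circ> swap x a) \<circ> (\<rho> (p - 1) \<circ> swap (?g x) a) = \<rho> (p - 1)"
    unfolding 2 T by (auto simp: fun_eq_iff bij_cancel[OF bij])
  show ?thesis
    unfolding 1 using 3
    by (intro ext) (auto simp: twist_def insert_pair_def)
qed

lemma pair_right_gaps:
  "twist (p + 1) (twist (p + 2) (insert_pair \<rho> p x a)) = insert_pair \<rho> (p + 1) x a"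
proof -
  have 1: "\<rho> (p + 1) \<circ> inv (\<rho> p) \<circ> (\<rho> p \<circ> swap x a) = \<rho> (p + 1) \<circ> swap x a"
    by (auto simp: fun_eq_iff bij_cancel[OF bij])
  have 2: "twist (p + 2) (insert_pair \<rho> p x a) =
     (insert_pair \<rho> p x a)(p + 2 := \<rho> (p + 1) \<circ> swap x a)"
  proof -
    have e: "p + 2 + 1 - 2 = p + 1" by simp
    have "insert_pair \<rho> p x a (p + 2 + 1) = \<rho> (p + 2 + 1 - 2)" by (simp add: insert_pair_def)
    then have "insert_pair \<rho> p x a (p + 2 + 1) = \<rho> (p + 1)" by (simp only: e)
    moreover have "insert_pair \<rho> p x a (p + 2) = \<rho> p" "insert_pair \<rho> p x a (p + 2 - 1) = \<rho> p \<circ> swap x a"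
      by (auto simp: insert_pair_def)
    ultimately show ?thesis unfolding 1[symmetric] twist_def by simp
  qed
  have 3: "\<rho> (p + 1) \<circ> swap x a \<circ> inv (\<rho> p \<circ> swap x a) \<circ> \<rho> p = \<rho> (p + 1)"
    unfolding inv_comp_swap[OF bij] by (auto simp: fun_eq_iff bij_cancel[OF bij])
  show ?thesis
    unfolding 2 using 3
    by (intro ext) (auto simp: twist_def insert_pair_def)
qed

lemma pair_left:
  assumes "pos j < p" "p + 1 \<notin> range pos" "p + 2 \<notin> range pos"
  shows "moves j (insert_pair \<rho> p x a, pos)
    (insert_pair \<rho> (p - 1) (inv (\<rho> (p - 1)) (\<rho> p x)) a, \<lambda>c. if pos c = p then p + 2 else pos c)"
proof -
  let ?q = "swap p (p + 1) \<circ> pos"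
  have pr: "pos c \<noteq> p + 1" "pos c \<noteq> p + 2" "pos c \<noteq> 2 + p" for c
    using assms(2,3) by (metis rangeI add.commute)+
  have 1: "move j (insert_pair \<rho> p x a, pos) (twist p (insert_pair \<rho> p x a), ?q)"
    using assms by (intro move.twist) auto
  have 2: "move j (twist p (insert_pair \<rho> p x a), ?q)
     (twist (p + 1) (twist p (insert_pair \<rho> p x a)), swap (p + 1) (p + 1 + 1) \<circ> ?q)"
    using assms by (intro move.twist) (auto simp: Transposition.transpose_def)
  have 3: "swap (p + 1) (p + 1 + 1) \<circ> ?q = (\<lambda>c. if pos c = p then p + 2 else pos c)"
    using pr by (auto simp: Transposition.transpose_def fun_eq_iff)
  show ?thesis
    using 1 2 unfolding 3 pair_left_gaps by (meson converse_rtranclp_into_rtranclp r_into_rtranclp)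
qed

lemma pair_right:
  assumes "pos j < p + 1" "p + 1 \<notin> range pos" "p + 2 \<notin> range pos"
  shows "moves j (insert_pair \<rho> p x a, pos)
    (insert_pair \<rho> (p + 1) x a, \<lambda>c. if pos c = p + 3 then p + 1 else pos c)"
proof -
  let ?q = "swap (p + 2) (p + 2 + 1) \<circ> pos"
  have pr: "pos c \<noteq> p + 1" "pos c \<noteq> p + 2" "pos c \<noteq> 2 + p" for c
    using assms(2,3) by (metis rangeI add.commute)+
  have 1: "move j (insert_pair \<rho> p x a, pos) (twist (p + 2) (insert_pair \<rho> p x a), ?q)"
    using assms by (intro move.twist) auto
  have 2: "move j (twist (p + 2) (insert_pair \<rho> p x a), ?q)
     (twist (p + 1) (twist (p + 2) (insert_pair \<rho> p x a)), swap (p + 1) (p + 1 + 1) \<circ> ?q)"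
    using assms by (intro move.twist) (auto simp: Transposition.transpose_def)
  have 3: "swap (p + 1) (p + 1 + 1) \<circ> ?q = (\<lambda>c. if pos c = p + 3 then p + 1 else pos c)"
    using pr by (auto simp: Transposition.transpose_def fun_eq_iff)
  show ?thesis
    using 1 2 unfolding 3 pair_right_gaps by (meson converse_rtranclp_into_rtranclp r_into_rtranclp)
qed

lemma pair_left_many:
  assumes "pos j \<le> q" "q + int n + 1 \<notin> range pos" "q + int n + 2 \<notin> range pos"
  shows "moves j (insert_pair \<rho> (q + int n) x a, pos)
    (insert_pair \<rho> q (inv (\<rho> q) (\<rho> (q + int n) x)) a,
     \<lambda>c. if q < pos c \<and> pos c \<le> q + int n then pos c + 2 else pos c)"
  using assms
proof (induction n arbitrary: pos x)
  case 0
  have "(\<lambda>c. if q < pos c \<and> pos c \<le> q + int 0 then pos c + 2 else pos c) = pos" by auto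
  then show ?case by (simp add: bij_cancel[OF bij])
next
  case (Suc n)
  let ?p = "q + int (Suc n)"
  let ?x = "inv (\<rho> (?p - 1)) (\<rho> ?p x)"
  let ?pos = "\<lambda>c. if pos c = ?p then ?p + 2 else pos c"
  have 1: "moves j (insert_pair \<rho> ?p x a, pos) (insert_pair \<rho> (?p - 1) ?x a, ?pos)"
    using Suc.prems by (intro pair_left) auto
  have e: "?p - 1 = q + int n" by simp
  have 2: "moves j (insert_pair \<rho> (q + int n) ?x a, ?pos)
    (insert_pair \<rho> q (inv (\<rho> q) (\<rho> (q + int n) ?x)) a,
     \<lambda>c. if q < ?pos c \<and> ?pos c \<le> q + int n then ?pos c + 2 else ?pos c)"
  proof (rule Suc.IH)
    show "?pos j \<le> q" using Suc.prems by auto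
    have ne: "?pos c \<noteq> q + int n + 1 \<and> ?pos c \<noteq> q + int n + 2" for c
    proof -
      have "pos c \<noteq> q + int (Suc n) + 1" using Suc.prems(2) by (metis rangeI)
      then show ?thesis by auto
    qed
    show "q + int n + 1 \<notin> range ?pos" "q + int n + 2 \<notin> range ?pos"
      by (rule notin_rangeI, use ne in blast)+
  qed
  have 3: "\<rho> (q + int n) ?x = \<rho> ?p x" unfolding e by (simp add: bij_cancel[OF bij])
  have 4: "(\<lambda>c. if q < ?pos c \<and> ?pos c \<le> q + int n then ?pos c + 2 else ?pos c)
     = (\<lambda>c. if q < pos c \<and> pos c \<le> ?p then pos c + 2 else pos c)" (is "?l = ?r")
  proof
    fix c
    show "?l c = ?r c" by (cases "pos c = ?p") auto
  qed
  show ?case using rtranclp_trans[OF 1[unfolded e] 2[unfolded e]] unfolding 4 3[unfolded e] .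
qed

lemma pair_right_many:
  assumes "pos j \<le> q" "q + 1 \<notin> range pos" "q + 2 \<notin> range pos"
  shows "moves j (insert_pair \<rho> q x a, pos)
    (insert_pair \<rho> (q + int n) x a,
     \<lambda>c. if q + 2 < pos c \<and> pos c \<le> q + int n + 2 then pos c - 2 else pos c)"
proof (induction n)
  case 0
  have "(\<lambda>c. if q + 2 < pos c \<and> pos c \<le> q + int 0 + 2 then pos c - 2 else pos c) = pos" by auto
  then show ?case by simp
next
  case (Suc n)
  let ?p = "q + int n"
  let ?pos = "\<lambda>c. if q + 2 < pos c \<and> pos c \<le> q + int n + 2 then pos c - 2 else pos c"
  have n1: "?p + 1 \<notin> range ?pos" "?p + 2 \<notin> range ?pos"
  proof -
    have ne: "?pos c \<noteq> ?p + 1 \<and> ?pos c \<noteq> ?p + 2" for c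
    proof -
      have "pos c \<noteq> q + 1" "pos c \<noteq> q + 2" using assms(2,3) by (metis rangeI)+
      then show ?thesis by auto
    qed
    show "?p + 1 \<notin> range ?pos" "?p + 2 \<notin> range ?pos" by (rule notin_rangeI, use ne in blast)+
  qed
  have 1: "moves j (insert_pair \<rho> ?p x a, ?pos)
    (insert_pair \<rho> (?p + 1) x a, \<lambda>c. if ?pos c = ?p + 3 then ?p + 1 else ?pos c)"
    using assms n1 by (intro pair_right) auto
  have 2: "(\<lambda>c. if ?pos c = ?p + 3 then ?p + 1 else ?pos c) =
     (\<lambda>c. if q + 2 < pos c \<and> pos c \<le> q + int (Suc n) + 2 then pos c - 2 else pos c)" (is "?l = ?r")
  proof
    fix c
    consider "pos c \<le> q + 2" | "q + 2 < pos c" "pos c \<le> q + int n + 2" | "pos c = q + int n + 3"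
      | "q + int n + 3 < pos c" by linarith
    then show "?l c = ?r c" by cases simp_all
  qed
  have e: "?p + 1 = q + int (Suc n)" by simp
  show ?case using Suc.IH 1 unfolding 2 unfolding e by (rule rtranclp_trans)
qed

text \<open>On the way out the pair keeps its upper label, on the way back its lower one; so an excursion to
\<open>q\<close> changes the label \<open>x\<close> although everything returns to its place. This is how
the pair acquires a prescribed label.\<close>

lemma pair_walk:
  assumes "pos j \<le> q" "q \<le> p" "p + 1 \<notin> range pos" "p + 2 \<notin> range pos"
  shows "moves j (insert_pair \<rho> p x a, pos) (insert_pair \<rho> p (inv (\<rho> q) (\<rho> p x)) a, pos)"
proof -
  obtain n where p: "p = q + int n" using assms(2) zle_iff_zadd by blast
  let ?pos = "\<lambda>c. if q < pos c \<and> pos c \<le> q + int n then pos c + 2 else pos c"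
  have 1: "moves j (insert_pair \<rho> p x a, pos) (insert_pair \<rho> q (inv (\<rho> q) (\<rho> p x)) a, ?pos)"
    using assms unfolding p by (intro pair_left_many) auto
  have nr: "q + 1 \<notin> range ?pos \<and> q + 2 \<notin> range ?pos"
  proof -
    have ne: "?pos c \<noteq> q + 1 \<and> ?pos c \<noteq> q + 2" for c
    proof -
      have "pos c \<noteq> p + 1" "pos c \<noteq> p + 2" using assms(3,4) by (metis rangeI)+
      then show ?thesis using p by auto
    qed
    show ?thesis by (rule conjI; rule notin_rangeI, use ne in blast)
  qed
  have 2: "moves j (insert_pair \<rho> q (inv (\<rho> q) (\<rho> p x)) a, ?pos)
    (insert_pair \<rho> (q + int n) (inv (\<rho> q) (\<rho> p x)) a,
     \<lambda>c. if q + 2 < ?pos c \<and> ?pos c \<le> q + int n + 2 then ?pos c - 2 else ?pos c)"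
    using assms nr by (intro pair_right_many) auto
  have 3: "(\<lambda>c. if q + 2 < ?pos c \<and> ?pos c \<le> q + int n + 2 then ?pos c - 2 else ?pos c) = pos"
  proof
    fix c
    have "pos c \<noteq> p + 1" "pos c \<noteq> p + 2" using assms(3,4) by (metis rangeI)+
    then show "(if q + 2 < ?pos c \<and> ?pos c \<le> q + int n + 2 then ?pos c - 2 else ?pos c) = pos c"
      using p by auto
  qed
  show ?thesis using 1 2 unfolding 3 unfolding p by (rule rtranclp_trans)
qed

text \<open>The right square of the pair next to the lake is led to the right below its neighbours as far as position
\<open>i + q + 2\<close>, and back above them. This loop conjugates its transposition by the permutations
that it passes, which turns \<open>(z a)\<close> into \<open>(\<rho> (i + q) z, a)\<close>. Swallowing both
squares multiplies the permutation of the lake by both transpositions, one on each side.\<close>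

lemma loop_and_merge:
  fixes i :: int and z :: 'a and q :: nat
  assumes "pos j = i" "i + 1 \<notin> range pos" "i + 2 \<notin> range pos" and q: "0 < q"
  defines "\<tau> \<equiv> swap z a" and "T \<equiv> swap (\<rho> (i + int q) z) a"
  shows "moves j (insert_pair \<rho> i z a, pos)
    (\<lambda>k. if k < i then \<rho> k else if k \<le> i + 2 then T \<circ> \<rho> i \<circ> \<tau>
         else if k < i + int q + 2 then T \<circ> \<rho> (k - 2) \<circ> \<tau> else \<rho> (k - 2), pos)"
proof -
  \<comment> \<open>\<open>L n\<close> is the row when the right square of the pair has moved \<open>n\<close> steps to the
  right. From \<open>L q = M q\<close> a square returns through the rows \<open>M n\<close>, now with the
  transposition \<open>T\<close>, until the pair is together again in \<open>M 0\<close>.\<close>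
  define L where "L n k = (if k \<le> i then \<rho> k else if k \<le> i + 1 + int n then \<rho> (k - 1) \<circ> \<tau>
      else \<rho> (k - 2))" for n k
  define M where "M n k = (if k \<le> i then \<rho> k else if k \<le> i + 1 + int n then \<rho> (k - 1) \<circ> \<tau>
      else if k \<le> i + 1 + int q then T \<circ> \<rho> (k - 2) \<circ> \<tau> else \<rho> (k - 2))" for n k
  define posR where "posR n = (\<lambda>c. if i + 3 \<le> pos c \<and> pos c \<le> i + 2 + int n then pos c - 1 else pos c)" for n
  have pr: "pos c \<noteq> i + 1" "pos c \<noteq> i + 2" for c using assms(2,3) by (metis rangeI)+
  have \<tau>2: "\<tau> \<circ> \<tau> = id" by (auto simp: \<tau>_def)
  have inv\<tau>: "inv (\<rho> k \<circ> \<tau>) = \<tau> \<circ> inv (\<rho> k)" for k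
    unfolding \<tau>_def by (rule inv_comp_swap[OF bij])
  have T: "\<rho> (i + int q) \<circ> \<tau> \<circ> inv (\<rho> (i + int q)) = T"
    unfolding T_def \<tau>_def using bij_conj_swap[OF bij] by (simp add: fix_a)
  have up: "moves j (L 0, posR 0) (L n, posR n)" for n
  proof (induction n)
    case (Suc n)
    have 1: "\<rho> (i + 1 + int n) \<circ> inv (\<rho> (i + int n)) \<circ> (\<rho> (i + int n) \<circ> \<tau>) = \<rho> (i + 1 + int n) \<circ> \<tau>"
      by (auto simp: fun_eq_iff bij_cancel[OF bij])
    have "twist (i + 2 + int n) (L n) = (L n)(i + 2 + int n := \<rho> (i + 1 + int n) \<circ> \<tau>)"
    proof -
      have "L n (i + 2 + int n + 1) = \<rho> (i + 2 + int n + 1 - 2)" "L n (i + 2 + int n) = \<rho> (i + 2 + int n - 2)"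
        "L n (i + 2 + int n - 1) = \<rho> (i + 2 + int n - 1 - 1) \<circ> \<tau>"
        by (auto simp: L_def)
      moreover have "i + 2 + int n + 1 - 2 = i + 1 + int n" "i + 2 + int n - 2 = i + int n" "i + 2 + int n - 1 - 1 = i + int n"
        by auto
      ultimately show ?thesis unfolding 1[symmetric] twist_def by (simp only:)
    qed
    also have "\<dots> = L (Suc n)"
    proof
      fix k
      show "((L n)(i + 2 + int n := \<rho> (i + 1 + int n) \<circ> \<tau>)) k = L (Suc n) k"
      proof (cases "k = i + 2 + int n")
        case True
        have e: "i + 2 + int n - 1 = i + 1 + int n" by simp
        have "L (Suc n) (i + 2 + int n) = \<rho> (i + 2 + int n - 1) \<circ> \<tau>" by (auto simp: L_def)
        then show ?thesis unfolding True e by (simp only: fun_upd_same)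
      qed (auto simp: L_def)
    qed
    finally have 2: "twist (i + 2 + int n) (L n) = L (Suc n)" .
    have 3: "swap (i + 2 + int n) (i + 2 + int n + 1) \<circ> posR n = posR (Suc n)"
    proof
      fix c
      consider "pos c \<le> i" | "i + 3 \<le> pos c" "pos c \<le> i + 2 + int n" | "pos c = i + 3 + int n"
        | "i + 3 + int n < pos c" using pr[of c] by linarith
      then show "(swap (i + 2 + int n) (i + 2 + int n + 1) \<circ> posR n) c = posR (Suc n) c"
        by cases (auto simp: posR_def Transposition.transpose_def)
    qed
    have "move j (L n, posR n) (twist (i + 2 + int n) (L n), swap (i + 2 + int n) (i + 2 + int n + 1) \<circ> posR n)"
      using assms(1) by (intro move.twist) (simp add: posR_def)
    then show ?case using Suc.IH unfolding 2 3 by (rule rtranclp.rtrancl_into_rtrancl[rotated])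
  qed auto
  have down: "n \<le> q \<Longrightarrow> moves j (M q, posR q) (M (q - n), posR (q - n))" for n
  proof (induction n)
    case (Suc n)
    define m where "m = q - Suc n"
    have m: "q - n = Suc m" "m < q" using Suc.prems by (auto simp: m_def)
    let ?k = "i + 2 + int m"
    have "M (Suc m) (?k + 1) \<circ> inv (M (Suc m) ?k) \<circ> M (Suc m) (?k - 1) = T \<circ> \<rho> (i + int m) \<circ> \<tau>"
    proof -
      have e: "?k - 1 = i + 1 + int m" "?k - 1 - 1 = i + int m" "?k + 1 - 2 = i + 1 + int m"
        "i + 1 + int m - 1 = i + int m" by auto
      have "M (Suc m) ?k = \<rho> (?k - 1) \<circ> \<tau>" "M (Suc m) (?k - 1) = \<rho> (?k - 1 - 1) \<circ> \<tau>"
        by (auto simp: M_def)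
      then have a: "M (Suc m) ?k = \<rho> (i + 1 + int m) \<circ> \<tau>" "M (Suc m) (?k - 1) = \<rho> (i + int m) \<circ> \<tau>"
        by (simp_all only: e)
      show ?thesis
      proof (cases "Suc m = q")
        case True
        then have qq: "int q = int m + 1" by auto
        have "M (Suc m) (?k + 1) = \<rho> (?k + 1 - 2)" using True by (auto simp: M_def)
        then have b: "M (Suc m) (?k + 1) = \<rho> (i + 1 + int m)" by (simp only: e)
        have "i + int q = i + 1 + int m" using qq by simp
        then show ?thesis unfolding a b inv\<tau> T[symmetric] by (simp only: o_assoc)
      next
        case False
        then have "M (Suc m) (?k + 1) = T \<circ> \<rho> (?k + 1 - 2) \<circ> \<tau>" using m by (auto simp: M_def)
        then have b: "M (Suc m) (?k + 1) = T \<circ> \<rho> (i + 1 + int m) \<circ> \<tau>" by (simp only: e)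
        have \<tau>3: "\<tau> (\<tau> u) = u" for u by (simp add: \<tau>_def)
        show ?thesis unfolding a b inv\<tau> by (simp add: fun_eq_iff bij_cancel[OF bij] \<tau>3)
      qed
    qed
    then have "twist ?k (M (Suc m)) = (M (Suc m))(?k := T \<circ> \<rho> (i + int m) \<circ> \<tau>)"
      unfolding twist_def by simp
    also have "\<dots> = M m"
    proof
      fix k
      show "((M (Suc m))(?k := T \<circ> \<rho> (i + int m) \<circ> \<tau>)) k = M m k"
      proof (cases "k = ?k")
        case True
        have e: "?k - 2 = i + int m" by simp
        have "M m ?k = T \<circ> \<rho> (?k - 2) \<circ> \<tau>" using m by (auto simp: M_def)
        then show ?thesis unfolding True e by (simp only: fun_upd_same)
      qed (use m in \<open>auto simp: M_def\<close>)
    qed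
    finally have 2: "twist ?k (M (Suc m)) = M m" .
    have 3: "swap ?k (?k + 1) \<circ> posR (Suc m) = posR m"
    proof
      fix c
      consider "pos c \<le> i" | "i + 3 \<le> pos c" "pos c \<le> i + 2 + int m" | "pos c = i + 3 + int m"
        | "i + 3 + int m < pos c" using pr[of c] by linarith
      then show "(swap ?k (?k + 1) \<circ> posR (Suc m)) c = posR m c"
        by cases (auto simp: posR_def Transposition.transpose_def)
    qed
    have "move j (M (Suc m), posR (Suc m)) (twist ?k (M (Suc m)), swap ?k (?k + 1) \<circ> posR (Suc m))"
      using assms(1) by (intro move.twist) (simp add: posR_def)
    then have "move j (M (q - n), posR (q - n)) (M (q - Suc n), posR (q - Suc n))"
      unfolding 2 3 m m_def[symmetric] .
    with Suc.IH Suc.prems show ?case by (auto intro: rtranclp.rtrancl_into_rtrancl)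
  qed auto
  have LM: "L q = M q" by (auto simp: L_def M_def fun_eq_iff)
  have L0: "L 0 = insert_pair \<rho> i z a" by (auto simp: L_def insert_pair_def fun_eq_iff \<tau>_def)
  have p0: "posR 0 = pos" by (auto simp: posR_def)
  have A: "moves j (insert_pair \<rho> i z a, pos) (M 0, pos)"
    using up[of q] down[of q] unfolding LM L0 p0 by (simp add: p0)
  \<comment> \<open>Swallow one square, twist the other one into the neighbouring place, and swallow it too.\<close>
  define N1 where "N1 = (M 0)(i := M 0 (i + 1))"
  define N2 where "N2 = twist (i + 1) N1"
  define N3 where "N3 = N2(i := N2 (i + 1))"
  have B: "move j (M 0, pos) (N1, pos)"
    using move.merge[of pos j "M 0"] assms(1,2) by (simp add: N1_def)
  have pp: "swap (i + 1) (i + 1 + 1) \<circ> pos = pos"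
  proof
    fix c
    show "(swap (i + 1) (i + 1 + 1) \<circ> pos) c = pos c"
      using pr[of c] by (simp add: Transposition.transpose_def)
  qed
  have C: "move j (N1, pos) (N2, pos)"
    using move.twist[of pos j "i + 1" N1] assms(1) unfolding pp N2_def by simp
  have D: "move j (N2, pos) (N3, pos)"
    using move.merge[of pos j N2] assms(1,2) by (simp add: N3_def)
  have M01: "M 0 (i + 1) = \<rho> i \<circ> \<tau>" "M 0 (i + 2) = T \<circ> \<rho> i \<circ> \<tau>"
    using q by (auto simp: M_def)
  have x: "N1 (i + 2) = T \<circ> \<rho> i \<circ> \<tau>" "N1 (i + 1) = \<rho> i \<circ> \<tau>" "N1 i = \<rho> i \<circ> \<tau>"
    using M01 by (simp_all add: N1_def)
  have N2: "N2 (i + 1) = T \<circ> \<rho> i \<circ> \<tau>"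
  proof -
    have bt: "bij (\<rho> i \<circ> \<tau>)" using bij by (auto simp: \<tau>_def intro: bij_comp)
    have e: "i + 1 + 1 = i + 2" "i + 1 - 1 = i" by simp_all
    have "N2 (i + 1) = N1 (i + 1 + 1) \<circ> inv (N1 (i + 1)) \<circ> N1 (i + 1 - 1)"
      by (simp only: N2_def twist_def fun_upd_same)
    moreover have "inv (\<rho> i \<circ> \<tau>) \<circ> (\<rho> i \<circ> \<tau>) = id"
      using bt by (rule inv_o_cancel[OF bij_is_inj])
    ultimately show ?thesis unfolding e x by (simp only: o_assoc[symmetric] o_id)
  qed
  have N3i: "N3 i = T \<circ> \<rho> i \<circ> \<tau>" unfolding N3_def N2[symmetric] by simp
  have N3o: "N3 k = N2 k" if "k \<noteq> i" for k using that by (simp add: N3_def)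
  have N2o: "N2 k = N1 k" if "k \<noteq> i + 1" for k using that by (simp add: N2_def twist_def)
  have N1o: "N1 k = M 0 k" if "k \<noteq> i" for k using that by (simp add: N1_def)
  have F: "N3 = (\<lambda>k. if k < i then \<rho> k else if k \<le> i + 2 then T \<circ> \<rho> i \<circ> \<tau>
         else if k < i + int q + 2 then T \<circ> \<rho> (k - 2) \<circ> \<tau> else \<rho> (k - 2))"
    (is "_ = ?F")
  proof
    fix k
    consider "k < i" | "k = i" | "k = i + 1" | "k = i + 2" | "k > i + 2" by linarith
    then show "N3 k = ?F k"
    proof cases
      case 1
      then have "N3 k = M 0 k" using N3o[of k] N2o[of k] N1o[of k] by auto
      then show ?thesis using 1 by (simp add: M_def)
    next
      case 2 then show ?thesis using N3i by simp
    next
      case 3 then show ?thesis using N2 N3o[of k] by simp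
    next
      case 4
      then have "N3 k = N1 (i + 2)" using N3o[of k] N2o[of k] by auto
      then show ?thesis using 4 x by simp
    next
      case 5
      then have "N3 k = M 0 k" using N3o[of k] N2o[of k] N1o[of k] by auto
      then show ?thesis using 5 by (simp add: M_def)
    qed
  qed
  have "moves j (insert_pair \<rho> i z a, pos) (N3, pos)"
    using A B C D by (meson rtranclp.rtrancl_into_rtrancl)
  then show ?thesis unfolding F .
qed

end

text \<open>The label that is exchanged with \<open>0\<close> by the two critical values in column \<open>m\<close> of
the initial picture; as \<open>m\<close> ranges over the integers it takes every value but \<open>0\<close>,
once.\<close>

definition slit_label :: "int \<Rightarrow> int" where
  "slit_label m = (if 0 \<le> m then m + 1 else m)"

text \<open>Column \<open>m\<close> consists of the squares \<open>3 m\<close>, \<open>3 m + 1\<close>, \<open>3 m +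
2\<close>; it is standard if it looks as in the initial picture and its label is fixed in all other gaps.\<close>

definition standard_at :: "(int \<Rightarrow> int \<Rightarrow> int) \<Rightarrow> (nat \<Rightarrow> int) \<Rightarrow> int \<Rightarrow> bool" where
  "standard_at \<pi> pos m \<longleftrightarrow> \<pi> (3 * m) = id \<and> \<pi> (3 * m + 1) = swap 0 (slit_label m) \<and> \<pi> (3 * m + 2) = id \<and>
     (\<forall>k. k \<noteq> 3 * m + 1 \<longrightarrow> \<pi> k (slit_label m) = slit_label m) \<and>
     3 * m + 1 \<notin> range pos \<and> 3 * m + 2 \<notin> range pos"

definition invariant_set :: "('a \<Rightarrow> 'a) \<Rightarrow> 'a set \<Rightarrow> bool" where
  "invariant_set g A \<longleftrightarrow> (\<forall>u. g u \<in> A \<longleftrightarrow> u \<in> A)"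

text \<open>The gap permutations generate a group that acts transitively on the labels.\<close>

definition transitive_gaps :: "(int \<Rightarrow> 'a \<Rightarrow> 'a) \<Rightarrow> bool" where
  "transitive_gaps \<pi> \<longleftrightarrow> (\<forall>A. (\<forall>k. invariant_set (\<pi> k) A) \<longrightarrow> A = {} \<or> A = UNIV)"

text \<open>For a bijection \<open>g\<close> this is the orbit of \<open>y\<close> under the group generated by
\<open>g\<close>, described so that no powers of \<open>g\<close> are needed.\<close>

definition orbit_of :: "('a \<Rightarrow> 'a) \<Rightarrow> 'a \<Rightarrow> 'a set" where
  "orbit_of g y = \<Inter>{A. invariant_set g A \<and> y \<in> A}"

definition tame :: "(int \<Rightarrow> int \<Rightarrow> int) \<times> (nat \<Rightarrow> int) \<Rightarrow> bool" where
  "tame = (\<lambda>(\<pi>, pos). (\<forall>k. bij (\<pi> k)) \<and> inj pos \<and> transitive_gaps \<pi> \<and>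
     (\<exists>N. \<forall>m. N \<le> \<bar>m\<bar> \<longrightarrow> standard_at \<pi> pos m))"

lemma orbit_of_self: "y \<in> orbit_of g y"
  by (auto simp: orbit_of_def)

lemma orbit_of_least: "invariant_set g A \<Longrightarrow> y \<in> A \<Longrightarrow> orbit_of g y \<subseteq> A"
  by (auto simp: orbit_of_def)

lemma invariant_orbit_of: "invariant_set g (orbit_of g y)"
  by (auto simp: orbit_of_def invariant_set_def)

lemma invariant_set_inv: "bij g \<Longrightarrow> invariant_set (inv g) A \<longleftrightarrow> invariant_set g A"
  unfolding invariant_set_def by (metis bij_cancel(1) bij_cancel(2))

lemma invariant_set_comp: "invariant_set g A \<Longrightarrow> invariant_set h A \<Longrightarrow> invariant_set (g \<circ> h) A"
  by (simp add: invariant_set_def)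

text \<open>An injective map that sends a finite set into itself permutes it.\<close>

lemma finite_invariant_set:
  assumes "finite A" "inj g" "g ` A \<subseteq> A"
  shows "invariant_set g A"
proof -
  have "g ` A = A" using assms by (metis endo_inj_surj inj_on_subset subset_UNIV)
  then show ?thesis unfolding invariant_set_def using assms(2) by (metis inj_image_mem_iff)
qed

lemma slit_label_simps: "slit_label m \<noteq> 0" "slit_label m = slit_label n \<longleftrightarrow> m = n"
  by (auto simp: slit_label_def)

lemma slit_label_surj: "u \<noteq> 0 \<Longrightarrow> \<exists>m. u = slit_label m"
  unfolding slit_label_def by (cases "u > 0"; rule exI[of _ "if u > 0 then u - 1 else u"]) auto

lemma moves_preserve:
  assumes "moves j (\<pi>, pos) (\<pi>', pos')" "\<And>k. bij (\<pi> k)" "inj pos"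
  shows "(\<forall>k. bij (\<pi>' k)) \<and> inj pos'"
  using assms(1)
proof (induction rule: rtranclp_induct2)
  case refl then show ?case using assms by simp
next
  case (step \<pi>1 pos1 \<pi>2 pos2)
  from step(2) show ?case
  proof cases
    case (twist k)
    have "inj (swap k (k + 1))" by (metis injI Transposition.transpose_involutory)
    then show ?thesis using twist step(3) bij_twist[of \<pi>1] by (auto intro: inj_compose simp del: comp_apply)
  next
    case merge
    then show ?thesis using step(3) by auto
  qed
qed

lemma transitive_gaps_twist:
  assumes "transitive_gaps \<pi>" "\<And>k. bij (\<pi> k)"
  shows "transitive_gaps (twist k \<pi>)"
  unfolding transitive_gaps_def
proof (intro allI impI)
  fix A assume A: "\<forall>l. invariant_set (twist k \<pi> l) A"
  have o: "invariant_set (\<pi> l) A" if "l \<noteq> k" for l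
    using A[rule_format, of l] that by (simp add: twist_def)
  have tk: "twist k \<pi> k = \<pi> (k + 1) \<circ> inv (\<pi> k) \<circ> \<pi> (k - 1)" by (simp add: twist_def)
  have "\<pi> k = \<pi> (k - 1) \<circ> inv (twist k \<pi> k) \<circ> \<pi> (k + 1)"
  proof -
    have i: "inv (twist k \<pi> k) = inv (\<pi> (k - 1)) \<circ> \<pi> k \<circ> inv (\<pi> (k + 1))"
      unfolding tk by (rule inv_unique_comp) (simp_all add: fun_eq_iff bij_cancel[OF assms(2)])
    show ?thesis unfolding i by (simp add: fun_eq_iff bij_cancel[OF assms(2)])
  qed
  moreover have "invariant_set (inv (twist k \<pi> k)) A"
    using A bij_twist[OF assms(2)] by (simp add: invariant_set_inv)
  ultimately have "invariant_set (\<pi> k) A"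
    using o[of "k - 1"] o[of "k + 1"] by (simp add: invariant_set_comp del: o_apply)
  then have "invariant_set (\<pi> l) A" for l using o by (cases "l = k") auto
  then show "A = {} \<or> A = UNIV" using assms(1) unfolding transitive_gaps_def by blast
qed

lemma standard_at_twist:
  assumes "standard_at \<pi> pos m" "\<And>k. bij (\<pi> k)" "k < 3 * m \<or> 3 * m + 2 < k"
  shows "standard_at (twist k \<pi>) (swap k (k + 1) \<circ> pos) m"
proof -
  have f: "\<pi> l (slit_label m) = slit_label m" if "l \<noteq> 3 * m + 1" for l
    using assms(1) that by (simp add: standard_at_def)
  have "inv (\<pi> k) (slit_label m) = slit_label m"
    using f[of k] bij_cancel(2)[OF assms(2)[of k], of "slit_label m"] assms(3) by auto
  then have 1: "twist k \<pi> k (slit_label m) = slit_label m"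
    using f[of "k - 1"] f[of "k + 1"] assms(3) by (auto simp: twist_def)
  have p: "pos c \<noteq> 3 * m + 1" "pos c \<noteq> 3 * m + 2" for c
    using assms(1) unfolding standard_at_def by (metis rangeI)+
  have n: "swap k (k + 1) (pos c) \<noteq> 3 * m + 1" "swap k (k + 1) (pos c) \<noteq> 3 * m + 2" for c
    using p[of c] assms(3) by (auto simp: Transposition.transpose_def)
  have r: "3 * m + 1 \<notin> range (swap k (k + 1) \<circ> pos)" "3 * m + 2 \<notin> range (swap k (k + 1) \<circ> pos)"
    by (rule notin_rangeI, use n in simp)+
  show ?thesis
    using assms(1,3) 1 f unfolding standard_at_def by (intro conjI r) (auto simp: twist_def)
qed

text \<open>The lake jumps to the left over one square after the other by half twists at the square before it. Columns
that lie entirely to the left of its final or to the right of its original position are not affected.\<close>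

lemma lake_to_the_left:
  assumes "\<And>k. bij (\<pi> k)" "transitive_gaps \<pi>" "pos j = i"
  shows "\<exists>\<pi>' pos'. moves j (\<pi>, pos) (\<pi>', pos') \<and> pos' j = i - int n \<and> transitive_gaps \<pi>' \<and>
     (\<forall>m. standard_at \<pi> pos m \<longrightarrow> 3 * m + 2 < i - int n \<or> i \<le> 3 * m \<longrightarrow> standard_at \<pi>' pos' m)"
proof (induction n)
  case 0
  then show ?case using assms by (intro exI[of _ \<pi>] exI[of _ pos]) auto
next
  case (Suc n)
  then obtain \<pi>' pos' where *: "moves j (\<pi>, pos) (\<pi>', pos')" "pos' j = i - int n" "transitive_gaps \<pi>'"
    "\<forall>m. standard_at \<pi> pos m \<longrightarrow> 3 * m + 2 < i - int n \<or> i \<le> 3 * m \<longrightarrow> standard_at \<pi>' pos' m" by blast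
  let ?k = "i - int n - 1"
  have b: "bij (\<pi>' k)" for k
  proof -
    have "moves j (\<pi>, \<lambda>c. pos c) (\<pi>', pos')" using *(1) by simp
    then show ?thesis
    proof (induction arbitrary: k rule: rtranclp_induct2)
      case refl then show ?case using assms by simp
    next
      case (step \<pi>1 pos1 \<pi>2 pos2)
      from step(2) show ?case by cases (use step(3) bij_twist[of \<pi>1] in auto)
    qed
  qed
  have "move j (\<pi>', pos') (twist ?k \<pi>', swap ?k (?k + 1) \<circ> pos')"
    using *(2) by (intro move.twist) simp
  then have "moves j (\<pi>, pos) (twist ?k \<pi>', swap ?k (?k + 1) \<circ> pos')"
    using *(1) by (rule rtranclp.rtrancl_into_rtrancl[rotated])
  moreover have "(swap ?k (?k + 1) \<circ> pos') j = i - int (Suc n)" using *(2) by simp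
  moreover have "transitive_gaps (twist ?k \<pi>')" by (rule transitive_gaps_twist[OF *(3) b])
  moreover have "standard_at (twist ?k \<pi>') (swap ?k (?k + 1) \<circ> pos') m"
    if "standard_at \<pi> pos m" "3 * m + 2 < i - int (Suc n) \<or> i \<le> 3 * m" for m
    using *(4) that by (intro standard_at_twist b) auto
  ultimately show ?case by blast
qed

text \<open>The finitely many labels that do not belong to one of the standard columns left of column \<open>M\<close>
or from column \<open>N\<close> on. Gaps in between only permute these.\<close>

definition label_window :: "int \<Rightarrow> int \<Rightarrow> int set" where
  "label_window M N = {u. \<forall>m. m < M \<or> N \<le> m \<longrightarrow> u \<noteq> slit_label m}"

lemma finite_label_window: "finite (label_window M N)"
proof (rule finite_subset)
  show "label_window M N \<subseteq> {min M 0..max N 0}"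
  proof
    fix u assume u: "u \<in> label_window M N"
    have "u \<le> max N 0"
    proof (rule ccontr)
      assume "\<not> u \<le> max N 0"
      then have "u = slit_label (u - 1)" "N \<le> u - 1" by (auto simp: slit_label_def)
      then show False using u unfolding label_window_def by blast
    qed
    moreover have "min M 0 \<le> u"
    proof (rule ccontr)
      assume "\<not> min M 0 \<le> u"
      then have "u = slit_label u" "u < M" by (auto simp: slit_label_def)
      then show False using u unfolding label_window_def by blast
    qed
    ultimately show "u \<in> {min M 0..max N 0}" by simp
  qed
qed simp

lemma zero_in_label_window: "0 \<in> label_window M N"
  unfolding label_window_def mem_Collect_eq using slit_label_simps(1) by (simp add: eq_commute[of 0])

lemma label_window_Suc:
  assumes "M \<le> N" shows "label_window M (N + 1) = insert (slit_label N) (label_window M N)"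
proof -
  have "N \<le> m \<longleftrightarrow> m = N \<or> N + 1 \<le> m" for m by linarith
  then show ?thesis using assms by (auto simp: label_window_def slit_label_simps)
qed

context
  fixes \<pi> :: "int \<Rightarrow> int \<Rightarrow> int" and pos :: "nat \<Rightarrow> int" and M N :: int
  assumes bij: "\<And>k. bij (\<pi> k)" and MN: "M \<le> N"
    and std: "\<And>m. m < M \<or> N \<le> m \<Longrightarrow> standard_at \<pi> pos m"
begin

lemma std_fix: "m < M \<or> N \<le> m \<Longrightarrow> k \<noteq> 3 * m + 1 \<Longrightarrow> \<pi> k (slit_label m) = slit_label m"
  using std by (simp add: standard_at_def)

lemma invariant_label_window:
  assumes "3 * M \<le> k" "k < 3 * N"
  shows "invariant_set (\<pi> k) (label_window M N)"
proof -
  have "\<pi> k u = slit_label m \<longleftrightarrow> u = slit_label m" if "m < M \<or> N \<le> m" for u m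
  proof -
    have "\<pi> k (slit_label m) = slit_label m" using that assms by (intro std_fix) auto
    then show ?thesis using bij[of k] by (metis bij_cancel(2))
  qed
  then show ?thesis by (auto simp: invariant_set_def label_window_def)
qed

text \<open>A set \<open>B\<close> of labels that is invariant under the gaps in the window becomes invariant under all
gaps once the labels of the outer columns are added, or left out, according to whether \<open>0\<close>
belongs to \<open>B\<close>.\<close>

lemma window_saturation:
  assumes "transitive_gaps \<pi>" "B \<subseteq> label_window M N" "B \<noteq> {}"
    and inv: "\<And>k. 3 * M \<le> k \<Longrightarrow> k < 3 * N \<Longrightarrow> invariant_set (\<pi> k) B"
  shows "label_window M N \<subseteq> B"
proof -
  define F where "F = slit_label ` {m. m < M \<or> N \<le> m}"
  define B' where "B' = B \<union> (if 0 \<in> B then F else {})"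
  have BF: "B \<inter> F = {}" using assms(2) by (auto simp: F_def label_window_def)
  have z: "0 \<notin> F" by (auto simp: F_def) (metis slit_label_simps(1))+
  have "invariant_set (\<pi> k) B'" for k
  proof (cases "3 * M \<le> k \<and> k < 3 * N")
    case True
    have fixF: "\<pi> k u = u" if "u \<in> F" for u
      using that True std_fix[of _ k] by (auto simp: F_def)
    have "\<pi> k u \<in> F \<longleftrightarrow> u \<in> F" for u using fixF bij[of k] by (metis bij_cancel(2))
    then show ?thesis using inv[of k] True by (auto simp: invariant_set_def B'_def)
  next
    case False
    define m where "m = k div 3"
    have m: "m < M \<or> N \<le> m" using False unfolding m_def by linarith
    have "k = 3 * m \<or> k = 3 * m + 1 \<or> k = 3 * m + 2" unfolding m_def by presburger
    then consider "\<pi> k = id" | "\<pi> k = swap 0 (slit_label m)"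
      using std[OF m] unfolding standard_at_def by metis
    then show ?thesis
    proof cases
      case 1 then show ?thesis by (simp add: invariant_set_def)
    next
      case 2
      have "slit_label m \<in> F" using m by (auto simp: F_def)
      then have "slit_label m \<in> B' \<longleftrightarrow> 0 \<in> B'" using BF z by (auto simp: B'_def)
      then show ?thesis unfolding 2 by (auto simp: invariant_set_def Transposition.transpose_def)
    qed
  qed
  then have "B' = UNIV" using assms(1,3) unfolding transitive_gaps_def B'_def by blast
  then show ?thesis by (auto simp: B'_def F_def label_window_def split: if_splits)
qed

text \<open>Let \<open>C\<close> be the orbit of \<open>y\<close> under the permutation of the lake. By transitivity
some gap \<open>k\<close> of the window moves a label \<open>z\<close> of \<open>C\<close> to a label
\<open>b\<close> outside \<open>C\<close>. The critical values of the standard column \<open>N\<close> carry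
the transposition \<open>(0 a)\<close>, where \<open>a\<close> is fixed by all other gaps. Excursions turn
it into \<open>(\<pi> i z, a)\<close>, and moving the pair next to the lake turns it into \<open>(z
a)\<close>. Leading one of them around all squares up to the gap \<open>k\<close> and swallowing both
changes the lake permutation from \<open>\<pi> i\<close> to \<open>(b a) (\<pi> i) (z a)\<close>, which
sends \<open>z\<close> to \<open>b\<close> and \<open>a\<close> to \<open>\<pi> i z\<close> and agrees with
\<open>\<pi> i\<close> on the rest of \<open>C\<close>. So the whole of \<open>C\<close>, together with
\<open>a\<close> and \<open>b\<close>, is now in one orbit. The price is that column \<open>N\<close> no
longer is standard.\<close>

lemma absorb_slit:
  assumes tr: "transitive_gaps \<pi>" and inj: "inj pos" and pj: "pos j = 3 * M"
    and y: "y \<in> label_window M N" "y' \<in> label_window M N" "y' \<notin> orbit_of (\<pi> (3 * M)) y"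
  shows "\<exists>\<pi>' pos' b. moves j (\<pi>, pos) (\<pi>', pos') \<and> transitive_gaps \<pi>' \<and> pos' j = 3 * M \<and>
     (\<forall>m. m < M \<or> N + 1 \<le> m \<longrightarrow> standard_at \<pi>' pos' m) \<and>
     insert (slit_label N) (insert b (orbit_of (\<pi> (3 * M)) y)) \<subseteq> orbit_of (\<pi>' (3 * M)) y \<and>
     b \<in> label_window M N \<and> b \<notin> orbit_of (\<pi> (3 * M)) y"
proof -
  define i where "i = 3 * M"
  define a where "a = slit_label N"
  define W where "W = label_window M N"
  define C where "C = orbit_of (\<pi> i) y"
  have finW: "finite W" by (simp add: W_def finite_label_window)
  have "M \<noteq> N"
  proof
    assume "M = N"
    then have "W \<subseteq> {0}" unfolding W_def label_window_def using slit_label_surj by (auto) (meson not_le)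
    then show False using y orbit_of_self[of y] by (auto simp: W_def)
  qed
  then have MN': "M < N" using MN by simp
  have Cinv: "invariant_set (\<pi> i) C" by (simp add: C_def invariant_orbit_of)
  have Winv: "invariant_set (\<pi> k) W" if "i \<le> k" "k < 3 * N" for k
    using that invariant_label_window by (simp add: W_def i_def)
  have CW: "C \<subseteq> W" unfolding C_def
    by (rule orbit_of_least) (use Winv[of i] MN' y in \<open>auto simp: i_def W_def\<close>)
  have aW: "a \<notin> W" by (auto simp: a_def W_def label_window_def)
  have yC: "y \<in> C" by (simp add: C_def orbit_of_self)
  have finC: "finite C" using CW finW by (rule finite_subset)
  obtain z k where zk: "z \<in> C" "i < k" "k < 3 * N" "\<pi> k z \<notin> C"
  proof -
    have "\<not> (\<forall>z\<in>C. \<forall>k. i < k \<and> k < 3 * N \<longrightarrow> \<pi> k z \<in> C)"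
    proof
      assume *: "\<forall>z\<in>C. \<forall>k. i < k \<and> k < 3 * N \<longrightarrow> \<pi> k z \<in> C"
      have "invariant_set (\<pi> k) C" if "3 * M \<le> k" "k < 3 * N" for k
      proof (cases "k = i")
        case True then show ?thesis using Cinv by simp
      next
        case False
        then show ?thesis using * that bij[of k] finC
          by (intro finite_invariant_set) (auto simp: i_def bij_is_inj)
      qed
      then have "W \<subseteq> C" unfolding W_def using tr CW yC by (intro window_saturation) (auto simp: W_def)
      then show False using y by (auto simp: W_def C_def i_def)
    qed
    then show ?thesis using that by blast
  qed
  define b where "b = \<pi> k z"
  have zW: "z \<in> W" using zk CW by auto
  have bW: "b \<in> W" using Winv[of k] zk zW by (auto simp: b_def invariant_set_def)
  define \<rho> where "\<rho> l = (if l \<le> 3 * N then \<pi> l else \<pi> (l + 2))" for l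
  have bij\<rho>: "bij (\<rho> l)" for l by (simp add: \<rho>_def bij)
  have stdN: "standard_at \<pi> pos N" using std by simp
  have \<rho>fix: "\<rho> l (slit_label m) = slit_label m" if "m < M \<or> N \<le> m" "l \<noteq> 3 * m + 1 \<or> m = N" "l + 2 \<noteq> 3 * m + 1 \<or> l \<le> 3 * N" for l m
    using that std_fix[of m l] std_fix[of m "l + 2"] by (auto simp: \<rho>_def)
  have \<rho>a: "\<rho> l a = a" for l unfolding a_def by (rule \<rho>fix) auto
  have ins: "\<pi> = insert_pair \<rho> (3 * N) 0 a"
  proof
    fix l
    consider "l \<le> 3 * N" | "l = 3 * N + 1" | "l = 3 * N + 2" | "l > 3 * N + 2" by linarith
    then show "\<pi> l = insert_pair \<rho> (3 * N) 0 a l"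
      using stdN by cases (auto simp: insert_pair_def \<rho>_def standard_at_def a_def)
  qed
  have posN: "3 * N + 1 \<notin> range pos" "3 * N + 2 \<notin> range pos" using stdN by (auto simp: standard_at_def)
  have \<rho>N: "\<rho> (3 * N) = id" using stdN by (simp add: \<rho>_def standard_at_def)
  \<comment> \<open>The labels that excursions of the pair can produce: a set that contains \<open>0\<close> and is invariant
  under the gaps of the window, hence everything.\<close>
  define R where "R = {x \<in> W. moves j (\<pi>, pos) (insert_pair \<rho> (3 * N) x a, pos)}"
  have "0 \<in> R" using zero_in_label_window by (auto simp: R_def W_def ins[symmetric])
  have "invariant_set (\<pi> q) R" if q: "3 * M \<le> q" "q < 3 * N" for q
  proof -
    have "inv (\<pi> q) x \<in> R" if x: "x \<in> R" for x
    proof -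
      have 1: "moves j (insert_pair \<rho> (3 * N) x a, pos) (insert_pair \<rho> (3 * N) (inv (\<rho> q) (\<rho> (3 * N) x)) a, pos)"
        using q posN pj by (intro pair_walk bij\<rho> \<rho>a) auto
      have 2: "inv (\<rho> q) (\<rho> (3 * N) x) = inv (\<pi> q) x" using q \<rho>N by (simp add: \<rho>_def)
      have "inv (\<pi> q) x \<in> W" using x Winv[of q] q invariant_set_inv[OF bij]
        unfolding R_def i_def invariant_set_def by blast
      then show ?thesis using x 1 unfolding 2 R_def by (auto intro: rtranclp_trans)
    qed
    then have "invariant_set (inv (\<pi> q)) R"
      using finW bij[of q] by (intro finite_invariant_set) (auto simp: R_def bij_imp_bij_inv bij_is_inj)
    then show ?thesis using invariant_set_inv[OF bij] by blast
  qed
  then have "W \<subseteq> R" unfolding W_def using \<open>0 \<in> R\<close> tr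
    by (intro window_saturation) (auto simp: R_def W_def)
  moreover have \<pi>zC: "\<pi> i z \<in> C" using Cinv zk by (auto simp: invariant_set_def)
  ultimately have "\<pi> i z \<in> R" using CW by auto
  then have mv1: "moves j (\<pi>, pos) (insert_pair \<rho> (3 * N) (\<pi> i z) a, pos)" by (simp add: R_def)
  define pos1 where "pos1 = (\<lambda>c. if i < pos c \<and> pos c \<le> 3 * N then pos c + 2 else pos c)"
  define n where "n = nat (3 * N - i)"
  have n: "i + int n = 3 * N" using MN by (simp add: n_def i_def)
  have \<rho>i: "\<rho> i = \<pi> i" using MN by (simp add: \<rho>_def i_def)
  have mv2: "moves j (insert_pair \<rho> (3 * N) (\<pi> i z) a, pos) (insert_pair \<rho> i z a, pos1)"
  proof -
    have "moves j (insert_pair \<rho> (i + int n) (\<pi> i z) a, pos)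
      (insert_pair \<rho> i (inv (\<rho> i) (\<rho> (i + int n) (\<pi> i z))) a,
       \<lambda>c. if i < pos c \<and> pos c \<le> i + int n then pos c + 2 else pos c)"
      by (rule pair_left_many[OF bij\<rho> \<rho>a]) (use n pj posN in \<open>auto simp: i_def\<close>)
    moreover have "inv (\<rho> i) (\<rho> (i + int n) (\<pi> i z)) = z"
      unfolding n \<rho>N \<rho>i by (simp add: bij_cancel[OF bij])
    ultimately show ?thesis unfolding n pos1_def by simp
  qed
  have pp: "pos c \<noteq> 3 * N + 1" "pos c \<noteq> 3 * N + 2" for c using posN by (metis rangeI)+
  define q where "q = nat (k - i)"
  have q: "0 < q" "i + int q = k" using zk by (auto simp: q_def)
  define \<tau> where "\<tau> = swap z a"
  define T where "T = swap b a"
  have \<rho>k: "\<rho> k z = b" using zk by (simp add: \<rho>_def b_def)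
  define \<pi>' where "\<pi>' = (\<lambda>l. if l < i then \<rho> l else if l \<le> i + 2 then T \<circ> \<rho> i \<circ> \<tau>
         else if l < k + 2 then T \<circ> \<rho> (l - 2) \<circ> \<tau> else \<rho> (l - 2))"
  have mv3: "moves j (insert_pair \<rho> i z a, pos1) (\<pi>', pos1)"
  proof -
    have ne: "pos1 c \<noteq> i + 1 \<and> pos1 c \<noteq> i + 2" for c
      using pp[of c] MN' by (auto simp: pos1_def i_def)
    have "pos1 j = i" using pj by (simp add: pos1_def i_def)
    moreover have "i + 1 \<notin> range pos1" "i + 2 \<notin> range pos1" by (rule notin_rangeI, use ne in blast)+
    ultimately show ?thesis
      using loop_and_merge[where \<rho> = \<rho> and a = a and pos = pos1 and j = j and i = i and z = z and q = q, OF bij\<rho> \<rho>a _ _ _ q(1)]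
      unfolding q(2) \<rho>k \<tau>_def[symmetric] T_def[symmetric] \<pi>'_def by blast
  qed
  have mv: "moves j (\<pi>, pos) (\<pi>', pos1)" using mv1 mv2 mv3 by (meson rtranclp_trans)
  have za: "z \<noteq> a" "b \<noteq> a" using zW bW aW by auto
  have bC: "b \<notin> C" using zk by (simp add: b_def)
  have TT: "T (T u) = u" "\<tau> (\<tau> u) = u" for u by (auto simp: T_def \<tau>_def)
  \<comment> \<open>Everything needed about the new lake permutation, and about transitivity, concerns its invariant sets.\<close>
  have key: "(\<forall>u\<in>C. u \<in> A \<longleftrightarrow> z \<in> A) \<and> (a \<in> A \<longleftrightarrow> z \<in> A) \<and> (b \<in> A \<longleftrightarrow> z \<in> A)"
    if A: "invariant_set (\<pi>' i) A" for A
  proof -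
    have \<pi>'i: "\<pi>' i u = T (\<pi> i (\<tau> u))" for u by (simp add: \<pi>'_def \<rho>i)
    have step: "\<pi> i u \<in> A \<longleftrightarrow> u \<in> A" if "u \<in> C" "u \<noteq> z" for u
    proof -
      have "u \<noteq> a" using that CW aW by auto
      moreover have "\<pi> i u \<in> C" using Cinv that by (auto simp: invariant_set_def)
      then have "\<pi> i u \<noteq> a" "\<pi> i u \<noteq> b" using CW aW bC by auto
      ultimately have "\<pi>' i u = \<pi> i u" using that by (simp add: \<pi>'i \<tau>_def T_def)
      then show ?thesis using A unfolding invariant_set_def by metis
    qed
    define D where "D = {u \<in> C. u \<in> A \<longleftrightarrow> z \<in> A}"
    have "inv (\<pi> i) u \<in> D" if u: "u \<in> D" for u
    proof -
      have "inv (\<pi> i) u \<in> C" using Cinv u invariant_set_inv[OF bij] unfolding D_def invariant_set_def by blast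
      then show ?thesis using step[of "inv (\<pi> i) u"] u
        by (cases "inv (\<pi> i) u = z") (auto simp: D_def bij_cancel[OF bij])
    qed
    then have "invariant_set (inv (\<pi> i)) D"
      using finC bij[of i] by (intro finite_invariant_set) (auto simp: D_def bij_imp_bij_inv bij_is_inj)
    then have Dinv: "invariant_set (\<pi> i) D" using invariant_set_inv[OF bij] by blast
    have "y \<in> D"
    proof (rule ccontr)
      assume "y \<notin> D"
      have "invariant_set (\<pi> i) (- D)" using Dinv by (auto simp: invariant_set_def)
      then have "C \<subseteq> - D" unfolding C_def using \<open>y \<notin> D\<close> by (intro orbit_of_least) auto
      then show False using zk(1) by (auto simp: D_def)
    qed
    then have "C \<subseteq> D" unfolding C_def using Dinv by (rule orbit_of_least[rotated])
    then have 1: "\<forall>u\<in>C. u \<in> A \<longleftrightarrow> z \<in> A" by (auto simp: D_def)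
    have "\<pi>' i a = \<pi> i z"
    proof -
      have "\<pi> i z \<noteq> a" "\<pi> i z \<noteq> b" using \<pi>zC CW aW bC by auto
      then show ?thesis by (simp add: \<pi>'i \<tau>_def T_def)
    qed
    then have "a \<in> A \<longleftrightarrow> \<pi> i z \<in> A" using A unfolding invariant_set_def by metis
    moreover have "\<pi>' i z = b" using \<rho>a[of i] by (simp add: \<pi>'i \<tau>_def T_def \<rho>i)
    then have "b \<in> A \<longleftrightarrow> z \<in> A" using A unfolding invariant_set_def by metis
    ultimately show ?thesis using 1 \<pi>zC by auto
  qed
  have tr': "transitive_gaps \<pi>'"
    unfolding transitive_gaps_def
  proof (intro allI impI)
    fix A assume A: "\<forall>l. invariant_set (\<pi>' l) A"
    have k: "a \<in> A \<longleftrightarrow> z \<in> A" "b \<in> A \<longleftrightarrow> z \<in> A" using key A by blast+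
    have T: "invariant_set T A" "invariant_set \<tau> A"
      using k by (auto simp: invariant_set_def T_def \<tau>_def Transposition.transpose_def)
    have \<rho>inv: "invariant_set (\<rho> r) A" for r
    proof -
      have conj: "invariant_set (\<rho> r) A" if "invariant_set (T \<circ> \<rho> r \<circ> \<tau>) A"
      proof -
        have "\<rho> r = T \<circ> (T \<circ> \<rho> r \<circ> \<tau>) \<circ> \<tau>" by (simp add: fun_eq_iff TT)
        then show ?thesis using that T invariant_set_comp by metis
      qed
      consider "r < i" | "r = i" | "i < r" "r < k" | "k \<le> r" by linarith
      then show ?thesis
      proof cases
        case 1 then show ?thesis using A[rule_format, of r] by (simp add: \<pi>'_def)
      next
        case 2 then show ?thesis using A[rule_format, of i] by (intro conj) (simp add: \<pi>'_def)
      next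
        case 3 then show ?thesis using A[rule_format, of "r + 2"] by (intro conj) (simp add: \<pi>'_def)
      next
        case 4 then show ?thesis using A[rule_format, of "r + 2"] zk by (simp add: \<pi>'_def)
      qed
    qed
    \<comment> \<open>An invariant set of the new row, adapted so that it treats \<open>a\<close> as the old column
    \<open>N\<close> does.\<close>
    define A1 where "A1 = A - {a} \<union> (if 0 \<in> A then {a} else {})"
    have a0: "a \<noteq> 0" by (simp add: a_def slit_label_simps)
    have "invariant_set (\<pi> l) A1" for l
    proof -
      have "invariant_set (\<rho> r) A1" for r
      proof -
        have "\<rho> r u = a \<longleftrightarrow> u = a" for u using \<rho>a[of r] bij\<rho>[of r] by (metis bij_cancel(2))
        then show ?thesis using \<rho>inv[of r] \<rho>a[of r] by (auto simp: invariant_set_def A1_def)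
      qed
      moreover have "invariant_set (\<rho> r \<circ> swap 0 a) A1" if "\<rho> r = id" for r
        using that a0 by (auto simp: invariant_set_def A1_def Transposition.transpose_def)
      ultimately show ?thesis unfolding ins insert_pair_def using \<rho>N by simp
    qed
    then have "A1 = {} \<or> A1 = UNIV" using tr unfolding transitive_gaps_def by blast
    then show "A = {} \<or> A = UNIV"
    proof
      assume "A1 = {}"
      then have "A \<subseteq> {a}" by (auto simp: A1_def)
      then show ?thesis using k za by auto
    next
      assume "A1 = UNIV"
      then have "u \<in> A" if "u \<noteq> a" for u using that UNIV_I[of u] unfolding A1_def by (auto split: if_splits)
      then have "A = UNIV" using k za by (metis UNIV_eq_I)
      then show ?thesis by simp
    qed
  qed
  have std': "standard_at \<pi>' pos1 m" if m: "m < M \<or> N + 1 \<le> m" for m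
  proof -
    have sm: "standard_at \<pi> pos m" using m std by auto
    have mm: "m < M \<or> N \<le> m" "m \<noteq> N" using m MN by auto
    then have sl: "slit_label m \<noteq> z" "slit_label m \<noteq> b" "slit_label m \<noteq> a"
      using zW bW unfolding W_def label_window_def a_def slit_label_simps mem_Collect_eq by metis+
    have Tm: "T (slit_label m) = slit_label m" "\<tau> (slit_label m) = slit_label m"
      using sl by (auto simp: T_def \<tau>_def Transposition.transpose_def)
    have same: "\<pi>' l = \<pi> l" if "l < i \<or> 3 * N + 2 < l" for l
      using that zk MN by (auto simp: \<pi>'_def \<rho>_def i_def)
    have "\<pi>' l (slit_label m) = slit_label m" if "l \<noteq> 3 * m + 1" for l
    proof (cases "l < i \<or> 3 * N + 2 < l")
      case True then show ?thesis using same[OF True] sm that by (simp add: standard_at_def)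
    next
      case False
      have r: "\<rho> r (slit_label m) = slit_label m" if "i \<le> r" "r \<le> 3 * N" for r
        using m that by (intro \<rho>fix) (auto simp: i_def)
      show ?thesis using False zk MN' r[of i] r[of "l - 2"] Tm by (auto simp: \<pi>'_def i_def)
    qed
    moreover have "\<pi>' (3 * m) = \<pi> (3 * m)" "\<pi>' (3 * m + 1) = \<pi> (3 * m + 1)" "\<pi>' (3 * m + 2) = \<pi> (3 * m + 2)"
      using m by (auto intro!: same simp: i_def)
    moreover have "pos1 c \<noteq> 3 * m + 1 \<and> pos1 c \<noteq> 3 * m + 2" for c
    proof -
      have "pos c \<noteq> 3 * m + 1" "pos c \<noteq> 3 * m + 2" using sm unfolding standard_at_def by (metis rangeI)+
      then show ?thesis using m by (auto simp: pos1_def i_def)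
    qed
    then have "3 * m + 1 \<notin> range pos1" "3 * m + 2 \<notin> range pos1" by (auto intro!: notin_rangeI simp del: not_le)
    ultimately show ?thesis using sm by (simp add: standard_at_def)
  qed
  have "insert a (insert b C) \<subseteq> orbit_of (\<pi>' i) y"
  proof -
    have k: "(\<forall>u\<in>C. u \<in> A \<longleftrightarrow> z \<in> A) \<and> (a \<in> A \<longleftrightarrow> z \<in> A) \<and> (b \<in> A \<longleftrightarrow> z \<in> A)" if "A = orbit_of (\<pi>' i) y" for A
      using key[of A] that by (simp add: invariant_orbit_of)
    show ?thesis using k[OF refl] yC orbit_of_self[of y "\<pi>' i"] by blast
  qed
  then show ?thesis
    using mv tr' std' bW bC pj unfolding C_def a_def W_def i_def
    by (intro exI[of _ \<pi>'] exI[of _ pos1] exI[of _ b]) (auto simp: pos1_def i_def)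
qed

end
text \<open>Each absorption enlarges the window by the one label \<open>slit_label N\<close>, which immediately joins
the orbit of \<open>y\<close>, and moreover adds a label of the old window to the orbit. So the number of
missing labels decreases until \<open>y'\<close> is reached. As the lake sits at \<open>3 M\<close> and
column \<open>M - 1\<close> is standard, the gap on its left carries the identity.\<close>

lemma connect_labels_in_window:
  assumes "\<And>k. bij (\<pi> k)" "M \<le> N" "\<And>m. m < M \<or> N \<le> m \<Longrightarrow> standard_at \<pi> pos m"
    and "transitive_gaps \<pi>" "inj pos" "pos j = 3 * M"
    and "y \<in> label_window M N" "y' \<in> label_window M N"
  shows "\<exists>\<pi>' pos'. moves j (\<pi>, pos) (\<pi>', pos') \<and> tame (\<pi>', pos') \<and>
     y' \<in> orbit_of (\<pi>' (pos' j) \<circ> inv (\<pi>' (pos' j - 1))) y"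
  using assms
proof (induction "card (label_window M N - orbit_of (\<pi> (3 * M)) y)" arbitrary: \<pi> pos N rule: less_induct)
  case less
  show ?case
  proof (cases "y' \<in> orbit_of (\<pi> (3 * M)) y")
    case True
    have "standard_at \<pi> pos (M - 1)" using less.prems by simp
    then have "\<pi> (3 * M - 1) = id" by (simp add: standard_at_def algebra_simps)
    moreover have "standard_at \<pi> pos m" if "\<bar>M\<bar> + \<bar>N\<bar> + 1 \<le> \<bar>m\<bar>" for m
      using that by (intro less.prems(3)) linarith
    then have "tame (\<pi>, pos)" using less.prems by (auto simp: tame_def)
    ultimately show ?thesis using True less.prems by (intro exI[of _ \<pi>] exI[of _ pos]) auto
  next
    case False
    obtain \<pi>1 pos1 b where 1: "moves j (\<pi>, pos) (\<pi>1, pos1)" "transitive_gaps \<pi>1" "pos1 j = 3 * M"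
      "\<forall>m. m < M \<or> N + 1 \<le> m \<longrightarrow> standard_at \<pi>1 pos1 m"
      "insert (slit_label N) (insert b (orbit_of (\<pi> (3 * M)) y)) \<subseteq> orbit_of (\<pi>1 (3 * M)) y"
      "b \<in> label_window M N" "b \<notin> orbit_of (\<pi> (3 * M)) y"
      using absorb_slit[OF less.prems(1-6) less.prems(7,8) False] by metis
    have p: "(\<forall>k. bij (\<pi>1 k)) \<and> inj pos1" by (rule moves_preserve[OF 1(1) less.prems(1,5)])
    have W: "label_window M (N + 1) = insert (slit_label N) (label_window M N)"
      by (rule label_window_Suc[OF less.prems(2)])
    have "label_window M (N + 1) - orbit_of (\<pi>1 (3 * M)) y \<subset> label_window M N - orbit_of (\<pi> (3 * M)) y"
      using 1(5,6,7) unfolding W by blast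
    then have c: "card (label_window M (N + 1) - orbit_of (\<pi>1 (3 * M)) y) <
        card (label_window M N - orbit_of (\<pi> (3 * M)) y)"
      by (intro psubset_card_mono finite_Diff finite_label_window)
    have "\<exists>\<pi>' pos'. moves j (\<pi>1, pos1) (\<pi>', pos') \<and> tame (\<pi>', pos') \<and>
       y' \<in> orbit_of (\<pi>' (pos' j) \<circ> inv (\<pi>' (pos' j - 1))) y"
      by (rule less.hyps[where N = "N + 1" and \<pi> = \<pi>1 and pos = pos1]) (use c p 1 less.prems W in auto)
    then show ?thesis using 1(1) by (meson rtranclp_trans)
  qed
qed

text \<open>The lake is first moved to the left of all columns that are not standard; then everything that matters for
\<open>y\<close> and \<open>y'\<close> lies to its right.\<close>

theorem connect_labels:
  assumes "tame (\<pi>, pos)"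
  shows "\<exists>\<pi>' pos'. moves j (\<pi>, pos) (\<pi>', pos') \<and> tame (\<pi>', pos') \<and>
     y' \<in> orbit_of (\<pi>' (pos' j) \<circ> inv (\<pi>' (pos' j - 1))) y"
proof -
  from assms obtain N0 where t: "\<And>k. bij (\<pi> k)" "inj pos" "transitive_gaps \<pi>"
    "\<And>m. N0 \<le> \<bar>m\<bar> \<Longrightarrow> standard_at \<pi> pos m" unfolding tame_def by auto
  define K where "K = \<bar>pos j\<bar> + \<bar>y\<bar> + \<bar>y'\<bar> + \<bar>N0\<bar> + 1"
  have pK: "\<bar>pos j\<bar> \<le> K" by (simp add: K_def)
  have n: "pos j - int (nat (pos j + 3 * K)) = 3 * (- K)"
  proof -
    have "0 \<le> pos j + 3 * K" using pK by linarith
    then show ?thesis by simp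
  qed
  obtain \<pi>1 pos1 where 1: "moves j (\<pi>, pos) (\<pi>1, pos1)" "pos1 j = 3 * (- K)" "transitive_gaps \<pi>1"
    "\<forall>m. standard_at \<pi> pos m \<longrightarrow> 3 * m + 2 < 3 * (- K) \<or> pos j \<le> 3 * m \<longrightarrow> standard_at \<pi>1 pos1 m"
    using lake_to_the_left[OF t(1,3) refl, where pos = pos and j = j and n = "nat (pos j + 3 * K)"] unfolding n by blast
  have p: "(\<forall>k. bij (\<pi>1 k)) \<and> inj pos1" by (rule moves_preserve[OF 1(1) t(1,2)])
  have S: "standard_at \<pi>1 pos1 m" if m: "m < - K \<or> K \<le> m" for m
  proof -
    have "standard_at \<pi> pos m" using m by (intro t(4)) (auto simp: K_def)
    moreover have "3 * m + 2 < 3 * (- K) \<or> pos j \<le> 3 * m" using m pK by linarith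
    ultimately show ?thesis using 1(4) by blast
  qed
  have W: "u \<in> label_window (- K) K" if "\<bar>u\<bar> < K" for u
    using that by (auto simp: label_window_def slit_label_def)
  have "\<exists>\<pi>' pos'. moves j (\<pi>1, pos1) (\<pi>', pos') \<and> tame (\<pi>', pos') \<and>
       y' \<in> orbit_of (\<pi>' (pos' j) \<circ> inv (\<pi>' (pos' j - 1))) y"
  proof (intro connect_labels_in_window[where M = "- K" and N = K])
    have "\<bar>y\<bar> < K" "\<bar>y'\<bar> < K" "- K \<le> K" by (simp_all add: K_def)
    then show "y \<in> label_window (- K) K" "y' \<in> label_window (- K) K" "- K \<le> K" by (simp_all add: W)
  qed (use p 1(2,3) S in auto)
  then show ?thesis using 1(1) by (meson rtranclp_trans)
qed

section \<open>Frames and sheets\<close>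

definition preim :: "complex set \<Rightarrow> complex set" where
  "preim U = {z. cos z \<noteq> 0 \<and> tanid z \<in> U}"

definition gap :: "int \<Rightarrow> complex set" where
  "gap k = {z. of_int k + 1/4 < Re z \<and> Re z < of_int k + 3/4}"

text \<open>For \<open>\<sigma> = 1\<close> the upper and for \<open>\<sigma> = -1\<close> the lower side of the row of
closed squares of half-width \<open>1/4\<close> around the integers; both sides include all gaps.\<close>

definition side :: "real \<Rightarrow> complex set" where
  "side \<sigma> = {z. 1/4 < \<sigma> * Im z} \<union> (\<Union>k. gap k)"

text \<open>The lakes are slightly larger than the closed squares of half-width \<open>1/4\<close>, so that there is
room in a lake to walk around such a square.\<close>

definition square :: "int \<Rightarrow> complex set" where
  "square k = {z. \<bar>Re z - of_int k\<bar> < 3/10 \<and> \<bar>Im z\<bar> < 3/10}"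

text \<open>Points of the square \<open>k\<close> near its rim, above or below its centre: \<open>7/25\<close> is
between \<open>1/4\<close> and \<open>3/10\<close>.\<close>

definition mark :: "real \<Rightarrow> int \<Rightarrow> complex" where
  "mark \<sigma> k = Complex (of_int k) (\<sigma> * (7/25))"

text \<open>The maps \<open>s x\<close> are lifts of \<open>\<phi>\<close> over one side, and together they exhaust the
fibres.\<close>

definition sheets :: "real \<Rightarrow> (complex \<Rightarrow> complex) \<Rightarrow> (int \<Rightarrow> complex \<Rightarrow> complex) \<Rightarrow> bool" where
  "sheets \<sigma> \<phi> s \<longleftrightarrow>
     (\<forall>x. continuous_on (side \<sigma>) (s x) \<and> (\<forall>w\<in>side \<sigma>. s x w \<in> regular_pts \<and> tanid (s x w) = \<phi> w)) \<and>
     (\<forall>w\<in>side \<sigma>. \<forall>z\<in>regular_pts. tanid z = \<phi> w \<longrightarrow> (\<exists>x. s x w = z))"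

text \<open>As the sheets take values in \<open>regular_pts\<close>, the homeomorphism \<open>\<phi>\<close> of a frame
maps no point of the two sides to a critical value: all critical values come from the closed squares of
half-width \<open>1/4\<close>.\<close>

definition frame :: "(complex \<Rightarrow> complex) \<Rightarrow> (int \<Rightarrow> complex \<Rightarrow> complex) \<Rightarrow> (int \<Rightarrow> complex \<Rightarrow> complex) \<Rightarrow>
    (int \<Rightarrow> int \<Rightarrow> int) \<Rightarrow> bool" where
  "frame \<phi> s t \<pi> \<longleftrightarrow> (\<exists>h. homeomorphism UNIV UNIV \<phi> h) \<and> sheets (-1) \<phi> s \<and> sheets 1 \<phi> t \<and>
     (\<forall>k x. \<forall>w\<in>gap k. s x w = t (\<pi> k x) w) \<and> (\<forall>k. bij (\<pi> k))"

lemma open_gap: "open (gap k)"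
  unfolding gap_def by (intro open_Collect_conj open_Collect_less continuous_intros)

lemma open_side: "open (side \<sigma>)"
  unfolding side_def by (intro open_Un open_UN open_Collect_less continuous_intros ballI open_gap)

lemma gap_side: "gap k \<subseteq> side \<sigma>"
  by (auto simp: side_def)

text \<open>Pushing everything vertically away from the axis stays within the side and ends in a half plane.\<close>

lemma contractible_side:
  assumes "\<sigma> = 1 \<or> \<sigma> = -1" shows "contractible (side \<sigma>)"
proof -
  define H where "H = {z. 1/4 < \<sigma> * Im z}"
  define r where "r z = Complex (Re z) (\<sigma> * max (\<sigma> * Im z) 1)" for z
  have s2: "\<sigma> * (\<sigma> * t) = t" for t using assms by auto
  have rH: "r z \<in> H" for z by (simp add: r_def H_def s2)
  have HS: "H \<subseteq> side \<sigma>" by (auto simp: H_def side_def)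
  have cr: "continuous_on A r" for A
    unfolding r_def Complex_eq by (intro continuous_intros)
  have "homotopic_with_canon (\<lambda>x. True) (side \<sigma>) (side \<sigma>) id r"
  proof (rule homotopic_with_linear)
    fix x assume x: "x \<in> side \<sigma>"
    show "closed_segment (id x) (r x) \<subseteq> side \<sigma>"
    proof
      fix v assume "v \<in> closed_segment (id x) (r x)"
      then obtain u where u: "0 \<le> u" "u \<le> 1" "v = (1 - u) *\<^sub>R x + u *\<^sub>R r x"
        by (auto simp: in_segment)
      have re: "Re v = Re x" by (simp add: u(3) r_def algebra_simps)
      have "\<sigma> * Im v = (1 - u) * (\<sigma> * Im x) + u * max (\<sigma> * Im x) 1"
        using s2 by (simp add: u(3) r_def algebra_simps)
      also have "\<dots> \<ge> (1 - u) * (\<sigma> * Im x) + u * (\<sigma> * Im x)" using u by (intro add_left_mono mult_left_mono) auto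
      finally have "\<sigma> * Im v \<ge> \<sigma> * Im x" by (simp add: algebra_simps)
      then show "v \<in> side \<sigma>" using x re by (auto simp: side_def gap_def)
    qed
  qed (auto intro: cr)
  moreover have "convex H"
  proof -
    have "H = {z. (\<sigma> * \<i>) \<bullet> z > 1/4}" by (auto simp: H_def inner_complex_def)
    then show ?thesis using convex_halfspace_gt by metis
  qed
  then have "homotopic_with_canon (\<lambda>x. True) (side \<sigma>) H r (\<lambda>x. r 0)"
    using rH by (intro homotopic_with_linear cr continuous_on_const) (auto dest: convex_contains_segment[THEN iffD1])
  then have "homotopic_with_canon (\<lambda>x. True) (side \<sigma>) (side \<sigma>) r (\<lambda>x. r 0)"
    by (rule homotopic_with_subset_right) (rule HS)
  ultimately show ?thesis unfolding contractible_def by (meson homotopic_with_trans)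
qed

lemma connected_side: "\<sigma> = 1 \<or> \<sigma> = -1 \<Longrightarrow> connected (side \<sigma>)"
  by (intro contractible_imp_connected contractible_side)

lemma lifts_agree:
  assumes "connected T" "c \<in> T" "w \<in> T" "g1 c = g2 c" "continuous_on T g1" "continuous_on T g2"
    and "\<And>w. w \<in> T \<Longrightarrow> g1 w \<in> regular_pts \<and> g2 w \<in> regular_pts \<and> tanid (g1 w) = tanid (g2 w)"
  shows "g1 w = g2 w"
proof (rule covering_space_lift_unique[where f = "\<lambda>w. tanid (g1 w)" and ?g1.0 = g1 and ?g2.0 = g2 and a = c, OF tanid_covering assms(4)])
  have "continuous_on regular_pts tanid" using tanid_covering by (rule covering_space_imp_continuous)
  then show "continuous_on T (\<lambda>w. tanid (g1 w))"
    using assms by (intro continuous_on_compose2[of regular_pts tanid T g1]) auto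
  show "(\<lambda>w. tanid (g1 w)) \<in> T \<rightarrow> - crit_vals" using assms by (auto simp: regular_pts_def)
qed (use assms in auto)

text \<open>When a frame \<open>\<phi>\<close> is changed to \<open>\<phi> \<circ> \<rho>\<close>, the new sheets are
followed along connected sets \<open>T\<close>: as long as \<open>\<rho>\<close> maps \<open>T\<close> into
one of the old sides, a new sheet over \<open>T\<close> is an old sheet over \<open>\<rho> ` T\<close>.\<close>

lemma sheet_trace:
  assumes "sheets \<sigma> (\<phi> \<circ> \<rho>) s'" "sheets \<tau> \<phi> s" "continuous_on UNIV \<rho>" "connected T"
    and "T \<subseteq> side \<sigma>" "\<rho> ` T \<subseteq> side \<tau>" "c \<in> T" "w \<in> T" "s' x c = s y (\<rho> c)"
  shows "s' x w = s y (\<rho> w)"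
proof (rule lifts_agree[OF assms(4,7,8)])
  show "continuous_on T (s' x)" using assms(1,5) unfolding sheets_def by (blast intro: continuous_on_subset)
  have 1: "continuous_on (side \<tau>) (s y)" using assms(2) by (simp add: sheets_def)
  have 2: "continuous_on T \<rho>" using assms(3) by (rule continuous_on_subset) simp
  show "continuous_on T (\<lambda>w. s y (\<rho> w))" by (rule continuous_on_compose2[OF 1 2 assms(6)])
  fix v assume v: "v \<in> T"
  then have "v \<in> side \<sigma>" "\<rho> v \<in> side \<tau>" using assms(5,6) by auto
  then show "s' x v \<in> regular_pts \<and> s y (\<rho> v) \<in> regular_pts \<and> tanid (s' x v) = tanid (s y (\<rho> v))"
    using assms(1,2) by (simp add: sheets_def)
qed (rule assms(9))

lemma sheet_path:
  assumes "sheets \<sigma> \<phi> s" "connected T" "T \<subseteq> side \<sigma>" "\<phi> ` T \<subseteq> U" "a \<in> T" "b \<in> T"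
  shows "connected_component (preim U) (s x a) (s x b)"
  unfolding connected_component_def
proof (intro exI conjI)
  show "connected (s x ` T)"
    using assms(1-3) unfolding sheets_def by (blast intro: connected_continuous_image continuous_on_subset)
  show "s x ` T \<subseteq> preim U"
    using assms(1,3,4) by (force simp: sheets_def preim_def regular_pts_def)
qed (use assms in auto)

text \<open>A side is simply connected, so every point of the fibre over \<open>b\<close> extends to a lift, and unique
lifting shows that these lifts exhaust the other fibres.\<close>

lemma sheets_from_fibre:
  assumes \<sigma>: "\<sigma> = 1 \<or> \<sigma> = -1" and cont: "continuous_on (side \<sigma>) \<Phi>" and fim: "\<Phi> \<in> side \<sigma> \<rightarrow> - crit_vals"
    and b: "b \<in> side \<sigma>"
    and Z: "\<And>x. Z x \<in> regular_pts \<and> tanid (Z x) = \<Phi> b" "\<And>z. z \<in> regular_pts \<Longrightarrow> tanid z = \<Phi> b \<Longrightarrow> z \<in> range Z"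
  shows "\<exists>s. sheets \<sigma> \<Phi> s \<and> (\<forall>x. s x b = Z x)"
proof -
  let ?S = "side \<sigma>"
  have sc: "simply_connected ?S" "locally path_connected ?S"
    using contractible_side[OF \<sigma>] open_side by (auto intro: contractible_imp_simply_connected open_imp_locally_path_connected)
  have lift: "\<exists>g. continuous_on ?S g \<and> g \<in> ?S \<rightarrow> regular_pts \<and> g w = z \<and> (\<forall>u\<in>?S. tanid (g u) = \<Phi> u)"
    if "w \<in> ?S" "z \<in> regular_pts" "tanid z = \<Phi> w" for w z
    using covering_space_lift_strong[OF tanid_covering that(2,1) sc cont fim] that(3) by metis
  have "\<exists>g. continuous_on ?S g \<and> g \<in> ?S \<rightarrow> regular_pts \<and> g b = Z x \<and> (\<forall>u\<in>?S. tanid (g u) = \<Phi> u)" for x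
    by (rule lift[OF b]) (use Z(1) in auto)
  then obtain s where s: "\<And>x. continuous_on ?S (s x) \<and> s x \<in> ?S \<rightarrow> regular_pts \<and> s x b = Z x \<and>
      (\<forall>u\<in>?S. tanid (s x u) = \<Phi> u)" by metis
  have "\<exists>x. s x w = z" if w: "w \<in> ?S" and z: "z \<in> regular_pts" "tanid z = \<Phi> w" for w z
  proof -
    obtain g where g: "continuous_on ?S g" "g \<in> ?S \<rightarrow> regular_pts" "g w = z" "\<forall>u\<in>?S. tanid (g u) = \<Phi> u"
      using lift[OF w z] by blast
    have "g b \<in> regular_pts" "tanid (g b) = \<Phi> b" using g b by auto
    then obtain x where x: "Z x = g b" using Z(2) by (metis rangeE)
    have "s x w = g w"
    proof (rule lifts_agree[OF connected_side[OF \<sigma>] b w, where ?g1.0 = "s x" and ?g2.0 = g])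
      show "s x b = g b" using s[of x] x by simp
      show "continuous_on ?S (s x)" "continuous_on ?S g" using s[of x] g(1) by blast+
      show "s x w \<in> regular_pts \<and> g w \<in> regular_pts \<and> tanid (s x w) = tanid (g w)" if "w \<in> ?S" for w
        using s[of x] g(2,4) that by (simp add: Pi_iff)
    qed
    then show ?thesis using g(3) by blast
  qed
  then have "sheets \<sigma> \<Phi> s" unfolding sheets_def using s by (simp add: Pi_iff)
  then show ?thesis using s by blast
qed

text \<open>The new sheets are labelled by the old ones over a point deep inside the side, where \<open>\<rho>\<close>
is the identity.\<close>

lemma new_sheets:
  assumes \<sigma>: "\<sigma> = 1 \<or> \<sigma> = -1" and s: "sheets \<sigma> \<phi> s" "sheets (- \<sigma>) \<phi> t"
    and c: "continuous_on UNIV \<phi>" "continuous_on UNIV \<rho>"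
    and \<rho>: "\<rho> ` side \<sigma> \<subseteq> side \<sigma> \<union> side (- \<sigma>)" "\<And>w. 1 \<le> \<sigma> * Im w \<Longrightarrow> \<rho> w = w"
  shows "\<exists>s'. sheets \<sigma> (\<phi> \<circ> \<rho>) s' \<and> (\<forall>x. s' x (Complex 0 (2 * \<sigma>)) = s x (Complex 0 (2 * \<sigma>)))"
proof (rule sheets_from_fibre[OF \<sigma>])
  let ?S = "side \<sigma>" and ?b = "Complex 0 (2 * \<sigma>)"
  show b: "?b \<in> ?S" using \<sigma> by (auto simp: side_def)
  have \<rho>b: "\<rho> ?b = ?b" using \<sigma> by (intro \<rho>(2)) auto
  show "continuous_on ?S (\<phi> \<circ> \<rho>)"
    using c by (intro continuous_on_compose) (blast intro: continuous_on_subset)+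
  have "\<phi> v \<in> - crit_vals" if "v \<in> side \<sigma> \<union> side (- \<sigma>)" for v
  proof -
    have "s 0 v \<in> regular_pts \<and> tanid (s 0 v) = \<phi> v \<or> t 0 v \<in> regular_pts \<and> tanid (t 0 v) = \<phi> v"
      using that s by (auto simp: sheets_def)
    then show ?thesis by (auto simp: regular_pts_def)
  qed
  then show "\<phi> \<circ> \<rho> \<in> ?S \<rightarrow> - crit_vals" using \<rho>(1) by auto
  show "s x ?b \<in> regular_pts \<and> tanid (s x ?b) = (\<phi> \<circ> \<rho>) ?b" for x
    using s(1) b unfolding sheets_def o_apply \<rho>b by blast
  fix z assume z: "z \<in> regular_pts" "tanid z = (\<phi> \<circ> \<rho>) ?b"
  then obtain x where "s x ?b = z" using s(1) b unfolding sheets_def o_apply \<rho>b by blast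
  then show "z \<in> range (\<lambda>x. s x ?b)" by blast
qed

text \<open>Half of the walk around the square \<open>i\<close>: from below it, through the adjacent gap
\<open>k\<close> on its left or right, to above it, always staying in the lake.\<close>

lemma half_ring:
  assumes f: "frame \<phi> s t \<pi>" and k: "k = i \<or> k = i - 1"
  shows "connected_component (preim (\<phi> ` square i)) (s x (mark (-1) i)) (t (\<pi> k x) (mark 1 i))"
proof -
  define e :: real where "e = (if k = i then 7/25 else - (7/25))"
  define c where "c = Complex (of_int i + e) 0"
  define A where "A \<sigma> = {z. \<bar>Re z - of_int i\<bar> < 3/10 \<and> 1/4 < \<sigma> * Im z \<and> \<sigma> * Im z < 3/10} \<union> (gap k \<inter> square i)" for \<sigma>
  have kk: "real_of_int k = (if k = i then of_int i else of_int i - 1)" using k by auto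
  have absd: "\<bar>u - v\<bar> < d \<longleftrightarrow> v - d < u \<and> u < v + d" for u v d :: real by arith
  have absd0: "\<bar>u\<bar> < d \<longleftrightarrow> - d < u \<and> u < d" for u d :: real by arith
  have con: "connected (A \<sigma>)" if \<sigma>: "\<sigma> = 1 \<or> \<sigma> = -1" for \<sigma>
    unfolding A_def
  proof (rule connected_Un)
    have 1: "{z. \<bar>Re z - of_int i\<bar> < 3/10 \<and> 1/4 < \<sigma> * Im z \<and> \<sigma> * Im z < 3/10} =
      {z. 1 \<bullet> z > of_int i - 3/10} \<inter> {z. 1 \<bullet> z < of_int i + 3/10} \<inter>
      {z. (\<sigma> * \<i>) \<bullet> z > 1/4} \<inter> {z. (\<sigma> * \<i>) \<bullet> z < 3/10}"
      unfolding absd absd0 by (auto simp: inner_complex_def)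
    show "connected {z. \<bar>Re z - of_int i\<bar> < 3/10 \<and> 1/4 < \<sigma> * Im z \<and> \<sigma> * Im z < 3/10}"
      unfolding 1 by (intro convex_connected convex_Int convex_halfspace_gt convex_halfspace_lt)
    have 2: "gap k \<inter> square i = {z. 1 \<bullet> z > of_int k + 1/4} \<inter> {z. 1 \<bullet> z < of_int k + 3/4} \<inter>
      {z. 1 \<bullet> z > of_int i - 3/10} \<inter> {z. 1 \<bullet> z < of_int i + 3/10} \<inter>
      {z. \<i> \<bullet> z > - (3/10)} \<inter> {z. \<i> \<bullet> z < 3/10}"
      unfolding gap_def square_def absd absd0 by (auto simp: inner_complex_def)
    show "connected (gap k \<inter> square i)"
      unfolding 2 by (intro convex_connected convex_Int convex_halfspace_gt convex_halfspace_lt)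
    have "Complex (of_int i + e) (\<sigma> * (7/25)) \<in> {z. \<bar>Re z - of_int i\<bar> < 3/10 \<and> 1/4 < \<sigma> * Im z \<and> \<sigma> * Im z < 3/10} \<inter> (gap k \<inter> square i)"
      using \<sigma> kk by (auto simp: e_def gap_def square_def)
    then show "{z. \<bar>Re z - of_int i\<bar> < 3/10 \<and> 1/4 < \<sigma> * Im z \<and> \<sigma> * Im z < 3/10} \<inter> (gap k \<inter> square i) \<noteq> {}" by blast
  qed
  have sub: "A \<sigma> \<subseteq> side \<sigma>" "A \<sigma> \<subseteq> square i" if "\<sigma> = 1 \<or> \<sigma> = -1" for \<sigma>
    using that by (auto simp: A_def side_def square_def)
  have cA: "c \<in> A \<sigma>" for \<sigma> using kk by (auto simp: A_def c_def e_def gap_def square_def)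
  have mA: "mark \<sigma> i \<in> A \<sigma>" if "\<sigma> = 1 \<or> \<sigma> = -1" for \<sigma> using that by (auto simp: A_def mark_def)
  have cg: "c \<in> gap k" using kk by (auto simp: c_def e_def gap_def)
  have fr: "sheets (-1) \<phi> s" "sheets 1 \<phi> t" "s x c = t (\<pi> k x) c" using f cg by (auto simp: frame_def)
  have "connected_component (preim (\<phi> ` square i)) (s x (mark (-1) i)) (s x c)"
    using sub con mA cA by (intro sheet_path[OF fr(1), where T = "A (-1)"] image_mono) auto
  moreover have "connected_component (preim (\<phi> ` square i)) (t (\<pi> k x) c) (t (\<pi> k x) (mark 1 i))"
    using sub con mA cA by (intro sheet_path[OF fr(2), where T = "A 1"] image_mono) auto
  ultimately show ?thesis unfolding fr(3) by (rule connected_component_trans)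
qed

lemma ring:
  assumes f: "frame \<phi> s t \<pi>" and y: "y' \<in> orbit_of (\<pi> i \<circ> inv (\<pi> (i - 1))) y"
  shows "connected_component (preim (\<phi> ` square i)) (t y (mark 1 i)) (t y' (mark 1 i))"
proof -
  let ?C = "connected_component (preim (\<phi> ` square i))"
  have b: "bij (\<pi> k)" for k using f by (simp add: frame_def)
  have step: "?C (t u (mark 1 i)) (t ((\<pi> i \<circ> inv (\<pi> (i - 1))) u) (mark 1 i))" for u
  proof -
    have "?C (s (inv (\<pi> (i - 1)) u) (mark (-1) i)) (t u (mark 1 i))"
      using half_ring[OF f, of "i - 1" i "inv (\<pi> (i - 1)) u"] by (simp add: bij_cancel[OF b])
    then have "?C (t u (mark 1 i)) (s (inv (\<pi> (i - 1)) u) (mark (-1) i))" by (rule connected_component_sym)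
    moreover have "?C (s (inv (\<pi> (i - 1)) u) (mark (-1) i)) (t (\<pi> i (inv (\<pi> (i - 1)) u)) (mark 1 i))"
      using half_ring[OF f, of i i "inv (\<pi> (i - 1)) u"] by simp
    ultimately show ?thesis unfolding o_apply by (rule connected_component_trans)
  qed
  define A where "A = {u. ?C (t y (mark 1 i)) (t u (mark 1 i))}"
  have "invariant_set (\<pi> i \<circ> inv (\<pi> (i - 1))) A"
    unfolding invariant_set_def A_def mem_Collect_eq
    using step by (meson connected_component_sym connected_component_trans)
  moreover have "y \<in> A"
  proof -
    have "mark 1 i \<in> side 1" by (simp add: mark_def side_def)
    then have "t y (mark 1 i) \<in> preim (\<phi> ` square i)"
      using f by (auto simp: frame_def sheets_def preim_def regular_pts_def mark_def square_def)
    then show ?thesis by (simp add: A_def)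
  qed
  ultimately have "orbit_of (\<pi> i \<circ> inv (\<pi> (i - 1))) y \<subseteq> A" by (rule orbit_of_least)
  then have "y' \<in> A" using y by (rule subsetD)
  then show ?thesis by (simp add: A_def)
qed

section \<open>Enlarging a lake by the square next to it\<close>

lemma connected_gap: "connected (gap k)"
proof -
  have "gap k = {z. 1 \<bullet> z > of_int k + 1/4} \<inter> {z. 1 \<bullet> z < of_int k + 3/4}"
    by (auto simp: gap_def inner_complex_def)
  then show ?thesis by (metis convex_connected convex_Int convex_halfspace_gt convex_halfspace_lt)
qed

lemma gap_agree:
  assumes "sheets (-1) \<phi> s" "sheets 1 \<phi> t" "c \<in> gap k" "w \<in> gap k" "s x c = t y c"
  shows "s x w = t y w"
proof (rule lifts_agree[where ?g1.0 = "s x" and ?g2.0 = "t y" and T = "gap k" and c = c])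
  show "continuous_on (gap k) (s x)" "continuous_on (gap k) (t y)"
    using assms(1,2) gap_side unfolding sheets_def by (blast intro: continuous_on_subset)+
  fix w assume "w \<in> gap k"
  then have "w \<in> side (-1)" "w \<in> side 1" using gap_side by blast+
  then show "s x w \<in> regular_pts \<and> t y w \<in> regular_pts \<and> tanid (s x w) = tanid (t y w)"
    using assms(1,2) by (simp add: sheets_def)
qed (use assms connected_gap in auto)

text \<open>A far half plane together with a vertical ray down to height \<open>b\<close>. In the half plane the changes
of frames considered below are the identity, so over a stem the new sheets can be read off from the old
ones.\<close>

definition stem :: "real \<Rightarrow> real \<Rightarrow> real \<Rightarrow> complex set" where
  "stem \<sigma> a b = {z. 1 \<le> \<sigma> * Im z} \<union> {z. Re z = a \<and> b \<le> \<sigma> * Im z}"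

lemma stem_subset_side: "stem \<sigma> (of_int k + 1/2) b \<subseteq> side \<sigma>"
proof
  fix z assume "z \<in> stem \<sigma> (of_int k + 1/2) b"
  then have "1 \<le> \<sigma> * Im z \<or> z \<in> gap k" by (auto simp: stem_def gap_def)
  then show "z \<in> side \<sigma>" by (auto simp: side_def)
qed

lemma connected_stem:
  assumes "\<sigma> = 1 \<or> \<sigma> = -1" "b \<le> 1" shows "connected (stem \<sigma> a b)"
  unfolding stem_def
proof (rule connected_Un)
  have "{z. 1 \<le> \<sigma> * Im z} = {z. (\<sigma> * \<i>) \<bullet> z \<ge> 1}" by (auto simp: inner_complex_def)
  then show "connected {z. 1 \<le> \<sigma> * Im z}" using convex_connected convex_halfspace_ge by metis
  have "{z. Re z = a \<and> b \<le> \<sigma> * Im z} = {z. 1 \<bullet> z = a} \<inter> {z. (\<sigma> * \<i>) \<bullet> z \<ge> b}" by (auto simp: inner_complex_def)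
  then show "connected {z. Re z = a \<and> b \<le> \<sigma> * Im z}"
    by (simp only:) (intro convex_connected convex_Int convex_hyperplane convex_halfspace_ge)
  have "Complex a \<sigma> \<in> {z. 1 \<le> \<sigma> * Im z} \<inter> {z. Re z = a \<and> b \<le> \<sigma> * Im z}" using assms by auto
  then show "{z. 1 \<le> \<sigma> * Im z} \<inter> {z. Re z = a \<and> b \<le> \<sigma> * Im z} \<noteq> {}" by blast
qed

lemma not_side_iff: "z \<notin> side 1 \<union> side (-1) \<longleftrightarrow> \<bar>Im z\<bar> \<le> 1/4 \<and> (\<exists>l::int. \<bar>Re z - of_int l\<bar> \<le> 1/4)"
proof
  assume z: "z \<notin> side 1 \<union> side (-1)"
  define l where "l = \<lfloor>Re z + 1/2\<rfloor>"
  have l: "of_int l \<le> Re z + 1/2" "Re z + 1/2 < of_int l + 1" unfolding l_def by linarith+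
  have "z \<notin> gap l" "z \<notin> gap (l - 1)" using z by (auto simp: side_def)
  then have "\<bar>Re z - of_int l\<bar> \<le> 1/4" using l unfolding gap_def mem_Collect_eq by linarith
  moreover have "\<bar>Im z\<bar> \<le> 1/4" using z by (auto simp: side_def)
  ultimately show "\<bar>Im z\<bar> \<le> 1/4 \<and> (\<exists>l::int. \<bar>Re z - of_int l\<bar> \<le> 1/4)" by blast
next
  assume "\<bar>Im z\<bar> \<le> 1/4 \<and> (\<exists>l::int. \<bar>Re z - of_int l\<bar> \<le> 1/4)"
  then obtain l :: int where *: "\<bar>Im z\<bar> \<le> 1/4" "\<bar>Re z - of_int l\<bar> \<le> 1/4" by blast
  have "z \<notin> gap k" for k
  proof
    assume "z \<in> gap k"
    then have "real_of_int k < of_int l" "real_of_int l < of_int (k + 1)"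
      using *(2) unfolding gap_def mem_Collect_eq of_int_add of_int_1 by linarith+
    then show False unfolding of_int_less_iff by simp
  qed
  then show "z \<notin> side 1 \<union> side (-1)" using *(1) by (auto simp: side_def)
qed

text \<open>The part common to twists and merges, which only affect the gap \<open>i\<close>: the line in the middle of
every other gap is fixed, and comparing new and old sheets along it from both sides shows that the
permutation of this gap does not change.\<close>

lemma move_sheets:
  assumes f: "frame \<phi> s t \<pi>" and h: "homeomorphism UNIV UNIV \<rho> \<eta>"
    and \<rho>: "\<rho> ` (side 1 \<union> side (-1)) \<subseteq> side 1 \<union> side (-1)" "\<And>w. 1 \<le> \<bar>Im w\<bar> \<Longrightarrow> \<rho> w = w"
      "\<And>w k. k \<noteq> i \<Longrightarrow> Re w = of_int k + 1/2 \<Longrightarrow> \<rho> w = w"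
  obtains s' t' where "\<exists>h. homeomorphism UNIV UNIV (\<phi> \<circ> \<rho>) h"
    "sheets (-1) (\<phi> \<circ> \<rho>) s'" "sheets 1 (\<phi> \<circ> \<rho>) t'"
    "\<And>x a b w. b \<le> 1 \<Longrightarrow> stem (-1) a b \<subseteq> side (-1) \<Longrightarrow> \<rho> ` stem (-1) a b \<subseteq> side (-1) \<Longrightarrow> w \<in> stem (-1) a b \<Longrightarrow> s' x w = s x (\<rho> w)"
    "\<And>y a b w. b \<le> 1 \<Longrightarrow> stem 1 a b \<subseteq> side 1 \<Longrightarrow> \<rho> ` stem 1 a b \<subseteq> side 1 \<Longrightarrow> w \<in> stem 1 a b \<Longrightarrow> t' y w = t y (\<rho> w)"
    "\<And>k x w. k \<noteq> i \<Longrightarrow> w \<in> gap k \<Longrightarrow> s' x w = t' (\<pi> k x) w"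
proof -
  have F: "sheets (-1) \<phi> s" "sheets 1 \<phi> t" "\<exists>h. homeomorphism UNIV UNIV \<phi> h"
    "\<And>k x w. w \<in> gap k \<Longrightarrow> s x w = t (\<pi> k x) w" using f by (auto simp: frame_def)
  have c: "continuous_on UNIV \<phi>" "continuous_on UNIV \<rho>" using F(3) h by (auto simp: homeomorphism_def)
  obtain s' where s': "sheets (-1) (\<phi> \<circ> \<rho>) s'" "\<And>x. s' x (Complex 0 (2 * (-1))) = s x (Complex 0 (2 * (-1)))"
    using new_sheets[of "-1" \<phi> s t \<rho>] F(1,2) c \<rho>(1,2) by auto
  obtain t' where t': "sheets 1 (\<phi> \<circ> \<rho>) t'" "\<And>x. t' x (Complex 0 (2 * 1)) = t x (Complex 0 (2 * 1))"
    using new_sheets[of "1" \<phi> t s \<rho>] F(1,2) c \<rho>(1,2) by auto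
  have b: "Complex 0 (2 * \<sigma>) \<in> stem \<sigma> a b" "\<rho> (Complex 0 (2 * \<sigma>)) = Complex 0 (2 * \<sigma>)" if "\<sigma> = 1 \<or> \<sigma> = -1" for \<sigma> a b
    using that by (auto simp: stem_def intro!: \<rho>(2))
  have tr1: "s' x w = s x (\<rho> w)" if "b \<le> 1" "stem (-1) a b \<subseteq> side (-1)" "\<rho> ` stem (-1) a b \<subseteq> side (-1)" "w \<in> stem (-1) a b" for x a b w
  proof (rule sheet_trace[where s' = s' and x = x and s = s and y = x and c = "Complex 0 (2 * (-1))", OF s'(1) F(1) c(2) connected_stem[OF _ that(1)] that(2,3)])
    show "s' x (Complex 0 (2 * (-1))) = s x (\<rho> (Complex 0 (2 * (-1))))" unfolding b(2)[OF disjI2[OF refl]] by (rule s'(2))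
    show "Complex 0 (2 * (-1)) \<in> stem (-1) a b" by (rule b(1)) simp
  qed (use that(4) in simp_all)
  have tr2: "t' x w = t x (\<rho> w)" if "b \<le> 1" "stem 1 a b \<subseteq> side 1" "\<rho> ` stem 1 a b \<subseteq> side 1" "w \<in> stem 1 a b" for x a b w
  proof (rule sheet_trace[where s' = t' and x = x and s = t and y = x and c = "Complex 0 (2 * 1)", OF t'(1) F(2) c(2) connected_stem[OF _ that(1)] that(2,3)])
    show "t' x (Complex 0 (2 * 1)) = t x (\<rho> (Complex 0 (2 * 1)))" unfolding b(2)[OF disjI1[OF refl]] by (rule t'(2))
    show "Complex 0 (2 * 1) \<in> stem 1 a b" by (rule b(1)) simp
  qed (use that(4) in simp_all)
  have g: "s' x w = t' (\<pi> k x) w" if k: "k \<noteq> i" and w: "w \<in> gap k" for k x w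
  proof -
    define p where "p = Complex (of_int k + 1/2) 0"
    have pg: "p \<in> gap k" by (simp add: p_def gap_def)
    have sub: "stem \<sigma> (of_int k + 1/2) 0 \<subseteq> side \<sigma>" for \<sigma>
  by (rule stem_subset_side)
    have id: "\<rho> w = w" if "w \<in> stem \<sigma> (of_int k + 1/2) 0" "\<sigma> = 1 \<or> \<sigma> = -1" for w \<sigma>
      using that \<rho>(2)[of w] \<rho>(3)[OF k, of w] by (auto simp: stem_def)
    have im: "\<rho> ` stem \<sigma> (of_int k + 1/2) 0 \<subseteq> side \<sigma>" if "\<sigma> = 1 \<or> \<sigma> = -1" for \<sigma>
      using id[OF _ that] sub[of \<sigma>] by auto
    have p: "p \<in> stem \<sigma> (of_int k + 1/2) 0" for \<sigma> by (simp add: p_def stem_def)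
    have "s' x p = s x p" using tr1[OF _ sub im p, of x] id[OF p, of 1] by simp
    moreover have "t' (\<pi> k x) p = t (\<pi> k x) p" using tr2[OF _ sub im p, of "\<pi> k x"] id[OF p, of 1] by simp
    ultimately have "s' x p = t' (\<pi> k x) p" using F(4)[OF pg] by simp
    then show ?thesis by (rule gap_agree[where c = p, OF s'(1) t'(1) pg w])
  qed
  have "\<exists>h. homeomorphism UNIV UNIV (\<phi> \<circ> \<rho>) h"
  proof -
    obtain h1 where "homeomorphism UNIV UNIV \<phi> h1" using F(3) by blast
    from homeomorphism_compose[OF h this] show ?thesis by blast
  qed
  then show ?thesis using s'(1) t'(1) tr1 tr2 g by (rule that)
qed

text \<open>For \<open>\<omega> = 1\<close> this increasing piecewise linear map is \<open>u / 3 - 1/6\<close> on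
\<open>[-1/4, 5/4]\<close>, which presses the intervals of radius \<open>1/4\<close> about \<open>0\<close>
and \<open>1\<close> into the first of them, and it is the identity outside \<open>[-1/4, 3/2]\<close>.
Smaller values of \<open>\<omega>\<close> interpolate between it and the identity.\<close>

definition squeeze :: "real \<Rightarrow> real \<Rightarrow> real" where
  "squeeze \<omega> u = min u (max (u - 2 * \<omega> / 3 * (u + 1/4)) (u + 4 * \<omega> * (u - 3/2)))"

text \<open>The inverse: a minimum of increasing maps is inverted by the maximum of their inverses, and vice versa.\<close>

definition unsqueeze :: "real \<Rightarrow> real \<Rightarrow> real" where
  "unsqueeze \<omega> v = max v (min ((v + \<omega> / 6) / (1 - 2 * \<omega> / 3)) ((v + 6 * \<omega>) / (1 + 4 * \<omega>)))"

lemma squeeze_inverse: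
  assumes "0 \<le> \<omega>" "\<omega> \<le> 1"
  shows "unsqueeze \<omega> v = u \<longleftrightarrow> squeeze \<omega> u = v"
proof -
  have p: "0 < 1 - 2 * \<omega> / 3" "0 < 1 + 4 * \<omega>" using assms by auto
  have a: "(v + \<omega> / 6) / (1 - 2 * \<omega> / 3) \<le> u \<longleftrightarrow> v \<le> u - 2 * \<omega> / 3 * (u + 1/4)"
    "u \<le> (v + \<omega> / 6) / (1 - 2 * \<omega> / 3) \<longleftrightarrow> u - 2 * \<omega> / 3 * (u + 1/4) \<le> v"
    unfolding pos_divide_le_eq[OF p(1)] pos_le_divide_eq[OF p(1)] by (auto simp: field_simps)
  have b: "(v + 6 * \<omega>) / (1 + 4 * \<omega>) \<le> u \<longleftrightarrow> v \<le> u + 4 * \<omega> * (u - 3/2)"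
    "u \<le> (v + 6 * \<omega>) / (1 + 4 * \<omega>) \<longleftrightarrow> u + 4 * \<omega> * (u - 3/2) \<le> v"
    unfolding pos_divide_le_eq[OF p(2)] pos_le_divide_eq[OF p(2)] by (auto simp: algebra_simps)
  show ?thesis
    unfolding order_eq_iff[where 'a = real] squeeze_def unsqueeze_def max.bounded_iff min.bounded_iff
      le_max_iff_disj min_le_iff_disj a b by blast
qed

lemma squeeze_id: "0 \<le> \<omega> \<Longrightarrow> u \<le> - (1/4) \<or> 3/2 \<le> u \<or> \<omega> = 0 \<Longrightarrow> squeeze \<omega> u = u"
proof -
  assume w: "0 \<le> \<omega>" and u: "u \<le> - (1/4) \<or> 3/2 \<le> u \<or> \<omega> = 0"
  have "2 * \<omega> / 3 * (u + 1/4) \<le> 0 \<or> 0 \<le> 4 * \<omega> * (u - 3/2)"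
    using u
  proof (elim disjE)
    assume "u \<le> - (1/4)"
    then have "2 * \<omega> / 3 * (u + 1/4) \<le> 0" using w by (intro mult_nonneg_nonpos) auto
    then show ?thesis ..
  next
    assume "3/2 \<le> u"
    then have "0 \<le> 4 * \<omega> * (u - 3/2)" using w by (intro mult_nonneg_nonneg) auto
    then show ?thesis ..
  qed simp
  then have "u \<le> max (u - 2 * \<omega> / 3 * (u + 1/4)) (u + 4 * \<omega> * (u - 3/2))"
    unfolding le_max_iff_disj by linarith
  then show ?thesis unfolding squeeze_def by (rule min_absorb1)
qed

lemma squeeze_one:
  assumes "- (1/4) \<le> u" "u \<le> 5/4" shows "squeeze 1 u = u / 3 - 1/6"
proof -
  have "max (u - 2 * 1 / 3 * (u + 1/4)) (u + 4 * 1 * (u - 3/2)) = u - 2 * 1 / 3 * (u + 1/4)"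
    using assms by (intro max_absorb1) (simp add: field_simps)
  then show ?thesis unfolding squeeze_def using assms by (simp add: min_def field_simps)
qed

lemma squeeze_one_range:
  assumes "- (1/4) \<le> u" "u \<le> 5/4" shows "\<bar>squeeze 1 u\<bar> \<le> 1/4"
proof -
  have "u / 3 - 1/6 \<le> 1/4" "- (u / 3 - 1/6) \<le> 1/4" using assms by linarith+
  then show ?thesis unfolding squeeze_one[OF assms] by (rule abs_leI)
qed

lemma squeeze_one_small:
  assumes "\<bar>u\<bar> < 3/10" shows "\<bar>squeeze 1 u\<bar> < 3/10"
proof (cases "- (1/4) \<le> u")
  case True
  then have "\<bar>squeeze 1 u\<bar> \<le> 1/4" using assms by (intro squeeze_one_range) linarith+
  then show ?thesis by simp
next
  case False
  then show ?thesis using squeeze_id[of 1 u] assms by simp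
qed

definition weight :: "real \<Rightarrow> real" where "weight y = max 0 (min 1 (2 - 2 * \<bar>y\<bar>))"

lemma weight: "0 \<le> weight y" "weight y \<le> 1" "1 \<le> \<bar>y\<bar> \<Longrightarrow> weight y = 0" "\<bar>y\<bar> \<le> 1/2 \<Longrightarrow> weight y = 1"
  by (auto simp: weight_def)

definition merge_in :: "int \<Rightarrow> complex \<Rightarrow> complex" where
  "merge_in i z = Complex (of_int i + squeeze (weight (Im z)) (Re z - of_int i)) (Im z)"

definition merge_out :: "int \<Rightarrow> complex \<Rightarrow> complex" where
  "merge_out i z = Complex (of_int i + unsqueeze (weight (Im z)) (Re z - of_int i)) (Im z)"

lemma merge_inverse: "merge_out i (merge_in i z) = z" "merge_in i (merge_out i z) = z"
proof -
  have "unsqueeze (weight y) (squeeze (weight y) u) = u" "squeeze (weight y) (unsqueeze (weight y) u) = u" for y u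
    using squeeze_inverse[OF weight(1,2)] by blast+
  then show "merge_out i (merge_in i z) = z" "merge_in i (merge_out i z) = z"
    by (simp_all add: merge_in_def merge_out_def complex_eq_iff)
qed

lemma merge_out_eq: "merge_out i w = z \<longleftrightarrow> merge_in i z = w"
  using merge_inverse by metis

lemma merge_homeo: "homeomorphism UNIV UNIV (merge_out i) (merge_in i)"
proof (rule homeomorphismI)
  have "1 - 2 * weight y / 3 \<noteq> 0" "1 + 4 * weight y \<noteq> 0" for y using weight(1,2)[of y] by linarith+
  moreover have "continuous_on UNIV (\<lambda>z. weight (Im z))" unfolding weight_def by (intro continuous_intros)
  ultimately show "continuous_on UNIV (merge_out i)" "continuous_on UNIV (merge_in i)"
    unfolding merge_out_def merge_in_def squeeze_def unsqueeze_def Complex_eq by (auto intro!: continuous_intros)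
qed (auto simp: merge_inverse)

text \<open>In the new frame \<open>\<phi> \<circ> merge_out i\<close> the square \<open>i\<close> covers the old lake,
the part of the old square \<open>i + 1\<close> that can contain critical values, and a bridge between them,
while nothing is left at position \<open>i + 1\<close>. Near the axis, the middle line of the new gap
\<open>i\<close> is the old line at abscissa \<open>i + 13/10\<close>, in the gap behind the swallowed
square. So the sheets are matched there by \<open>\<pi> (i + 1)\<close>.\<close>

lemma frame_merge:
  assumes f: "frame \<phi> s t \<pi>"
  shows "\<exists>\<phi>' s' t'. frame \<phi>' s' t' (\<pi>(i := \<pi> (i + 1))) \<and> \<phi> ` square i \<subseteq> \<phi>' ` square i \<and>
    (\<forall>l. l \<noteq> i \<and> l \<noteq> i + 1 \<longrightarrow> \<phi>' ` square l = \<phi> ` square l) \<and>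
    (\<forall>y. connected_component (preim (\<phi>' ` square i)) (t y (mark 1 i)) (t' y (mark 1 i)))"
proof -
  let ?\<rho> = "merge_out i"
  have fixed: "?\<rho> z = z" if "Re z \<le> of_int i - 1/4 \<or> of_int i + 3/2 \<le> Re z \<or> 1 \<le> \<bar>Im z\<bar>" for z
    unfolding merge_out_eq merge_in_def
    using squeeze_id[OF weight(1), of "Re z - of_int i" "Im z"] that weight(3)[of "Im z"] by (auto simp: complex_eq_iff)
  have sides: "?\<rho> ` (side 1 \<union> side (-1)) \<subseteq> side 1 \<union> side (-1)"
  proof -
    have "w \<notin> side 1 \<union> side (-1)" if v: "?\<rho> w \<notin> side 1 \<union> side (-1)" for w
    proof -
      define z where "z = ?\<rho> w"
      have w: "w = merge_in i z" by (simp add: z_def merge_inverse)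
      obtain l :: int where l: "\<bar>Im z\<bar> \<le> 1/4" "\<bar>Re z - of_int l\<bar> \<le> 1/4" using v unfolding z_def not_side_iff by blast
      consider "l \<le> i - 1" | "l = i" | "l = i + 1" | "i + 2 \<le> l" by linarith
      then show ?thesis
      proof cases
        case 1
        then have "?\<rho> z = z" using l by (intro fixed) linarith
        then have "w = z" using w merge_inverse by metis
        then show ?thesis using v z_def by simp
      next
        case 4
        then have "?\<rho> z = z" using l by (intro fixed) linarith
        then have "w = z" using w merge_inverse by metis
        then show ?thesis using v z_def by simp
      next
        case 2
        have "\<bar>squeeze 1 (Re z - of_int i)\<bar> \<le> 1/4"
          using l(2) unfolding 2 by (intro squeeze_one_range) linarith+
        then show ?thesis unfolding not_side_iff w using l weight(4)[of "Im z"]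
          by (auto simp: merge_in_def intro!: exI[of _ i])
      next
        case 3
        have "\<bar>squeeze 1 (Re z - of_int i)\<bar> \<le> 1/4"
          using l(2) unfolding 3 of_int_add of_int_1 by (intro squeeze_one_range) linarith+
        then show ?thesis unfolding not_side_iff w using l weight(4)[of "Im z"]
          by (auto simp: merge_in_def intro!: exI[of _ i])
      qed
    qed
    then show ?thesis by blast
  qed
  have lines: "?\<rho> w = w" if "k \<noteq> i" "Re w = of_int k + 1/2" for w k
    using that by (intro fixed) (cases "k < i"; linarith)
  obtain s' t' where st: "\<exists>h. homeomorphism UNIV UNIV (\<phi> \<circ> ?\<rho>) h"
    "sheets (-1) (\<phi> \<circ> ?\<rho>) s'" "sheets 1 (\<phi> \<circ> ?\<rho>) t'"
    "\<And>x a b w. b \<le> 1 \<Longrightarrow> stem (-1) a b \<subseteq> side (-1) \<Longrightarrow> ?\<rho> ` stem (-1) a b \<subseteq> side (-1) \<Longrightarrow> w \<in> stem (-1) a b \<Longrightarrow> s' x w = s x (?\<rho> w)"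
    "\<And>y a b w. b \<le> 1 \<Longrightarrow> stem 1 a b \<subseteq> side 1 \<Longrightarrow> ?\<rho> ` stem 1 a b \<subseteq> side 1 \<Longrightarrow> w \<in> stem 1 a b \<Longrightarrow> t' y w = t y (?\<rho> w)"
    "\<And>k x w. k \<noteq> i \<Longrightarrow> w \<in> gap k \<Longrightarrow> s' x w = t' (\<pi> k x) w"
    by (rule move_sheets[OF f merge_homeo[of i] sides _ lines]) (use fixed in blast)+
  have fs: "sheets 1 \<phi> t" "\<And>k x w. w \<in> gap k \<Longrightarrow> s x w = t (\<pi> k x) w" "\<And>k. bij (\<pi> k)" using f by (auto simp: frame_def)
  define p where "p = Complex (of_int i + 1/2) 0"
  define q where "q = Complex (of_int i + 13/10) 0"
  \<comment> \<open>\<open>13/10\<close> solves \<open>5 u - 6 = 1/2\<close>.\<close>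
  have out: "?\<rho> (Complex (of_int i + 1/2) y) = Complex (of_int i + 13/10) y" if "\<bar>y\<bar> \<le> 1/2" for y
    unfolding merge_out_eq merge_in_def using weight(4)[OF that] by (simp add: squeeze_def)
  have sub: "stem \<sigma> (of_int i + 1/2) 0 \<subseteq> side \<sigma>" for \<sigma>
by (rule stem_subset_side)
  have im: "?\<rho> ` stem \<sigma> (of_int i + 1/2) 0 \<subseteq> side \<sigma>" if \<sigma>: "\<sigma> = 1 \<or> \<sigma> = -1" for \<sigma>
  proof (rule image_subsetI)
    fix w assume w: "w \<in> stem \<sigma> (of_int i + 1/2) 0"
    show "?\<rho> w \<in> side \<sigma>"
    proof (cases "1/4 < \<sigma> * Im w")
      case True then show ?thesis by (simp add: side_def merge_out_def)
    next
      case False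
      then have "w = Complex (of_int i + 1/2) (Im w)" "\<bar>Im w\<bar> \<le> 1/2" using w \<sigma> by (auto simp: stem_def complex_eq_iff)
      then have "?\<rho> w \<in> gap (i + 1)" using out[of "Im w"] by (simp add: gap_def)
      then show ?thesis using gap_side by blast
    qed
  qed
  have pq: "?\<rho> p = q" using out[of 0] by (simp add: p_def q_def)
  have ps: "p \<in> stem \<sigma> (of_int i + 1/2) 0" for \<sigma> by (simp add: p_def stem_def)
  have "s' x p = t' (\<pi> (i + 1) x) p" for x
  proof -
    have "s' x p = s x q" using st(4)[OF _ sub im ps, of x] pq by simp
    moreover have "t' (\<pi> (i + 1) x) p = t (\<pi> (i + 1) x) q" using st(5)[OF _ sub im ps, of "\<pi> (i + 1) x"] pq by simp
    ultimately show ?thesis using fs(2)[of q "i + 1" x] by (simp add: q_def gap_def)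
  qed
  then have gi: "s' x w = t' (\<pi> (i + 1) x) w" if "w \<in> gap i" for x w
    using gap_agree[OF st(2,3) _ that, of p] by (simp add: p_def gap_def)
  have fr: "frame (\<phi> \<circ> ?\<rho>) s' t' (\<pi>(i := \<pi> (i + 1)))"
    unfolding frame_def using st(1,2,3,6) gi fs(3) by auto
  have into: "\<phi> ` T \<subseteq> (\<phi> \<circ> ?\<rho>) ` square i" if "merge_in i ` T \<subseteq> square i" for T
  proof
    fix v assume "v \<in> \<phi> ` T"
    then obtain u where "u \<in> T" "v = \<phi> u" by blast
    then have "merge_in i u \<in> square i" "v = (\<phi> \<circ> ?\<rho>) (merge_in i u)" using that by (auto simp: merge_inverse)
    then show "v \<in> (\<phi> \<circ> ?\<rho>) ` square i" by blast
  qed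
  have 1: "\<phi> ` square i \<subseteq> (\<phi> \<circ> ?\<rho>) ` square i"
  proof (rule into, rule image_subsetI)
    fix z assume z: "z \<in> square i"
    then have "\<bar>squeeze 1 (Re z - of_int i)\<bar> < 3/10" unfolding square_def by (intro squeeze_one_small) blast
    then show "merge_in i z \<in> square i" using z weight(4)[of "Im z"] by (simp add: merge_in_def square_def)
  qed
  have 2: "(\<phi> \<circ> ?\<rho>) ` square l = \<phi> ` square l" if "l \<noteq> i" "l \<noteq> i + 1" for l
  proof -
    have "?\<rho> z = z" if z: "z \<in> square l" for z
    proof (rule fixed)
      have "l \<le> i - 1 \<or> i + 2 \<le> l" using \<open>l \<noteq> i\<close> \<open>l \<noteq> i + 1\<close> by linarith
      then show "Re z \<le> of_int i - 1/4 \<or> of_int i + 3/2 \<le> Re z \<or> 1 \<le> \<bar>Im z\<bar>"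
        using z unfolding square_def mem_Collect_eq by linarith
    qed
    then show ?thesis by (auto simp: image_def)
  qed
  have 3: "connected_component (preim ((\<phi> \<circ> ?\<rho>) ` square i)) (t y (mark 1 i)) (t' y (mark 1 i))" for y
  proof -
    \<comment> \<open>The new mark is the point above the middle of the old gap \<open>i\<close>; it is joined to the old mark
    within the bridge.\<close>
    define T where "T = closed_segment (mark 1 i) (Complex (of_int i + 1/2) (7/25))"
    have T: "Im z = 7/25 \<and> of_int i \<le> Re z \<and> Re z \<le> of_int i + 1/2" if "z \<in> T" for z
    proof -
      from that obtain u where u: "0 \<le> u" "u \<le> 1" "z = (1 - u) *\<^sub>R mark 1 i + u *\<^sub>R Complex (of_int i + 1/2) (7/25)"
        by (auto simp: T_def in_segment)
      show ?thesis using u(1,2) unfolding u(3) by (simp add: mark_def algebra_simps)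
    qed
    have Ts: "T \<subseteq> side 1"
    proof
      fix z assume "z \<in> T"
      then have "Im z = 7/25" using T by blast
      then show "z \<in> side 1" by (simp add: side_def)
    qed
    have "merge_in i ` T \<subseteq> square i"
    proof (rule image_subsetI)
      fix z assume "z \<in> T"
      note z = T[OF this]
      then have "\<bar>squeeze 1 (Re z - of_int i)\<bar> \<le> 1/4" by (intro squeeze_one_range) linarith+
      then have "\<bar>squeeze 1 (Re z - of_int i)\<bar> < 3/10" by simp
      then show "merge_in i z \<in> square i" using z weight(4)[of "Im z"] by (simp add: merge_in_def square_def)
    qed
    then have "connected_component (preim ((\<phi> \<circ> ?\<rho>) ` square i)) (t y (mark 1 i)) (t y (Complex (of_int i + 1/2) (7/25)))"
      using Ts by (intro sheet_path[OF fs(1), where T = T] into) (simp_all add: T_def)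
    moreover have "t' y (mark 1 i) = t y (Complex (of_int i + 1/2) (7/25))"
    proof -
      have "stem 1 (of_int i) (7/25) \<subseteq> side 1" by (auto simp: stem_def side_def)
      moreover have "?\<rho> ` stem 1 (of_int i) (7/25) \<subseteq> side 1" by (auto simp: stem_def side_def merge_out_def)
      moreover have "?\<rho> (mark 1 i) = Complex (of_int i + 1/2) (7/25)"
        unfolding merge_out_eq merge_in_def using weight(4)[of "7/25"] by (simp add: squeeze_def mark_def)
      ultimately show ?thesis using st(5)[of "7/25" "of_int i" "mark 1 i" y] by (simp add: stem_def mark_def)
    qed
    ultimately show ?thesis by simp
  qed
  show ?thesis using fr 1 2 3 by blast
qed

section \<open>Half twists\<close>

text \<open>Half a turn up to radius \<open>9/10\<close>, decreasing to none at radius \<open>1\<close>.\<close>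

definition angle :: "real \<Rightarrow> real" where "angle r = pi * max 0 (min 1 (10 * (1 - r)))"

lemma angle: "1 \<le> r \<Longrightarrow> angle r = 0" "r \<le> 9/10 \<Longrightarrow> angle r = pi"
  by (auto simp: angle_def)

definition spin :: "real \<Rightarrow> complex \<Rightarrow> complex" where
  "spin \<epsilon> v = v * cis (\<epsilon> * angle (norm v))"

lemma spin_simps: "1 \<le> norm v \<Longrightarrow> spin \<epsilon> v = v" "norm v \<le> 9/10 \<Longrightarrow> spin 1 v = - v" "norm v \<le> 9/10 \<Longrightarrow> spin (-1) v = - v"
  "norm (spin \<epsilon> v) = norm v" "spin 1 (spin (-1) v) = v" "spin (-1) (spin 1 v) = v"
proof -
  show n: "norm (spin \<epsilon> v) = norm v" for \<epsilon> v by (simp add: spin_def norm_mult)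
  show "1 \<le> norm v \<Longrightarrow> spin \<epsilon> v = v" "norm v \<le> 9/10 \<Longrightarrow> spin 1 v = - v" "norm v \<le> 9/10 \<Longrightarrow> spin (-1) v = - v"
    by (simp_all add: spin_def angle cis_neq_zero flip: cis_inverse)
  have "spin a (spin b v) = v * (cis (b * angle (norm v)) * cis (a * angle (norm v)))" for a b
    unfolding spin_def[of a] n by (simp add: spin_def)
  then show "spin 1 (spin (-1) v) = v" "spin (-1) (spin 1 v) = v" by (simp_all add: cis_mult)
qed

text \<open>The spin about the midpoint between the squares \<open>k\<close> and \<open>k + 1\<close>.\<close>

definition turn :: "real \<Rightarrow> int \<Rightarrow> complex \<Rightarrow> complex" where
  "turn \<epsilon> k w = Complex (of_int k + 1/2) 0 + spin \<epsilon> (w - Complex (of_int k + 1/2) 0)"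

lemma turn_inverse: "turn 1 k (turn (-1) k w) = w" "turn (-1) k (turn 1 k w) = w"
  by (simp_all add: turn_def spin_simps)

lemma turn_homeo: "homeomorphism UNIV UNIV (turn (-1) k) (turn 1 k)"
proof (rule homeomorphismI)
  have "continuous_on UNIV (turn \<epsilon> k)" for \<epsilon>
    unfolding turn_def spin_def angle_def cis_conv_exp by (intro continuous_intros)
  then show "continuous_on UNIV (turn (-1) k)" "continuous_on UNIV (turn 1 k)" by blast+
qed (auto simp: turn_inverse)

lemma cmod_le_iff: "0 \<le> r \<Longrightarrow> norm (z::complex) \<le> r \<longleftrightarrow> (Re z)\<^sup>2 + (Im z)\<^sup>2 \<le> r\<^sup>2"
  unfolding cmod_power2[symmetric] by (rule power_mono_iff[symmetric]) auto

lemma turn_far: "1 \<le> \<bar>Re w - (of_int k + 1/2)\<bar> \<or> 1 \<le> \<bar>Im w\<bar> \<Longrightarrow> turn \<epsilon> k w = w"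
  using abs_Re_le_cmod[of "w - Complex (of_int k + 1/2) 0"] abs_Im_le_cmod[of "w - Complex (of_int k + 1/2) 0"]
  by (auto simp: turn_def spin_simps(1))

lemma turn_near:
  assumes "(Re w - (of_int k + 1/2))\<^sup>2 + (Im w)\<^sup>2 \<le> 81/100" "\<epsilon> = 1 \<or> \<epsilon> = -1"
  shows "turn \<epsilon> k w = Complex (2 * of_int k + 1 - Re w) (- Im w)"
proof -
  have "norm (w - Complex (of_int k + 1/2) 0) \<le> 9/10"
    using assms(1) by (subst cmod_le_iff) (auto simp: power2_eq_square)
  then show ?thesis using assms(2) by (auto simp: turn_def spin_simps complex_eq_iff)
qed

lemma turn_vertical:
  assumes "0 \<le> r" "\<sigma> = 1 \<or> \<sigma> = -1"
  shows "turn (-1) k (Complex (of_int k + 1/2) (\<sigma> * r)) =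
    Complex (of_int k + 1/2 + \<sigma> * (r * sin (angle r))) (\<sigma> * (r * cos (angle r)))"
proof -
  have n: "norm (Complex 0 (\<sigma> * r)) = r" using assms by (auto simp: cmod_def abs_mult)
  have d: "Complex (of_int k + 1/2) (\<sigma> * r) - Complex (of_int k + 1/2) 0 = Complex 0 (\<sigma> * r)"
    by (simp add: complex_eq_iff)
  show ?thesis unfolding turn_def spin_def d n by (simp add: complex_eq_iff algebra_simps)
qed

text \<open>Near the real axis the annulus in which the twisting happens lies in the gaps \<open>k - 1\<close> and
\<open>k + 1\<close>; therefore its two halves belong to the two sides.\<close>

lemma annulus_side:
  assumes "9/10 \<le> r" "r \<le> 1" "a\<^sup>2 + b\<^sup>2 = r\<^sup>2" "0 \<le> \<sigma> * b" "\<sigma> = 1 \<or> \<sigma> = -1"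
  shows "Complex (of_int k + 1/2 + a) b \<in> side \<sigma>"
proof (cases "1/4 < \<sigma> * b")
  case False
  have r2: "81/100 \<le> r\<^sup>2" "r\<^sup>2 \<le> 1"
    using power_mono[of "9/10" r 2] power_mono[of r 1 2] assms(1,2) by (auto simp: power2_eq_square)
  have "\<bar>b\<bar> \<le> 1/4" using False assms(4,5) by auto
  then have "b\<^sup>2 \<le> (1/4)\<^sup>2" using abs_le_square_iff[of b "1/4"] by simp
  then have "(3/4)\<^sup>2 < a\<^sup>2" "a\<^sup>2 \<le> 1\<^sup>2" using assms(3) r2 zero_le_square[of b] unfolding power2_eq_square by linarith+
  then have a: "3/4 < \<bar>a\<bar>" "\<bar>a\<bar> \<le> 1"
    using abs_le_square_iff[of a "3/4"] abs_le_square_iff[of a 1] by auto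
  have "Complex (of_int k + 1/2 + a) b \<in> gap (if 0 < a then k + 1 else k - 1)"
    using a by (auto simp: gap_def)
  then show ?thesis using gap_side by blast
qed (simp add: side_def)

text \<open>The spoke from the rim of the twisted disc to its centre is wound by \<open>turn (-1)\<close> from one half
of the annulus to the other. The change takes place at radius \<open>19/20\<close>, where the angle is a
right one.\<close>

lemma turn_spoke_side:
  assumes \<sigma>: "\<sigma> = 1 \<or> \<sigma> = -1"
  shows "turn (-1) k ` stem \<sigma> (of_int k + 1/2) (19/20) \<subseteq> side \<sigma>"
    and "turn (-1) k ` {w. Re w = of_int k + 1/2 \<and> 0 \<le> \<sigma> * Im w \<and> \<sigma> * Im w \<le> 19/20} \<subseteq> side (- \<sigma>)"
proof -
  have w: "w = Complex (of_int k + 1/2) (\<sigma> * (\<sigma> * Im w))" if "Re w = of_int k + 1/2" for w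
    using that \<sigma> by (auto simp: complex_eq_iff)
  have square: "(\<sigma> * (r * sin t))\<^sup>2 + (\<sigma> * (r * cos t))\<^sup>2 = r\<^sup>2" for r t
    using \<sigma> by (auto simp: power_mult_distrib simp flip: distrib_left)
  show "turn (-1) k ` stem \<sigma> (of_int k + 1/2) (19/20) \<subseteq> side \<sigma>"
  proof (rule image_subsetI)
    fix w assume wS: "w \<in> stem \<sigma> (of_int k + 1/2) (19/20)"
    show "turn (-1) k w \<in> side \<sigma>"
    proof (cases "1 \<le> \<sigma> * Im w")
      case True
      then have "turn (-1) k w = w" using \<sigma> by (intro turn_far) auto
      then show ?thesis using True by (simp add: side_def)
    next
      case False
      define r where "r = \<sigma> * Im w"
      have r: "19/20 \<le> r" "r \<le> 1" "Re w = of_int k + 1/2" using wS False by (auto simp: stem_def r_def)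
      have "0 \<le> angle r" "angle r \<le> pi / 2" using r by (auto simp: angle_def)
      then have "0 \<le> cos (angle r)" by (intro cos_ge_zero) auto
      then have c: "0 \<le> \<sigma> * (\<sigma> * (r * cos (angle r)))" using r \<sigma> by auto
      have "turn (-1) k w = turn (-1) k (Complex (of_int k + 1/2) (\<sigma> * r))" using w[OF r(3)] by (simp add: r_def)
      also have "\<dots> \<in> side \<sigma>"
        unfolding turn_vertical[OF order_trans[OF _ r(1)] \<sigma>, simplified]
        using r by (intro annulus_side[of r] square c \<sigma>) auto
      finally show ?thesis .
    qed
  qed
  show "turn (-1) k ` {w. Re w = of_int k + 1/2 \<and> 0 \<le> \<sigma> * Im w \<and> \<sigma> * Im w \<le> 19/20} \<subseteq> side (- \<sigma>)"
  proof (rule image_subsetI)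
    fix w assume wS: "w \<in> {w. Re w = of_int k + 1/2 \<and> 0 \<le> \<sigma> * Im w \<and> \<sigma> * Im w \<le> 19/20}"
    define r where "r = \<sigma> * Im w"
    have r: "0 \<le> r" "r \<le> 19/20" "Re w = of_int k + 1/2" using wS by (auto simp: r_def)
    have e: "turn (-1) k w = turn (-1) k (Complex (of_int k + 1/2) (\<sigma> * r))" using w[OF r(3)] by (simp add: r_def)
    show "turn (-1) k w \<in> side (- \<sigma>)"
    proof (cases "r \<le> 9/10")
      case True
      then have "turn (-1) k w \<in> gap k" unfolding e turn_vertical[OF r(1) \<sigma>] by (simp add: angle gap_def)
      then show ?thesis using gap_side by blast
    next
      case False
      have "pi / 2 \<le> angle r" "angle r \<le> pi" using r False by (auto simp: angle_def)
      then have "0 \<le> cos (pi - angle r)" by (intro cos_ge_zero) auto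
      then have "cos (angle r) \<le> 0" by simp
      then have c: "0 \<le> - \<sigma> * (\<sigma> * (r * cos (angle r)))" using r \<sigma> by (auto simp: mult_nonneg_nonpos)
      show ?thesis unfolding e turn_vertical[OF r(1) \<sigma>]
        using r False \<sigma> by (intro annulus_side[of r] square c) auto
    qed
  qed
qed

lemma far_from_turn:
  fixes x a b :: real
  assumes "\<bar>x - a\<bar> \<le> 3/10" "a \<le> b - 1 \<or> b + 2 \<le> a" shows "1 \<le> \<bar>x - (b + 1/2)\<bar>"
  using assms(2)
proof
  assume "a \<le> b - 1"
  then have "1 \<le> - (x - (b + 1/2))" using assms(1) by linarith
  then show ?thesis by (rule order_trans) (rule abs_ge_minus_self)
next
  assume "b + 2 \<le> a"
  then have "1 \<le> x - (b + 1/2)" using assms(1) by linarith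
  then show ?thesis by (rule order_trans) (rule abs_ge_self)
qed

lemma turn_squares: "turn (-1) k ` square (swap k (k + 1) l) = square l"
proof -
  have near: "turn \<epsilon> k w = Complex (2 * of_int k + 1 - Re w) (- Im w)"
    if "w \<in> square k \<union> square (k + 1)" "\<epsilon> = 1 \<or> \<epsilon> = -1" for w \<epsilon>
  proof (rule turn_near[OF _ that(2)])
    have "\<bar>Re w - (of_int k + 1/2)\<bar> \<le> 8/10" "\<bar>Im w\<bar> \<le> 3/10"
      using that(1) unfolding square_def Un_iff mem_Collect_eq of_int_add of_int_1 by linarith+
    then have "(Re w - (of_int k + 1/2))\<^sup>2 \<le> (8/10)\<^sup>2" "(Im w)\<^sup>2 \<le> (3/10)\<^sup>2"
      using abs_le_square_iff[of "Re w - (of_int k + 1/2)" "8/10"] abs_le_square_iff[of "Im w" "3/10"] by auto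
    then show "(Re w - (of_int k + 1/2))\<^sup>2 + (Im w)\<^sup>2 \<le> 81/100" by (simp add: power2_eq_square)
  qed
  have into: "turn \<epsilon> k ` square (swap k (k + 1) l) \<subseteq> square l" if \<epsilon>: "\<epsilon> = 1 \<or> \<epsilon> = -1" for \<epsilon> l
  proof (rule image_subsetI)
    fix w assume w: "w \<in> square (swap k (k + 1) l)"
    consider "l = k" | "l = k + 1" | "l < k \<or> k + 1 < l" by linarith
    then show "turn \<epsilon> k w \<in> square l"
    proof cases
      case 1
      then have "w \<in> square (k + 1)" using w by simp
      then have "turn \<epsilon> k w = Complex (2 * of_int k + 1 - Re w) (- Im w)" by (intro near[OF _ \<epsilon>]) blast
      moreover have "\<bar>2 * of_int k + 1 - Re w - of_int k\<bar> = \<bar>Re w - of_int (k + 1)\<bar>" by simp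
      ultimately show ?thesis using \<open>w \<in> square (k + 1)\<close> unfolding 1 square_def by simp
    next
      case 2
      then have "w \<in> square k" using w by simp
      then have "turn \<epsilon> k w = Complex (2 * of_int k + 1 - Re w) (- Im w)" by (intro near[OF _ \<epsilon>]) blast
      moreover have "\<bar>2 * of_int k + 1 - Re w - of_int (k + 1)\<bar> = \<bar>Re w - of_int k\<bar>" by simp
      ultimately show ?thesis using \<open>w \<in> square k\<close> unfolding 2 square_def by simp
    next
      case 3
      then have wl: "w \<in> square l" using w by (auto simp: Transposition.transpose_def)
      have "of_int l \<le> (of_int (k - 1) :: real) \<or> of_int (k + 2) \<le> (of_int l :: real)"
        using 3 unfolding of_int_le_iff by linarith
      then have "1 \<le> \<bar>Re w - (of_int k + 1/2)\<bar>"
        using wl unfolding square_def by (intro far_from_turn[where a = "of_int l"]) auto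
      then show ?thesis using wl turn_far by auto
    qed
  qed
  show ?thesis
  proof
    show "turn (-1) k ` square (swap k (k + 1) l) \<subseteq> square l" by (rule into) simp
    have "turn 1 k ` square l \<subseteq> square (swap k (k + 1) l)"
      using into[of 1 "swap k (k + 1) l"] by simp
    then show "square l \<subseteq> turn (-1) k ` square (swap k (k + 1) l)"
      using turn_inverse(2)[of k] by (metis image_subset_iff rev_image_eqI subsetI)
  qed
qed

lemma turn_sides: "turn (-1) k ` (side 1 \<union> side (-1)) \<subseteq> side 1 \<union> side (-1)"
proof -
  have "w \<notin> side 1 \<union> side (-1)" if v: "turn (-1) k w \<notin> side 1 \<union> side (-1)" for w
  proof -
    define z where "z = turn (-1) k w"
    have w: "w = turn 1 k z" by (simp add: z_def turn_inverse)
    obtain l :: int where l: "\<bar>Im z\<bar> \<le> 1/4" "\<bar>Re z - of_int l\<bar> \<le> 1/4" using v unfolding z_def not_side_iff by blast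
    show ?thesis
    proof (cases "l = k \<or> l = k + 1")
      case True
      have "\<bar>Re z - (of_int k + 1/2)\<bar> \<le> 3/4"
        using True l(2) by (elim disjE) (simp only: of_int_add of_int_1, linarith)+
      then have "(Re z - (of_int k + 1/2))\<^sup>2 \<le> (3/4)\<^sup>2" "(Im z)\<^sup>2 \<le> (1/4)\<^sup>2"
        using abs_le_square_iff[of "Re z - (of_int k + 1/2)" "3/4"] abs_le_square_iff[of "Im z" "1/4"] l(1) by auto
      then have "w = Complex (2 * of_int k + 1 - Re z) (- Im z)"
        unfolding w by (intro turn_near) (auto simp: power2_eq_square)
      moreover have "\<bar>2 * of_int k + 1 - Re z - of_int (2 * k + 1 - l)\<bar> \<le> 1/4" using l(2) by (simp add: abs_minus_commute)
      ultimately have "\<bar>Im w\<bar> \<le> 1/4" "\<bar>Re w - of_int (2 * k + 1 - l)\<bar> \<le> 1/4" using l(1) by simp_all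
      then show ?thesis unfolding not_side_iff by blast
    next
      case False
      then have "l \<le> k - 1 \<or> k + 2 \<le> l" by linarith
      then have "of_int l \<le> (of_int (k - 1) :: real) \<or> of_int (k + 2) \<le> (of_int l :: real)"
        unfolding of_int_le_iff .
      then have "1 \<le> \<bar>Re z - (of_int k + 1/2)\<bar>"
        using l(2) by (intro far_from_turn[where a = "of_int l"]) auto
      then have "w = z" unfolding w by (intro turn_far) simp
      then show ?thesis using v z_def by simp
    qed
  qed
  then show ?thesis by blast
qed

text \<open>The new sheets are traced along the middle line of the gap \<open>k\<close> towards its centre, from both
sides. Under \<open>turn (-1)\<close> the line from below winds around the left of the disc, through gap
\<open>k - 1\<close>, and arrives at the centre from above: the new lower sheet \<open>x\<close> is the old
upper sheet \<open>\<pi> (k - 1) x\<close> there. The line from above winds around the right through gap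
\<open>k + 1\<close>, and the new upper sheet \<open>y\<close> is the old lower sheet \<open>inv (\<pi> (k +
1)) y\<close>. Comparing both over the centre gives the new permutation. If the square \<open>k + 1\<close>
is a lake, the new mark above it is the old mark below it, and half a walk around the rim leads back to the
old mark above it.\<close>

lemma frame_twist:
  assumes f: "frame \<phi> s t \<pi>"
  shows "\<exists>\<phi>' s' t'. frame \<phi>' s' t' (twist k \<pi>) \<and>
    (\<forall>l. \<phi>' ` square (swap k (k + 1) l) = \<phi> ` square l) \<and>
    (\<forall>i y. i \<noteq> k \<longrightarrow> connected_component (preim (\<phi> ` square i)) (t y (mark 1 i)) (t' y (mark 1 (swap k (k + 1) i))))"
proof -
  let ?\<rho> = "turn (-1) k"
  let ?a = "of_int k + 1/2 :: real"
  have lines: "?\<rho> w = w" if "l \<noteq> k" "Re w = of_int l + 1/2" for w l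
  proof (rule turn_far)
    have "l \<le> k - 1 \<or> k + 1 \<le> l" using that(1) by linarith
    then have "of_int l \<le> (of_int (k - 1) :: real) \<or> of_int (k + 1) \<le> (of_int l :: real)" unfolding of_int_le_iff .
    then show "1 \<le> \<bar>Re w - ?a\<bar> \<or> 1 \<le> \<bar>Im w\<bar>" using that(2) by auto
  qed
  obtain s' t' where st: "\<exists>h. homeomorphism UNIV UNIV (\<phi> \<circ> ?\<rho>) h"
    "sheets (-1) (\<phi> \<circ> ?\<rho>) s'" "sheets 1 (\<phi> \<circ> ?\<rho>) t'"
    "\<And>x a b w. b \<le> 1 \<Longrightarrow> stem (-1) a b \<subseteq> side (-1) \<Longrightarrow> ?\<rho> ` stem (-1) a b \<subseteq> side (-1) \<Longrightarrow> w \<in> stem (-1) a b \<Longrightarrow> s' x w = s x (?\<rho> w)"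
    "\<And>y a b w. b \<le> 1 \<Longrightarrow> stem 1 a b \<subseteq> side 1 \<Longrightarrow> ?\<rho> ` stem 1 a b \<subseteq> side 1 \<Longrightarrow> w \<in> stem 1 a b \<Longrightarrow> t' y w = t y (?\<rho> w)"
    "\<And>l x w. l \<noteq> k \<Longrightarrow> w \<in> gap l \<Longrightarrow> s' x w = t' (\<pi> l x) w"
    by (rule move_sheets[OF f turn_homeo[of k] turn_sides _ lines]) (use turn_far in blast)+
  have F: "sheets (-1) \<phi> s" "sheets 1 \<phi> t" "\<And>k x w. w \<in> gap k \<Longrightarrow> s x w = t (\<pi> k x) w" "\<And>k. bij (\<pi> k)"
    using f by (auto simp: frame_def)
  have c\<rho>: "continuous_on UNIV ?\<rho>" using turn_homeo by (rule homeomorphism_cont1)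
  define seg where "seg \<sigma> = {w. Re w = ?a \<and> 0 \<le> \<sigma> * Im w \<and> \<sigma> * Im w \<le> 19/20}" for \<sigma>
  have con: "connected (seg \<sigma>)" for \<sigma>
  proof -
    have "seg \<sigma> = {z. 1 \<bullet> z = ?a} \<inter> {z. (\<sigma> * \<i>) \<bullet> z \<ge> 0} \<inter> {z. (\<sigma> * \<i>) \<bullet> z \<le> 19/20}"
      by (auto simp: inner_complex_def seg_def)
    then show ?thesis by (metis convex_connected convex_halfspace_ge convex_halfspace_le convex_hyperplane convex_Int)
  qed
  have segs: "seg \<sigma> \<subseteq> side \<tau>" for \<sigma> \<tau>
  proof -
    have "seg \<sigma> \<subseteq> gap k" by (auto simp: seg_def gap_def)
    then show ?thesis using gap_side by blast
  qed
  \<comment> \<open>Both halves of the argument: follow a new sheet down the stem to radius \<open>19/20\<close>, where it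
  passes from one old side to the other, and on to the centre.\<close>
  have core: "S' x w = T y (?\<rho> w)"
    if \<sigma>: "\<sigma> = 1 \<or> \<sigma> = -1" and S: "sheets \<sigma> (\<phi> \<circ> ?\<rho>) S'" "sheets (- \<sigma>) \<phi> T"
      and tr: "\<And>w. w \<in> stem \<sigma> ?a (19/20) \<Longrightarrow> S' x w = S x (?\<rho> w)"
      and q: "S x (Complex (?a + \<sigma> * (19/20)) 0) = T y (Complex (?a + \<sigma> * (19/20)) 0)" and w: "w \<in> seg \<sigma>"
    for \<sigma> S' S T x y w
  proof -
    let ?c = "Complex ?a (\<sigma> * (19/20))"
    have an: "angle (19/20) = pi / 2" by (simp add: angle_def)
    have "?\<rho> ?c = Complex (?a + \<sigma> * (19/20)) 0"
      using turn_vertical[OF _ \<sigma>, of "19/20" k] by (simp add: an)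
    then have "S' x ?c = T y (?\<rho> ?c)" using tr[of ?c] q \<sigma> by (auto simp: stem_def)
    moreover have "?\<rho> ` seg \<sigma> \<subseteq> side (- \<sigma>)" unfolding seg_def by (rule turn_spoke_side(2)[OF \<sigma>])
    moreover have "?c \<in> seg \<sigma>" using \<sigma> by (auto simp: seg_def)
    ultimately show ?thesis using sheet_trace[OF S c\<rho> con segs _ _ w] by blast
  qed
  have stem_s: "stem \<sigma> ?a (19/20) \<subseteq> side \<sigma>" for \<sigma> by (rule stem_subset_side)
  have low: "s' x w = t (\<pi> (k - 1) x) (?\<rho> w)" if "w \<in> seg (-1)" for x w
  proof (rule core[where \<sigma> = "-1" and S' = s' and S = s and T = t, OF _ st(2) _ _ _ that])
    show "s x (Complex (?a + - 1 * (19/20)) 0) = t (\<pi> (k - 1) x) (Complex (?a + - 1 * (19/20)) 0)"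
      by (rule F(3)) (simp add: gap_def)
    show "s' x w = s x (?\<rho> w)" if "w \<in> stem (-1) ?a (19/20)" for w
      by (rule st(4)[OF _ stem_s turn_spoke_side(1) that]) auto
  qed (use F in auto)
  have up: "t' y w = s (inv (\<pi> (k + 1)) y) (?\<rho> w)" if "w \<in> seg 1" for y w
  proof (rule core[where \<sigma> = 1 and S' = t' and S = t and T = s, OF _ st(3) _ _ _ that])
    have "s (inv (\<pi> (k + 1)) y) (Complex (?a + 1 * (19/20)) 0) = t (\<pi> (k + 1) (inv (\<pi> (k + 1)) y)) (Complex (?a + 1 * (19/20)) 0)"
      by (rule F(3)) (simp add: gap_def)
    then show "t y (Complex (?a + 1 * (19/20)) 0) = s (inv (\<pi> (k + 1)) y) (Complex (?a + 1 * (19/20)) 0)"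
      by (simp add: bij_cancel[OF F(4)])
    show "t' y w = t y (?\<rho> w)" if "w \<in> stem 1 ?a (19/20)" for w
      by (rule st(5)[OF _ stem_s turn_spoke_side(1) that]) auto
  qed (use F in auto)
  define m where "m = Complex ?a 0"
  have m: "?\<rho> m = m" "m \<in> gap k" "m \<in> seg \<sigma>" for \<sigma> by (auto simp: m_def gap_def seg_def turn_def spin_def)
  have "s' x m = t' (\<pi> (k + 1) (inv (\<pi> k) (\<pi> (k - 1) x))) m" for x
    using low[OF m(3), of x] up[OF m(3), of "\<pi> (k + 1) (inv (\<pi> k) (\<pi> (k - 1) x))"] F(3)[OF m(2)]
    by (simp add: m(1) bij_cancel[OF F(4)])
  then have gk: "s' x w = t' (\<pi> (k + 1) (inv (\<pi> k) (\<pi> (k - 1) x))) w" if "w \<in> gap k" for x w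
    using gap_agree[OF st(2,3) m(2) that] by blast
  have fr: "frame (\<phi> \<circ> ?\<rho>) s' t' (twist k \<pi>)"
    unfolding frame_def
  proof (intro conjI allI ballI st(1-3) bij_twist F(4))
    fix l x w assume "w \<in> gap l"
    then show "s' x w = t' (twist k \<pi> l x) w"
      using gk st(6) by (cases "l = k") (auto simp: twist_def)
  qed
  have sqs: "(\<phi> \<circ> ?\<rho>) ` square (swap k (k + 1) l) = \<phi> ` square l" for l
    unfolding image_comp[symmetric] turn_squares ..
  have "connected_component (preim (\<phi> ` square i)) (t y (mark 1 i)) (t' y (mark 1 (swap k (k + 1) i)))" if "i \<noteq> k" for i y
  proof (cases "i = k + 1")
    case True
    define T where "T = cball m (9/10) \<inter> {z. \<i> \<bullet> z \<ge> 7/25}"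
    define c where "c = Complex ?a (9/10)"
    have T: "z \<in> T \<longleftrightarrow> (Re z - ?a)\<^sup>2 + (Im z)\<^sup>2 \<le> 81/100 \<and> 7/25 \<le> Im z" for z
      using cmod_le_iff[of "9/10" "z - m"]
      by (auto simp: T_def m_def dist_norm norm_minus_commute inner_complex_def power2_eq_square)
    have "connected T" unfolding T_def by (intro convex_connected convex_Int convex_cball convex_halfspace_ge)
    moreover have "T \<subseteq> side 1" using T by (auto simp: side_def)
    moreover have im: "?\<rho> z = Complex (2 * of_int k + 1 - Re z) (- Im z)" if "z \<in> T" for z
      using that unfolding T by (intro turn_near) auto
    then have "?\<rho> ` T \<subseteq> side (-1)" using T by (auto simp: side_def)
    moreover have cm: "c \<in> T" "mark 1 k \<in> T" unfolding T by (auto simp: c_def mark_def power2_eq_square)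
    moreover have "t' y c = s (inv (\<pi> (k + 1)) y) (?\<rho> c)" by (rule up) (simp add: c_def seg_def)
    ultimately have "t' y (mark 1 k) = s (inv (\<pi> (k + 1)) y) (?\<rho> (mark 1 k))"
      using sheet_trace[OF st(3) F(1) c\<rho>] by blast
    moreover have "?\<rho> (mark 1 k) = mark (-1) (k + 1)" using im[OF cm(2)] by (simp add: mark_def)
    ultimately have "t' y (mark 1 k) = s (inv (\<pi> (k + 1)) y) (mark (-1) i)" using True by simp
    moreover have "connected_component (preim (\<phi> ` square i)) (s (inv (\<pi> (k + 1)) y) (mark (-1) i)) (t y (mark 1 i))"
      using half_ring[OF f, of i i "inv (\<pi> (k + 1)) y"] True by (simp add: bij_cancel[OF F(4)])
    ultimately show ?thesis using True by (simp add: connected_component_sym)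
  next
    case False
    then have "i \<le> k - 1 \<or> k + 2 \<le> i" using that by linarith
    then have "of_int i \<le> (of_int (k - 1) :: real) \<or> of_int (k + 2) \<le> (of_int i :: real)" unfolding of_int_le_iff .
    then have far: "1 \<le> \<bar>of_int i - ?a\<bar>" by auto
    have id: "?\<rho> w = w" if "w \<in> stem 1 (of_int i) (7/25)" for w
      using that far by (intro turn_far) (auto simp: stem_def)
    have sub: "stem 1 (of_int i) (7/25) \<subseteq> side 1" by (auto simp: stem_def side_def)
    have m: "mark 1 i \<in> stem 1 (of_int i) (7/25)" by (simp add: mark_def stem_def)
    have "t' y (mark 1 i) = t y (mark 1 i)"
      using st(5)[OF _ sub _ m, of y] id m sub by (simp add: image_subset_iff subset_iff)
    moreover have "t y (mark 1 i) \<in> preim (\<phi> ` square i)"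
    proof -
      have "mark 1 i \<in> side 1" using m sub by blast
      then show ?thesis using F(2) by (auto simp: sheets_def preim_def regular_pts_def mark_def square_def)
    qed
    moreover have "swap k (k + 1) i = i" using that False by (simp add: Transposition.transpose_def)
    ultimately show ?thesis by simp
  qed
  then show ?thesis using fr sqs by blast
qed

section \<open>The initial frame\<close>

definition pole_line :: "int \<Rightarrow> real" where "pole_line k = (of_int k + 1/2) * pi"

text \<open>The plane is cut into strips by the vertical lines through the poles; sheets are going to be labelled by
strips.\<close>

definition strip :: "int \<Rightarrow> complex set" where "strip l = {z. pole_line (l - 1) < Re z \<and> Re z < pole_line l}"

text \<open>The plane without the parts of the vertical lines through the poles at distance at least \<open>1\<close>
from the axis. The function \<open>tanid\<close> maps the lines into these slits, so a lift over a connected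
subset of the slit plane stays in one strip.\<close>

definition slit_plane :: "complex set" where "slit_plane = {w. \<forall>k. Re w = pole_line k \<longrightarrow> \<bar>Im w\<bar> < 1}"

lemma pole_line_less: "pole_line k < pole_line l \<longleftrightarrow> k < l" "pole_line k \<le> pole_line l \<longleftrightarrow> k \<le> l" "pole_line k = pole_line l \<longleftrightarrow> k = l"
  by (auto simp: pole_line_def)

lemma pole_line_Suc: "pole_line (k - 1) = pole_line k - pi" "pole_line (k + 1) = pole_line k + pi"
  by (auto simp: pole_line_def algebra_simps)

lemma strip_unique: "z \<in> strip l \<Longrightarrow> z \<in> strip l' \<Longrightarrow> l = l'"
proof -
  assume "z \<in> strip l" "z \<in> strip l'"
  then have "pole_line (l - 1) < pole_line l'" "pole_line (l' - 1) < pole_line l" by (auto simp: strip_def)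
  then show ?thesis unfolding pole_line_less by linarith
qed

lemma strip_exists:
  assumes "\<And>k. Re z \<noteq> pole_line k" obtains l where "z \<in> strip l"
proof
  define l where "l = \<lfloor>Re z / pi + 1/2\<rfloor>"
  have "of_int l \<le> Re z / pi + 1/2" "Re z / pi + 1/2 < of_int l + 1" unfolding l_def by linarith+
  then have "pole_line (l - 1) \<le> Re z" "Re z < pole_line l" by (auto simp: pole_line_def field_simps)
  then show "z \<in> strip l" using assms[of "l - 1"] by (simp add: strip_def)
qed

lemma strip_cos_nz: "z \<in> strip l \<Longrightarrow> cos z \<noteq> 0"
proof
  assume z: "z \<in> strip l" and "cos z = 0"
  then obtain k where "z = pole k" by (auto simp: cos_0_iff_pole)
  then have "Re z = pole_line k" by (simp add: pole_def pole_line_def)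
  then have "pole_line (l - 1) < pole_line k" "pole_line k < pole_line l" using z by (auto simp: strip_def)
  then show False unfolding pole_line_less by linarith
qed

lemma sin_cos_Complex:
  "cos (Complex x y) = Complex (cos x * cosh y) (- (sin x * sinh y))"
  "sin (Complex x y) = Complex (sin x * cosh y) (cos x * sinh y)"
  by (simp_all add: complex_eq_iff Re_cos Im_cos Re_sin Im_sin sinh_field_def cosh_field_def exp_minus
      algebra_simps diff_divide_distrib)

lemma abs_coth_ge: "y \<noteq> 0 \<Longrightarrow> 1 \<le> \<bar>cosh y / sinh (y::real)\<bar> \<and> 0 < y * (cosh y / sinh y)"
proof -
  assume y: "y \<noteq> 0"
  have s: "sinh y \<noteq> 0" "0 < y * sinh y" using y by (auto simp: zero_less_mult_iff)
  have "(sinh y)\<^sup>2 \<le> (cosh y)\<^sup>2" using cosh_square_eq[of y] by simp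
  then have "\<bar>sinh y\<bar> \<le> \<bar>cosh y\<bar>" by (simp only: abs_le_square_iff)
  moreover have "0 < y * (cosh y / sinh y)"
  proof -
    have "y * (cosh y / sinh y) = (y * sinh y) * cosh y / (sinh y)\<^sup>2" using s by (simp add: power2_eq_square field_simps)
    then show ?thesis using s by (simp add: cosh_real_pos)
  qed
  ultimately show ?thesis using s by (simp add: field_simps)
qed

text \<open>On the vertical line through a pole \<open>tan z\<close> becomes \<open>i coth (Im z)\<close>, which has the
same sign as \<open>Im z\<close> and modulus at least \<open>1\<close>.\<close>

lemma tanid_on_line:
  assumes "cos z \<noteq> 0" "Re z = pole_line k"
  shows "tanid z = Complex (pole_line k) (Im z + cosh (Im z) / sinh (Im z))" "1 \<le> \<bar>Im (tanid z)\<bar>"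
    "Im z \<noteq> 0"
proof -
  obtain x y where z: "z = Complex x y" by (cases z)
  have x: "x = pole_line k" using assms(2) z by simp
  have "cos (of_real x :: complex) = 0" using cos_0_iff_pole[of "pole k"] by (simp add: pole_def x pole_line_def)
  then have cx: "cos x = 0" by (simp add: cos_of_real)
  have sx: "(sin x)\<^sup>2 = 1" using cx sin_cos_squared_add[of x] by simp
  have sxy: "sin x * sinh y \<noteq> 0" using assms(1) cx by (simp add: z sin_cos_Complex complex_eq_iff)
  then show y: "Im z \<noteq> 0" by (auto simp: z)
  have "tan z = Complex 0 (cosh y / sinh y)"
    using cx sxy sx by (simp add: z tan_def sin_cos_Complex complex_eq_iff Re_divide Im_divide field_simps power2_eq_square)
  then show 1: "tanid z = Complex (pole_line k) (Im z + cosh (Im z) / sinh (Im z))"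
    by (simp add: tanid_def z x complex_eq_iff)
  have "1 \<le> \<bar>cosh y / sinh y\<bar>" "0 < y * (cosh y / sinh y)" using abs_coth_ge[of y] y by (auto simp: z)
  then have "1 \<le> \<bar>y + cosh y / sinh y\<bar>"
    unfolding zero_less_mult_iff by (elim conjE disjE) linarith+
  then show "1 \<le> \<bar>Im (tanid z)\<bar>" unfolding 1 by (simp add: z)
qed

lemma off_lines_over_slit_plane: "cos z \<noteq> 0 \<Longrightarrow> tanid z \<in> slit_plane \<Longrightarrow> Re z \<noteq> pole_line k"
  using tanid_on_line(1,2)[of z k] by (auto simp: slit_plane_def)

lemma real_in_slit_plane: "Im w = 0 \<Longrightarrow> w \<in> slit_plane" by (simp add: slit_plane_def)

lemma Im_tan: "cos z \<noteq> 0 \<Longrightarrow> Im (tan z) = sinh (Im z) * cosh (Im z) / (cmod (cos z))\<^sup>2"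
proof -
  obtain x y where z: "z = Complex x y" by (cases z)
  have "Im (tan z) = (cos x * sinh y * (cos x * cosh y) + sin x * cosh y * (sin x * sinh y)) / (cmod (cos z))\<^sup>2"
    unfolding tan_def Im_divide cmod_power2 by (simp add: z sin_cos_Complex)
  also have "cos x * sinh y * (cos x * cosh y) + sin x * cosh y * (sin x * sinh y) =
     ((cos x)\<^sup>2 + (sin x)\<^sup>2) * (sinh y * cosh y)" unfolding power2_eq_square distrib_right by (simp only: mult_ac)
  also have "(cos x)\<^sup>2 + (sin x)\<^sup>2 = 1" by simp
  finally show ?thesis unfolding z complex.sel mult_1 .
qed

text \<open>The imaginary parts of \<open>tan z\<close> and \<open>z\<close> have the same sign, so they cannot cancel.\<close>

lemma real_fibre:
  assumes "cos z \<noteq> 0" "Im (tanid z) = 0" shows "Im z = 0"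
proof (rule ccontr)
  assume y: "Im z \<noteq> 0"
  have "0 < Im z * sinh (Im z)" using y by (auto simp: zero_less_mult_iff)
  then have "0 < Im z * Im (tan z)"
    using assms(1) by (simp add: Im_tan cosh_real_pos mult_pos_pos flip: mult.assoc)
  moreover have "Im (tan z) = - Im z" using assms(2) by (simp add: tanid_def)
  ultimately have "0 < - (Im z * Im z)" by simp
  then show False using zero_le_square[of "Im z"] by linarith
qed

lemma tan_real_strict_mono:
  assumes "x < y" "\<And>t. x \<le> t \<Longrightarrow> t \<le> y \<Longrightarrow> cos t \<noteq> 0" shows "tan x + x < tan y + (y::real)"
proof (rule DERIV_pos_imp_increasing[OF assms(1)])
  fix t assume "x \<le> t" "t \<le> y"
  then have c: "cos t \<noteq> 0" using assms(2) by blast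
  then have "((\<lambda>t. tan t + t) has_real_derivative (inverse ((cos t)\<^sup>2) + 1)) (at t)"
    by (auto intro!: derivative_eq_intros)
  moreover have "inverse ((cos t)\<^sup>2) + 1 > 0" by (simp add: add_nonneg_pos)
  ultimately show "\<exists>d. ((\<lambda>t. tan t + t) has_real_derivative d) (at t) \<and> 0 < d" by blast
qed

text \<open>Over a real value the points of the fibre are real, and \<open>tan x + x\<close> is strictly increasing
between consecutive poles.\<close>

lemma real_fibre_unique:
  assumes "z \<in> strip l" "z' \<in> strip l" "tanid z = tanid z'" "Im (tanid z) = 0"
  shows "z = z'"
proof -
  have c: "cos z \<noteq> 0" "cos z' \<noteq> 0" using assms strip_cos_nz by blast+
  have i: "Im z = 0" "Im z' = 0" using real_fibre c assms by auto
  obtain x x' where x: "z = of_real x" "z' = of_real x'" using i by (metis complex_is_Real_iff Reals_cases)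
  have eq: "tan x + x = tan x' + x'"
  proof -
    have "of_real (tan x + x) = (of_real (tan x' + x') :: complex)"
      using assms(3) by (simp add: tanid_def x flip: tan_of_real)
    then show ?thesis by (simp only: of_real_eq_iff)
  qed
  have nz: "cos t \<noteq> 0" if "pole_line (l - 1) < t" "t < pole_line l" for t
  proof -
    have "of_real t \<in> strip l" using that by (simp add: strip_def)
    then have "cos (of_real t :: complex) \<noteq> 0" by (rule strip_cos_nz)
    then show ?thesis by (simp add: cos_of_real)
  qed
  have r: "pole_line (l - 1) < x" "x < pole_line l" "pole_line (l - 1) < x'" "x' < pole_line l" using assms x by (auto simp: strip_def)
  have "\<not> x < x'"
  proof
    assume "x < x'"
    then have "tan x + x < tan x' + x'" using r by (intro tan_real_strict_mono nz) auto
    then show False using eq by simp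
  qed
  moreover have "\<not> x' < x"
  proof
    assume "x' < x"
    then have "tan x' + x' < tan x + x" using r by (intro tan_real_strict_mono nz) auto
    then show False using eq by simp
  qed
  ultimately show ?thesis using x by auto
qed

lemma real_fibre_exists: "\<exists>z \<in> strip l. tanid z = of_real r"
proof -
  define g where "g t = t + arctan t + of_int l * pi" for t
  define B where "B = \<bar>r\<bar> + \<bar>of_int l * pi\<bar> + pi"
  have at: "\<bar>arctan t\<bar> < pi / 2" for t using arctan_lbound[of t] arctan_ubound[of t] by linarith
  have "B = \<bar>r\<bar> + \<bar>of_int l * pi\<bar> + pi" by (simp add: B_def)
  then have gB: "g (- B) \<le> r" "r \<le> g B"
    using arctan_ubound[of "- B"] arctan_lbound[of B] pi_gt_zero unfolding g_def by linarith+
  have "\<exists>t\<ge>- B. t \<le> B \<and> g t = r"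
  proof (rule IVT'[where f = g, OF gB])
    show "- B \<le> B" by (simp add: B_def)
    show "continuous_on {- B..B} g" unfolding g_def by (intro continuous_intros)
  qed
  then obtain t where t: "g t = r" by blast
  define x where "x = arctan t"
  have ct: "cos x \<noteq> 0" by (simp add: x_def)
  let ?z = "of_real x + of_int l * of_real pi :: complex"
  have "tanid ?z = tanid (of_real x) + of_int l * of_real pi" by (rule tanid_shift)
  also have "\<dots> = of_real (tan x + x + of_int l * pi)" by (simp add: tanid_def flip: tan_of_real)
  also have "tan x + x + of_int l * pi = r" using t by (simp add: x_def g_def tan_arctan)
  finally have "tanid ?z = of_real r" .
  moreover have "?z \<in> strip l"
    using at[of t] by (auto simp: strip_def pole_line_def x_def abs_less_iff algebra_simps)
  ultimately show ?thesis by blast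
qed

lemma connected_between_lines:
  assumes "connected T" "continuous_on T g" "a \<in> T" "b \<in> T"
    and "\<And>w. w \<in> T \<Longrightarrow> Re (g w) \<noteq> A \<and> Re (g w) \<noteq> B" "A < Re (g a)" "Re (g a) < B"
  shows "A < Re (g b) \<and> Re (g b) < B"
proof -
  let ?R = "(\<lambda>w. Re (g w)) ` T"
  have c: "connected ?R" by (intro connected_continuous_image assms(1) continuous_intros assms(2))
  have no: "A \<notin> ?R" "B \<notin> ?R" using assms(5) by auto
  have m: "Re (g a) \<in> ?R" "Re (g b) \<in> ?R" using assms(3,4) by auto
  have "A < Re (g b)"
  proof (rule ccontr)
    assume "\<not> A < Re (g b)"
    then have "A \<in> ?R" using connectedD_interval[OF c m(2,1), of A] assms(6) by linarith
    then show False using no by blast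
  qed
  moreover have "Re (g b) < B"
  proof (rule ccontr)
    assume "\<not> Re (g b) < B"
    then have "B \<in> ?R" using connectedD_interval[OF c m, of B] assms(7) by linarith
    then show False using no by blast
  qed
  ultimately show ?thesis ..
qed

lemma Re_tan: "cos z \<noteq> 0 \<Longrightarrow> Re (tan z) = sin (Re z) * cos (Re z) / (cmod (cos z))\<^sup>2"
proof -
  obtain x y where z: "z = Complex x y" by (cases z)
  have "Re (tan z) = (sin x * cosh y * (cos x * cosh y) - cos x * sinh y * (sin x * sinh y)) / (cmod (cos z))\<^sup>2"
    unfolding tan_def Re_divide cmod_power2 by (simp add: z sin_cos_Complex)
  also have "sin x * cosh y * (cos x * cosh y) - cos x * sinh y * (sin x * sinh y) =
     sin x * cos x * ((cosh y)\<^sup>2 - (sinh y)\<^sup>2)" by (simp add: power2_eq_square algebra_simps)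
  finally show ?thesis by (simp add: z cosh_square_eq)
qed

lemma cmod_cos_ge: "2 \<le> \<bar>Im z\<bar> \<Longrightarrow> 1 \<le> (cmod (cos z))\<^sup>2"
proof -
  assume y: "2 \<le> \<bar>Im z\<bar>"
  have e: "exp t \<ge> 4" if "t \<ge> 2" for t :: real
  proof -
    have "2 \<le> exp (1::real)" using exp_ge_add_one_self[of 1] by simp
    then have "2 * 2 \<le> exp 1 * exp (1::real)" by (intro mult_mono) auto
    also have "\<dots> = exp 2" by (simp flip: exp_add)
    also have "\<dots> \<le> exp t" using that by simp
    finally show ?thesis by simp
  qed
  define t where "t = exp \<bar>Im z\<bar>"
  have t: "4 \<le> t" using e[OF y] by (simp add: t_def)
  then have "inverse t \<le> inverse 4" by (intro le_imp_inverse_le) auto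
  then have "2 \<le> t - inverse t" using t by simp
  then have "2\<^sup>2 \<le> (t - inverse t)\<^sup>2" by (intro power_mono) auto
  moreover have "(exp (Im z) - inverse (exp (Im z)))\<^sup>2 = (t - inverse t)\<^sup>2"
    by (cases "0 \<le> Im z") (simp_all add: t_def exp_minus power2_commute)
  ultimately have "(cmod (cos z))\<^sup>2 = (cos (Re z))\<^sup>2 + (t - inverse t)\<^sup>2 / 4" "1 \<le> (t - inverse t)\<^sup>2 / 4"
    using norm_cos_squared[of z] by simp_all
  then show ?thesis using zero_le_power2[of "cos (Re z)"] by linarith
qed

lemma sin_cos_le: "0 \<le> x \<Longrightarrow> x \<le> pi / 2 \<Longrightarrow> 0 \<le> sin x * cos x \<and> sin x * cos x \<le> (x::real)"
proof -
  assume x: "0 \<le> x" "x \<le> pi / 2"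
  have s: "0 \<le> sin x" "0 \<le> cos x" "cos x \<le> 1" "sin x \<le> x"
    using x by (auto intro: sin_ge_zero cos_ge_zero sin_x_le_x)
  have "sin x * cos x \<le> sin x * 1" using s by (intro mult_left_mono) auto
  then show ?thesis using s by simp
qed

text \<open>With \<open>\<xi> = Re z - pole_line m\<close> one has \<open>Re (tanid z) - pole_line m = \<xi> - sin \<xi>
cos \<xi> / \<bar>cos z\<bar> ^ 2\<close>. At some distance from the axis the denominator is at least
\<open>1\<close>, and then \<open>\<xi>\<close> dominates: \<open>tanid\<close> preserves the two sides of
the line.\<close>

lemma sign_near_line:
  assumes "cos z \<noteq> 0" "2 \<le> \<bar>Im z\<bar>" "\<bar>Re z - pole_line m\<bar> \<le> pi / 2"
  shows "Re (tanid z) < pole_line m \<Longrightarrow> Re z < pole_line m" "pole_line m < Re (tanid z) \<Longrightarrow> pole_line m < Re z"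
proof -
  define x where "x = Re z - pole_line m"
  define D where "D = (cmod (cos z))\<^sup>2"
  have D: "1 \<le> D" using cmod_cos_ge[OF assms(2)] by (simp add: D_def)
  have "cos (of_real (pole_line m) :: complex) = 0" using cos_0_iff_pole[of "pole m"] by (simp add: pole_def pole_line_def)
  then have c: "cos (pole_line m) = 0" by (simp add: cos_of_real)
  have s: "(sin (pole_line m))\<^sup>2 = 1" using c sin_cos_squared_add[of "pole_line m"] by simp
  have rz: "Re z = pole_line m + x" by (simp add: x_def)
  have "sin (Re z) * cos (Re z) = - ((sin (pole_line m))\<^sup>2 * (sin x * cos x))"
    unfolding rz sin_add cos_add c by (simp add: power2_eq_square)
  then have "Re (tan z) = - (sin x * cos x / D)" using Re_tan[OF assms(1)] s by (simp add: D_def)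
  then have f: "Re (tanid z) = pole_line m + (x - sin x * cos x / D)" by (simp add: tanid_def rz)
  have pos: "sin u * cos u / D \<le> u" if "0 \<le> u" "u \<le> pi / 2" for u
  proof -
    have "sin u * cos u / D \<le> sin u * cos u / 1"
      using D sin_cos_le[OF that] by (intro divide_left_mono) auto
    then show ?thesis using sin_cos_le[OF that] by simp
  qed
  have x: "\<bar>x\<bar> \<le> pi / 2" using assms(3) by (simp add: x_def)
  show "Re z < pole_line m" if "Re (tanid z) < pole_line m"
  proof (rule ccontr)
    assume "\<not> Re z < pole_line m"
    then have "0 \<le> x" by (simp add: x_def)
    then show False using pos[of x] x f that by simp
  qed
  show "pole_line m < Re z" if "pole_line m < Re (tanid z)"
  proof (rule ccontr)
    assume "\<not> pole_line m < Re z"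
    then have "0 \<le> - x" by (simp add: x_def)
    then show False using pos[of "- x"] x f that by simp
  qed
qed

definition clip :: "real \<Rightarrow> real" where "clip u = max (-1) (min 1 u)"

text \<open>The two critical values of a column have the same real part. The shear by \<open>\<plusminus> \<pi> /
6\<close> above and below the axis moves them apart: the upper one is at \<open>3 m + 2 + i/4\<close> and
the lower one at \<open>3 m + 1 - i/4\<close> in the frame. The shear is completed already at height
\<open>1/8\<close>, so that the slits beyond the critical values are vertical rays in the frame, too.\<close>

definition chart0 :: "complex \<Rightarrow> complex" where
  "chart0 z = Complex (pi / 3 * Re z - pi / 6 * clip (8 * Im z)) (4 * crit_height * Im z)"

lemma crit_height_bounds: "0 < crit_height" "crit_height < 4"
proof -
  have s: "sqrt 2 < 2" by (rule real_less_lsqrt) auto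
  have a: "arsinh (1::real) = ln (1 + sqrt 2)" by (simp add: arsinh_real_def)
  have "0 < ln (1 + sqrt 2)" by (rule ln_gt_zero) simp
  then show "0 < crit_height" by (simp add: crit_height_def a add_pos_nonneg)
  have "ln (1 + sqrt 2) \<le> sqrt 2" by (rule ln_add_one_self_le_self) simp
  then show "crit_height < 4" using s by (simp add: crit_height_def a)
qed

lemma chart0_homeo: "\<exists>h. homeomorphism UNIV UNIV chart0 h"
proof (intro exI homeomorphismI)
  let ?h = "\<lambda>z. Complex (3 / pi * (Re z + pi / 6 * clip (2 * Im z / crit_height))) (Im z / (4 * crit_height))"
  show "continuous_on UNIV chart0" "continuous_on UNIV ?h"
    unfolding chart0_def clip_def Complex_eq using crit_height_bounds(1) by (auto intro!: continuous_intros)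
  show "?h (chart0 z) = z" "chart0 (?h z) = z" for z
    using crit_height_bounds(1) by (auto simp: chart0_def complex_eq_iff field_simps)
qed auto

lemma chart0_line: "Re (chart0 w) = pole_line n \<longleftrightarrow> Re w = 3 * of_int n + 3/2 + clip (8 * Im w) / 2"
proof -
  have "Re (chart0 w) - pole_line n = pi / 3 * (Re w - (3 * of_int n + 3/2 + clip (8 * Im w) / 2))"
    by (simp add: chart0_def pole_line_def field_simps)
  then show ?thesis by (smt (verit, best) mult_eq_0_iff pi_gt_zero divide_eq_0_iff)
qed

lemma chart0_not_crit:
  assumes "w \<in> side 1 \<union> side (-1)" shows "chart0 w \<notin> crit_vals"
proof
  assume "chart0 w \<in> crit_vals"
  then obtain k s where s: "s = 1 \<or> s = -1" "chart0 w = Complex (pole_line k) (s * crit_height)"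
    using crit_vals_form by (metis pole_line_def)
  then have "4 * crit_height * Im w = s * crit_height" by (simp add: chart0_def)
  then have y: "Im w = s / 4" using crit_height_bounds(1) by simp
  have "Re (chart0 w) = pole_line k" using s by simp
  then have "Re w = 3 * of_int k + 3/2 + s / 2" using s(1) unfolding chart0_line y by (auto simp: clip_def)
  then have "Re w = of_int (3 * k + 2) \<or> Re w = of_int (3 * k + 1)" using s(1) by auto
  then have "\<exists>l::int. \<bar>Re w - of_int l\<bar> \<le> 1/4" by (metis abs_zero diff_self zero_le_divide_1_iff zero_le_numeral)
  moreover have "\<bar>Im w\<bar> \<le> 1/4" using s(1) by (auto simp: y)
  ultimately have "w \<notin> side 1 \<union> side (-1)" unfolding not_side_iff by blast
  then show False using assms by blast
qed

text \<open>In a gap, the line through a pole is only met at heights below \<open>1/16\<close> in the frame, because of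
the shear.\<close>

lemma gap_in_slit_plane:
  assumes w: "w \<in> gap k" shows "chart0 w \<in> slit_plane"
  unfolding slit_plane_def
proof (rule CollectI, intro allI impI)
  fix n assume "Re (chart0 w) = pole_line n"
  then have X: "Re w = 3 * of_int n + 3/2 + clip (8 * Im w) / 2" unfolding chart0_line .
  define u where "u = clip (8 * Im w)"
  have u: "- 1 \<le> u" "u \<le> 1" by (auto simp: u_def clip_def)
  have g: "of_int (k - 3 * n - 1) < u / 2 + 1/4" "u / 2 - 1/4 < of_int (k - 3 * n - 1)"
    using w X unfolding gap_def u_def by auto
  have "real_of_int (k - 3 * n - 1) < of_int 1" "real_of_int (-1) < of_int (k - 3 * n - 1)"
    using g u unfolding of_int_1 of_int_minus by linarith+
  then have "k - 3 * n - 1 = 0" unfolding of_int_less_iff by linarith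
  then have "\<bar>u\<bar> < 1/2" using g by auto
  then have "\<bar>8 * Im w\<bar> < 1/2" by (auto simp: u_def clip_def max_def min_def split: if_splits)
  then have "crit_height * (16 * \<bar>Im w\<bar>) < crit_height * 1" using crit_height_bounds(1) by (intro mult_strict_left_mono) auto
  moreover have "crit_height * (16 * \<bar>Im w\<bar>) = 4 * \<bar>Im (chart0 w)\<bar>"
    using crit_height_bounds by (simp add: chart0_def abs_mult)
  ultimately show "\<bar>Im (chart0 w)\<bar> < 1" using crit_height_bounds by linarith
qed

text \<open>The slit that the side \<open>\<sigma>\<close> has in column \<open>m\<close> is the vertical ray behind the
square \<open>3 m + tip \<sigma>\<close>.\<close>

definition tip :: "real \<Rightarrow> int" where "tip \<sigma> = (if \<sigma> = 1 then 2 else 1)"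

text \<open>The way from gap \<open>k\<close> to gap \<open>k + 1\<close> on side \<open>\<sigma>\<close>.\<close>

definition passage :: "real \<Rightarrow> int \<Rightarrow> complex set" where
  "passage \<sigma> k = {w. of_int k + 1/4 < Re w \<and> Re w < of_int k + 7/4 \<and> 1/4 < \<sigma> * Im w} \<union> gap k \<union> gap (k + 1)"

lemma passage_side: "passage \<sigma> k \<subseteq> side \<sigma>"
  using gap_side[of k \<sigma>] gap_side[of "k + 1" \<sigma>] by (auto simp: passage_def side_def)

lemma passage_line:
  assumes \<sigma>: "\<sigma> = 1 \<or> \<sigma> = -1" and w: "w \<in> passage \<sigma> k" "Re (chart0 w) = pole_line n" "1 \<le> \<bar>Im (chart0 w)\<bar>"
  shows "3 * n + tip \<sigma> = k + 1 \<and> Re w = of_int (k + 1)"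
proof -
  have "chart0 w \<notin> slit_plane" using w(2,3) unfolding slit_plane_def mem_Collect_eq by (metis not_le)
  then have w1: "of_int k + 1/4 < Re w" "Re w < of_int k + 7/4" "1/4 < \<sigma> * Im w"
    using w(1) gap_in_slit_plane unfolding passage_def by blast+
  have "clip (8 * Im w) = \<sigma>" using w1(3) \<sigma> by (auto simp: clip_def)
  then have X: "Re w = of_int (3 * n + tip \<sigma>)" using w(2) \<sigma> unfolding chart0_line by (auto simp: tip_def)
  then have "real_of_int k < of_int (3 * n + tip \<sigma>)" "real_of_int (3 * n + tip \<sigma>) < of_int (k + 2)"
    using w1 unfolding of_int_add[of k 2] of_int_numeral by linarith+
  then have "3 * n + tip \<sigma> = k + 1" unfolding of_int_less_iff by linarith
  then show ?thesis using X by simp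
qed

lemma connected_slab_gap:
  assumes "\<sigma> = 1 \<or> \<sigma> = -1" "a < b" "a < of_int k + 3/4" "of_int k + 1/4 < b"
  shows "connected ({w. a < Re w \<and> Re w < b \<and> 1/4 < \<sigma> * Im w} \<union> gap k)"
proof (rule connected_Un)
  have "{w. a < Re w \<and> Re w < b \<and> 1/4 < \<sigma> * Im w} = {z. 1 \<bullet> z > a} \<inter> {z. 1 \<bullet> z < b} \<inter> {z. (\<sigma> * \<i>) \<bullet> z > 1/4}"
    by (auto simp: inner_complex_def)
  then show "connected {w. a < Re w \<and> Re w < b \<and> 1/4 < \<sigma> * Im w}"
    by (simp only:) (intro convex_connected convex_Int convex_halfspace_gt convex_halfspace_lt)
  define A B x where "A = max a (of_int k + 1/4)" and "B = min b (of_int k + 3/4)" and "x = (A + B) / 2"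
  have "A < B" using assms(2-4) by (auto simp: A_def B_def)
  then have "A < x" "x < B" by (simp_all add: x_def)
  then have "a < x" "x < b" "of_int k + 1/4 < x" "x < of_int k + 3/4" by (auto simp: A_def B_def)
  then have "Complex x \<sigma> \<in> {w. a < Re w \<and> Re w < b \<and> 1/4 < \<sigma> * Im w} \<inter> gap k"
    using assms(1) by (auto simp: gap_def)
  then show "{w. a < Re w \<and> Re w < b \<and> 1/4 < \<sigma> * Im w} \<inter> gap k \<noteq> {}" by blast
qed (rule connected_gap)

lemma connected_passage:
  assumes \<sigma>: "\<sigma> = 1 \<or> \<sigma> = -1" shows "connected (passage \<sigma> k)"
proof -
  let ?A = "{w. of_int k + 1/4 < Re w \<and> Re w < of_int k + 7/4 \<and> 1/4 < \<sigma> * Im w}"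
  have "passage \<sigma> k = (?A \<union> gap k) \<union> (?A \<union> gap (k + 1))" by (auto simp: passage_def)
  moreover have "connected \<dots>"
  proof (rule connected_Un)
    show "connected (?A \<union> gap k)" "connected (?A \<union> gap (k + 1))" by (rule connected_slab_gap[OF \<sigma>]; simp)+
    have "Complex (of_int k + 1) \<sigma> \<in> ?A" using \<sigma> by auto
    then show "(?A \<union> gap k) \<inter> (?A \<union> gap (k + 1)) \<noteq> {}" by blast
  qed
  ultimately show ?thesis by simp
qed

definition gap_mid :: "int \<Rightarrow> complex" where "gap_mid k = Complex (of_int k + 1/2) 0"

lemma gap_mid: "gap_mid k \<in> gap k" "Im (chart0 (gap_mid k)) = 0" "chart0 (gap_mid k) \<in> slit_plane"
  "gap_mid k \<in> passage \<sigma> k" "gap_mid (k + 1) \<in> passage \<sigma> k"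
  by (auto simp: gap_mid_def gap_def chart0_def passage_def intro!: real_in_slit_plane)

lemma label_exists:
  assumes "sheets \<sigma> chart0 S" "w \<in> side \<sigma>" "chart0 w \<in> slit_plane"
  obtains l where "S x w \<in> strip l"
proof -
  have "cos (S x w) \<noteq> 0" "tanid (S x w) \<in> slit_plane" using assms by (auto simp: sheets_def regular_pts_def)
  then show ?thesis using strip_exists[of "S x w"] off_lines_over_slit_plane that by metis
qed

lemma label_const:
  assumes S: "sheets \<sigma> chart0 S" and T: "connected T" "T \<subseteq> side \<sigma>" "chart0 ` T \<subseteq> slit_plane" "a \<in> T" "b \<in> T" "S x a \<in> strip l"
  shows "S x b \<in> strip l"
proof -
  have "pole_line (l - 1) < Re (S x b) \<and> Re (S x b) < pole_line l"
  proof (rule connected_between_lines[OF T(1) _ T(4,5)])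
    show "continuous_on T (S x)" using S T(2) unfolding sheets_def by (meson continuous_on_subset)
    fix w assume "w \<in> T"
    then have "w \<in> side \<sigma>" "chart0 w \<in> slit_plane" using T(2,3) by auto
    then have "cos (S x w) \<noteq> 0" "tanid (S x w) \<in> slit_plane" using S by (auto simp: sheets_def regular_pts_def)
    then show "Re (S x w) \<noteq> pole_line (l - 1) \<and> Re (S x w) \<noteq> pole_line l" using off_lines_over_slit_plane by blast
  qed (use T(6) in \<open>auto simp: strip_def\<close>)
  then show ?thesis by (simp add: strip_def)
qed

lemma label_determines:
  assumes \<sigma>: "\<sigma> = 1 \<or> \<sigma> = -1" and S: "sheets \<sigma> chart0 S" and "S x (gap_mid k) \<in> strip l" "S y (gap_mid k) \<in> strip l" "w \<in> side \<sigma>"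
  shows "S x w = S y w"
proof -
  have c: "gap_mid k \<in> side \<sigma>" using gap_mid(1) gap_side by blast
  have eq: "S x (gap_mid k) = S y (gap_mid k)"
    by (rule real_fibre_unique[OF assms(3,4)]) (use S c gap_mid(2) in \<open>simp_all add: sheets_def\<close>)
  show ?thesis
  proof (rule lifts_agree[where ?g1.0 = "S x" and ?g2.0 = "S y", OF connected_side[OF \<sigma>] c assms(5) eq])
    show "continuous_on (side \<sigma>) (S x)" "continuous_on (side \<sigma>) (S y)" using S by (simp_all add: sheets_def)
  qed (use S in \<open>simp add: sheets_def\<close>)
qed

text \<open>The line through a pole carries the points \<open>z0\<close> at height \<open>\<plusminus> 3\<close>, whose
values lie on the slits. Near \<open>z0\<close> the map \<open>tanid\<close> preserves left and right of the
line, so the sheet through \<open>z0\<close> crosses from strip \<open>m\<close> to strip \<open>m +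
1\<close> when the slit is crossed from left to right.\<close>

lemma crossing_sheet:
  assumes \<sigma>: "\<sigma> = 1 \<or> \<sigma> = -1" and S: "sheets \<sigma> chart0 S" and k: "k + 1 = 3 * m + tip \<sigma>"
  obtains x where "S x (gap_mid k) \<in> strip m" "S x (gap_mid (k + 1)) \<in> strip (m + 1)"
proof -
  define v where "v = 3 + cosh 3 / sinh (3::real)"
  have v4: "4 \<le> v" using abs_coth_ge[of 3] by (auto simp: v_def)
  then have v: "4 \<le> v" "0 < v" by simp_all
  define z0 where "z0 = Complex (pole_line m) (\<sigma> * 3)"
  define w0 where "w0 = Complex (of_int (k + 1)) (\<sigma> * (v / (4 * crit_height)))"
  have "cos (of_real (pole_line m) :: complex) = 0" using cos_0_iff_pole[of "pole m"] by (simp add: pole_def pole_line_def)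
  then have cp: "cos (pole_line m) = 0" by (simp add: cos_of_real)
  have sp: "sin (pole_line m) \<noteq> 0" using cp sin_cos_squared_add[of "pole_line m"] by auto
  have cz: "cos z0 \<noteq> 0" using sp \<sigma> by (auto simp: z0_def sin_cos_Complex complex_eq_iff)
  have fz: "tanid z0 = Complex (pole_line m) (\<sigma> * v)"
    using tanid_on_line(1)[OF cz, of m] \<sigma> by (auto simp: z0_def v_def)
  have z0: "z0 \<in> regular_pts"
    unfolding regular_pts_def
  proof (intro CollectI conjI cz notI)
    assume "tanid z0 \<in> crit_vals"
    then obtain s where "s = 1 \<or> s = -1" "\<sigma> * v = s * crit_height" using crit_vals_form unfolding fz by blast
    then have "\<bar>\<sigma> * v\<bar> = \<bar>crit_height\<bar>" by auto
    then show False using \<sigma> v crit_height_bounds by auto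
  qed
  have vc: "1 < v / crit_height" using v crit_height_bounds by simp
  have clipw: "clip (8 * Im w) = \<sigma>" if "Im w = \<sigma> * (v / (4 * crit_height))" for w
    using \<sigma> vc crit_height_bounds(1) by (auto simp: that clip_def field_simps)
  have line: "pi / 3 * of_int (k + 1) - pi / 6 * \<sigma> = pole_line m"
    using \<sigma> unfolding k by (auto simp: tip_def pole_line_def field_simps)
  have c0: "chart0 w = Complex (pole_line m + pi / 3 * (Re w - of_int (k + 1))) (\<sigma> * v)"
    if "Im w = \<sigma> * (v / (4 * crit_height))" for w
    unfolding chart0_def clipw[OF that] line[symmetric] using crit_height_bounds(1) by (simp add: that algebra_simps)
  have w0: "chart0 w0 = tanid z0" unfolding fz by (subst c0) (simp_all add: w0_def)
  have up: "1/4 < \<sigma> * (\<sigma> * (v / (4 * crit_height)))" using \<sigma> vc by auto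
  have ws: "w0 \<in> side \<sigma>" using up by (simp add: w0_def side_def)
  obtain x where x: "S x w0 = z0" using S ws z0 w0 unfolding sheets_def by metis
  have "isCont (S x) w0"
    using S ws open_side continuous_on_interior[of "side \<sigma>" "S x" w0] by (auto simp: sheets_def interior_open)
  then obtain d where d: "d > 0" "\<And>w. dist w w0 < d \<Longrightarrow> dist (S x w) (S x w0) < 1"
    unfolding continuous_at_eps_delta by (metis zero_less_one)
  define e where "e = min (d / 2) (1/2)"
  have e: "0 < e" "e < d" "e \<le> 1/2" using d(1) by (auto simp: e_def)
  define w1 where "w1 \<epsilon> = Complex (of_int (k + 1) + \<epsilon> * e) (\<sigma> * (v / (4 * crit_height)))" for \<epsilon>
  \<comment> \<open>Two points close to \<open>w0\<close> on the left and on the right of the slit.\<close>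
  have near: "w1 \<epsilon> \<in> side \<sigma>" "cos (S x (w1 \<epsilon>)) \<noteq> 0" "2 \<le> \<bar>Im (S x (w1 \<epsilon>))\<bar>" "\<bar>Re (S x (w1 \<epsilon>)) - pole_line m\<bar> \<le> 1"
    "Re (tanid (S x (w1 \<epsilon>))) = pole_line m + pi / 3 * (\<epsilon> * e)" if \<epsilon>: "\<epsilon> = 1 \<or> \<epsilon> = -1" for \<epsilon>
  proof -
    show s: "w1 \<epsilon> \<in> side \<sigma>" using up by (simp add: w1_def side_def)
    show "cos (S x (w1 \<epsilon>)) \<noteq> 0" using S s by (simp add: sheets_def regular_pts_def)
    have "w1 \<epsilon> - w0 = of_real (\<epsilon> * e)" by (simp add: w1_def w0_def complex_eq_iff)
    then have "dist (w1 \<epsilon>) w0 = e" using \<epsilon> e(1) by (auto simp: dist_norm)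
    then have "norm (S x (w1 \<epsilon>) - z0) < 1" using d(2)[of "w1 \<epsilon>"] e(2) by (simp add: x dist_norm)
    then have r: "\<bar>Re (S x (w1 \<epsilon>)) - pole_line m\<bar> \<le> 1" and i: "\<bar>Im (S x (w1 \<epsilon>)) - \<sigma> * 3\<bar> < 1"
      using abs_Re_le_cmod[of "S x (w1 \<epsilon>) - z0"] abs_Im_le_cmod[of "S x (w1 \<epsilon>) - z0"] by (auto simp: z0_def)
    show "\<bar>Re (S x (w1 \<epsilon>)) - pole_line m\<bar> \<le> 1" by (rule r)
    show "2 \<le> \<bar>Im (S x (w1 \<epsilon>))\<bar>" using i \<sigma> by auto
    have "tanid (S x (w1 \<epsilon>)) = chart0 (w1 \<epsilon>)" using S s by (simp add: sheets_def)
    then show "Re (tanid (S x (w1 \<epsilon>))) = pole_line m + pi / 3 * (\<epsilon> * e)"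
      using c0[of "w1 \<epsilon>"] by (simp add: w1_def)
  qed
  have pi2: "1 \<le> pi / 2" using pi_ge_two by simp
  have pe: "0 < pi / 3 * e" using e(1) by simp
  have near2: "\<bar>Re (S x (w1 \<epsilon>)) - pole_line m\<bar> \<le> pi / 2" if "\<epsilon> = 1 \<or> \<epsilon> = -1" for \<epsilon>
    using near(4)[OF that] pi2 by (rule order_trans)
  have m1: "(-1::real) = 1 \<or> (-1::real) = -1" and p1: "(1::real) = 1 \<or> (1::real) = -1" by simp_all
  have "Re (tanid (S x (w1 (-1)))) < pole_line m" unfolding near(5)[OF m1] using pe by simp
  then have "Re (S x (w1 (-1))) < pole_line m" by (rule sign_near_line(1)[OF near(2,3)[OF m1] near2[OF m1]])
  then have left: "S x (w1 (-1)) \<in> strip m"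
    using near(4)[OF m1] pi2 unfolding strip_def pole_line_Suc mem_Collect_eq by linarith
  have "pole_line m < Re (tanid (S x (w1 1)))" unfolding near(5)[OF p1] using pe by simp
  then have "pole_line m < Re (S x (w1 1))" by (rule sign_near_line(2)[OF near(2,3)[OF p1] near2[OF p1]])
  then have "S x (w1 1) \<in> {z. pole_line m < Re z \<and> Re z < pole_line (m + 1)}"
    using near(4)[OF p1] pi2 unfolding pole_line_Suc mem_Collect_eq by linarith
  then have right: "S x (w1 1) \<in> strip (m + 1)" by (simp add: strip_def)
  have slit_plane: "w \<in> passage \<sigma> k \<Longrightarrow> Re w \<noteq> of_int (k + 1) \<Longrightarrow> chart0 w \<in> slit_plane" for w
    unfolding slit_plane_def mem_Collect_eq using passage_line[OF \<sigma>, of w k] linorder_not_less by blast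
  define L where "L = {w. of_int k + 1/4 < Re w \<and> Re w < of_int k + 1 \<and> 1/4 < \<sigma> * Im w} \<union> gap k"
  define R where "R = {w. of_int k + 1 < Re w \<and> Re w < of_int k + 7/4 \<and> 1/4 < \<sigma> * Im w} \<union> gap (k + 1)"
  have con: "connected L" "connected R" unfolding L_def R_def by (rule connected_slab_gap[OF \<sigma>]; simp)+
  have sub: "L \<subseteq> passage \<sigma> k" "R \<subseteq> passage \<sigma> k" by (auto simp: L_def R_def passage_def)
  have "chart0 ` L \<subseteq> slit_plane" "chart0 ` R \<subseteq> slit_plane"
    using sub by (auto intro!: slit_plane simp: L_def R_def gap_def)
  moreover have "w1 (-1) \<in> L" "w1 1 \<in> R" using up e by (auto simp: w1_def L_def R_def)
  moreover have "gap_mid k \<in> L" "gap_mid (k + 1) \<in> R" using gap_mid(1) by (auto simp: L_def R_def)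
  moreover have "L \<subseteq> side \<sigma>" "R \<subseteq> side \<sigma>" using sub passage_side by blast+
  ultimately have "S x (gap_mid k) \<in> strip m" "S x (gap_mid (k + 1)) \<in> strip (m + 1)"
    using label_const[OF S con(1) _ _ _ _ left, of "gap_mid k"] label_const[OF S con(2) _ _ _ _ right, of "gap_mid (k + 1)"]
    by simp_all
  then show ?thesis by (rule that)
qed

text \<open>Passing the slit of column \<open>m\<close>, a sheet can leave its strip only through the line with index
\<open>m\<close>, since the values on the other lines lie on other slits. So all labels but \<open>m\<close>
and \<open>m + 1\<close> are kept. The sheet from strip \<open>m\<close> is the one of
\<open>crossing_sheet\<close>; the sheet from strip \<open>m + 1\<close> stays in one of these two strips,
and it must end in strip \<open>m\<close>, because the other one is taken.\<close>

lemma label_step: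
  assumes \<sigma>: "\<sigma> = 1 \<or> \<sigma> = -1" and S: "sheets \<sigma> chart0 S" and l: "S x (gap_mid k) \<in> strip l"
  shows "(\<And>m. k + 1 = 3 * m + tip \<sigma> \<Longrightarrow> S x (gap_mid (k + 1)) \<in> strip (swap m (m + 1) l))"
    and "(\<And>m. k + 1 \<noteq> 3 * m + tip \<sigma>) \<Longrightarrow> S x (gap_mid (k + 1)) \<in> strip l"
proof -
  note P = connected_passage[OF \<sigma>, of k] passage_side[of \<sigma> k] gap_mid(4)[of k \<sigma>] gap_mid(5)[of k \<sigma>]
  show "S x (gap_mid (k + 1)) \<in> strip l" if no: "\<And>m. k + 1 \<noteq> 3 * m + tip \<sigma>"
  proof (rule label_const[OF S P(1,2) _ P(3,4) l])
    show "chart0 ` passage \<sigma> k \<subseteq> slit_plane"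
    proof (rule image_subsetI)
      fix w assume "w \<in> passage \<sigma> k"
      then have "\<bar>Im (chart0 w)\<bar> < 1" if "Re (chart0 w) = pole_line n" for n
        using passage_line[OF \<sigma> _ that] no[of n] linorder_not_less by metis
      then show "chart0 w \<in> slit_plane" unfolding slit_plane_def mem_Collect_eq by blast
    qed
  qed
  show "S x (gap_mid (k + 1)) \<in> strip (swap m (m + 1) l)" if k: "k + 1 = 3 * m + tip \<sigma>" for m
  proof -
    have gside: "gap_mid n \<in> side \<sigma>" for n using gap_mid(1) gap_side by blast
    obtain l' where l': "S x (gap_mid (k + 1)) \<in> strip l'" by (rule label_exists[OF S gside gap_mid(3)])
    obtain x0 where x0: "S x0 (gap_mid k) \<in> strip m" "S x0 (gap_mid (k + 1)) \<in> strip (m + 1)"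
      by (rule crossing_sheet[OF \<sigma> S k])
    have off: "Re (S x w) \<noteq> pole_line n" if "n \<noteq> m" "w \<in> passage \<sigma> k" for n w
    proof
      assume R: "Re (S x w) = pole_line n"
      have w: "cos (S x w) \<noteq> 0" "tanid (S x w) = chart0 w"
        using S that(2) P(2) by (auto simp: sheets_def regular_pts_def)
      have "Re (chart0 w) = pole_line n" "1 \<le> \<bar>Im (chart0 w)\<bar>"
        using tanid_on_line(1,2)[OF w(1) R] unfolding w(2) by simp_all
      then have "3 * n + tip \<sigma> = k + 1" using passage_line[OF \<sigma> that(2)] by blast
      then show False using k that(1) by simp
    qed
    have cont: "continuous_on (passage \<sigma> k) (S x)" using S P(2) unfolding sheets_def by (meson continuous_on_subset)
    have between: "pole_line a < Re (S x (gap_mid (k + 1))) \<and> Re (S x (gap_mid (k + 1))) < pole_line b"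
      if "a \<noteq> m" "b \<noteq> m" "pole_line a < Re (S x (gap_mid k))" "Re (S x (gap_mid k)) < pole_line b" for a b
      using off that by (intro connected_between_lines[OF P(1) cont P(3,4)]) auto
    consider "l = m" | "l = m + 1" | "l \<noteq> m" "l \<noteq> m + 1" by blast
    then show ?thesis
    proof cases
      case 1
      have "S x (gap_mid (k + 1)) = S x0 (gap_mid (k + 1))"
        using label_determines[OF \<sigma> S l _ gside] x0(1) 1 by blast
      then show ?thesis using x0(2) 1 by simp
    next
      case 2
      have "pole_line (m - 1) < pole_line (l - 1)" "pole_line l \<le> pole_line (m + 1)" unfolding pole_line_less using 2 by auto
      then have "pole_line (m - 1) < Re (S x (gap_mid k))" "Re (S x (gap_mid k)) < pole_line (m + 1)"
        using l by (auto simp: strip_def)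
      then have "pole_line (m - 1) < Re (S x (gap_mid (k + 1))) \<and> Re (S x (gap_mid (k + 1))) < pole_line (m + 1)"
        by (intro between) auto
      then have "pole_line (m - 1) < pole_line l'" "pole_line (l' - 1) < pole_line (m + 1)" using l' by (auto simp: strip_def)
      then have "l' = m \<or> l' = m + 1" unfolding pole_line_less by linarith
      moreover have "l' \<noteq> m + 1"
      proof
        assume "l' = m + 1"
        then have "S x (gap_mid k) = S x0 (gap_mid k)" using label_determines[OF \<sigma> S l' _ gside] x0(2) by blast
        then have "l = m" using l x0(1) strip_unique by metis
        then show False using 2 by simp
      qed
      ultimately show ?thesis using l' 2 by simp
    next
      case 3
      have "pole_line (l - 1) < Re (S x (gap_mid (k + 1))) \<and> Re (S x (gap_mid (k + 1))) < pole_line l"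
        using l 3 by (intro between) (auto simp: strip_def)
      then show ?thesis using 3 by (simp add: strip_def Transposition.transpose_def)
    qed
  qed
qed

text \<open>The strip reached from strip \<open>l\<close> after crossing the slits of the columns \<open>0\<close> to
\<open>m - 1\<close> from left to right, or of the columns \<open>-1\<close> down to \<open>m\<close> from
right to left.\<close>

definition start_label :: "int \<Rightarrow> int \<Rightarrow> int" where
  "start_label m l = (if l = 0 then m else if 1 \<le> l \<and> l \<le> m then l - 1 else if m \<le> l \<and> l \<le> - 1 then l + 1 else l)"

lemma start_label_Suc: "start_label (m + 1) l = swap m (m + 1) (start_label m l)"
  by (auto simp: start_label_def Transposition.transpose_def)

lemma start_label_slit: "start_label m (swap 0 (slit_label m) l) = start_label (m + 1) l"
  by (auto simp: start_label_def slit_label_def Transposition.transpose_def)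

text \<open>Labels are normalised over the gap \<open>tip \<sigma> - 2\<close>, which lies between the slits of the
columns \<open>-1\<close> and \<open>0\<close>; the quotient counts the slits crossed on the way from there.\<close>

lemma start_labels:
  assumes \<sigma>: "\<sigma> = 1 \<or> \<sigma> = -1" and S: "sheets \<sigma> chart0 S" and b: "S x (gap_mid (tip \<sigma> - 2)) \<in> strip x"
  shows "S x (gap_mid k) \<in> strip (start_label ((k + 3 - tip \<sigma>) div 3) x)"
proof -
  define lev where "lev k = (k + 3 - tip \<sigma>) div 3" for k
  have tip: "tip \<sigma> = 1 \<or> tip \<sigma> = 2" by (simp add: tip_def)
  have next1: "lev (k + 1) = m + 1 \<and> lev k = m" if "k + 1 = 3 * m + tip \<sigma>" for k m
  proof -
    have "k + 1 + 3 - tip \<sigma> = 3 * m + 3" "k + 3 - tip \<sigma> = 3 * m + 2" using that by linarith+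
    then show ?thesis unfolding lev_def by presburger
  qed
  have next2: "lev (k + 1) = lev k" if "\<And>m. k + 1 \<noteq> 3 * m + tip \<sigma>" for k
  proof -
    define d where "d = k + 3 - tip \<sigma>"
    have "d + 1 \<noteq> 3 * ((d + 1) div 3)" using that[of "(d + 1) div 3 - 1"] by (simp add: d_def)
    then have "(d + 1) div 3 = d div 3" by presburger
    moreover have "k + 1 + 3 - tip \<sigma> = d + 1" by (simp add: d_def)
    ultimately show ?thesis unfolding lev_def by (simp add: d_def)
  qed
  have up: "S x (gap_mid (k + 1)) \<in> strip (start_label (lev (k + 1)) x)" if "S x (gap_mid k) \<in> strip (start_label (lev k) x)" for k
  proof (cases "\<exists>m. k + 1 = 3 * m + tip \<sigma>")
    case True
    then obtain m where m: "k + 1 = 3 * m + tip \<sigma>" by blast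
    show ?thesis using label_step(1)[OF \<sigma> S that m] next1[OF m] by (simp add: start_label_Suc)
  next
    case False
    then show ?thesis using label_step(2)[OF \<sigma> S that] next2[of k] by simp
  qed
  \<comment> \<open>Each step is a permutation of the strips, so it can also be traced backwards.\<close>
  have down: "S x (gap_mid k) \<in> strip (start_label (lev k) x)" if k: "S x (gap_mid (k + 1)) \<in> strip (start_label (lev (k + 1)) x)" for k
  proof -
    have "gap_mid k \<in> side \<sigma>" using gap_mid(1) gap_side by blast
    then obtain l where l: "S x (gap_mid k) \<in> strip l" by (rule label_exists[OF S _ gap_mid(3)])
    have "l = start_label (lev k) x"
    proof (cases "\<exists>m. k + 1 = 3 * m + tip \<sigma>")
      case True
      then obtain m where m: "k + 1 = 3 * m + tip \<sigma>" by blast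
      have "swap m (m + 1) l = swap m (m + 1) (start_label m x)"
        using strip_unique[OF label_step(1)[OF \<sigma> S l m] k] next1[OF m] by (simp add: start_label_Suc)
      then have "swap m (m + 1) (swap m (m + 1) l) = swap m (m + 1) (swap m (m + 1) (start_label m x))" by (rule arg_cong)
      then show ?thesis using next1[OF m] by simp
    next
      case False
      then show ?thesis using strip_unique[OF label_step(2)[OF \<sigma> S l] k] next2[of k] by auto
    qed
    then show ?thesis using l by simp
  qed
  have "S x (gap_mid k) \<in> strip (start_label (lev k) x)"
  proof (induction k rule: int_induct[where k = "tip \<sigma> - 2"])
    case base
    have "lev (tip \<sigma> - 2) = 0" by (simp add: lev_def)
    moreover have "start_label 0 x = x" by (auto simp: start_label_def)
    ultimately show ?case using b by simp
  next
    case (step1 i) then show ?case by (intro up)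
  next
    case (step2 i) then show ?case using down[of "i - 1"] by simp
  qed
  then show ?thesis by (simp add: lev_def)
qed

definition start_perm :: "int \<Rightarrow> int \<Rightarrow> int" where
  "start_perm k = (if k mod 3 = 1 then swap 0 (slit_label (k div 3)) else id)"

lemma start_sheets:
  assumes \<sigma>: "\<sigma> = 1 \<or> \<sigma> = -1"
  shows "\<exists>S. sheets \<sigma> chart0 S \<and> (\<forall>x. S x (gap_mid (tip \<sigma> - 2)) \<in> strip x)"
proof -
  let ?b = "gap_mid (tip \<sigma> - 2)"
  have b: "?b \<in> side \<tau>" for \<tau> using gap_mid(1) gap_side by blast
  have nc: "chart0 w \<in> - crit_vals" if "w \<in> side \<sigma>" for w using chart0_not_crit[of w] that \<sigma> by auto
  obtain r where r: "chart0 ?b = of_real r" using gap_mid(2) by (metis complex_is_Real_iff Reals_cases)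
  obtain Z where Z: "\<And>x. Z x \<in> strip x" "\<And>x. tanid (Z x) = chart0 ?b"
    using real_fibre_exists[of _ r] unfolding r by metis
  have "\<exists>S. sheets \<sigma> chart0 S \<and> (\<forall>x. S x ?b = Z x)"
  proof (rule sheets_from_fibre[OF \<sigma> _ _ b])
    show "continuous_on (side \<sigma>) chart0"
      using chart0_homeo homeomorphism_cont1 by (metis continuous_on_subset subset_UNIV)
    show "chart0 \<in> side \<sigma> \<rightarrow> - crit_vals" using nc by blast
    show "Z x \<in> regular_pts \<and> tanid (Z x) = chart0 ?b" for x
      using Z strip_cos_nz[OF Z(1)] nc[OF b] by (simp add: regular_pts_def)
    fix z assume z: "z \<in> regular_pts" "tanid z = chart0 ?b"
    have "cos z \<noteq> 0" using z(1) by (simp add: regular_pts_def)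
    then have "\<And>k. Re z \<noteq> pole_line k" using off_lines_over_slit_plane z(2) gap_mid(3) by metis
    then obtain l where "z \<in> strip l" by (rule strip_exists)
    then have "z = Z l" using z(2) Z gap_mid(2) by (intro real_fibre_unique[of z l]) auto
    then show "z \<in> range Z" by blast
  qed
  then show ?thesis using Z(1) by metis
qed

text \<open>In the gaps \<open>3 m\<close> and \<open>3 m + 2\<close> both sides have crossed the same slits. In the gap
\<open>3 m + 1\<close> the lower side has crossed the slit of column \<open>m\<close>, but the upper side
has not; this gives the transposition of \<open>0\<close> and \<open>slit_label m\<close>.\<close>

theorem start_frame: "\<exists>s t. frame chart0 s t start_perm"
proof -
  obtain s where s: "sheets (-1) chart0 s" "\<And>x. s x (gap_mid (tip (-1) - 2)) \<in> strip x" using start_sheets[of "-1"] by blast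
  obtain t where t: "sheets 1 chart0 t" "\<And>x. t x (gap_mid (tip 1 - 2)) \<in> strip x" using start_sheets[of 1] by blast
  have "s x w = t (start_perm k x) w" if w: "w \<in> gap k" for k x w
  proof (rule gap_agree[OF s(1) t(1) gap_mid(1) w])
    have sl: "s x (gap_mid k) \<in> strip (start_label ((k + 2) div 3) x)"
      using start_labels[OF _ s, where k = k] by (simp add: tip_def add.commute)
    have tl: "t y (gap_mid k) \<in> strip (start_label ((k + 1) div 3) y)" for y
      using start_labels[OF _ t, where k = k] by (simp add: tip_def add.commute)
    have eq: "start_label ((k + 1) div 3) (start_perm k x) = start_label ((k + 2) div 3) x"
    proof (cases "k mod 3 = 1")
      case True
      then have "(k + 1) div 3 = k div 3" "(k + 2) div 3 = k div 3 + 1" by presburger+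
      then show ?thesis using True by (simp add: start_perm_def start_label_slit)
    next
      case False
      then have "(k + 1) div 3 = (k + 2) div 3" by presburger
      then show ?thesis using False by (simp add: start_perm_def)
    qed
    have "gap_mid k \<in> side (-1)" "gap_mid k \<in> side 1" using gap_mid(1) gap_side by blast+
    then have "tanid (s x (gap_mid k)) = chart0 (gap_mid k)" "tanid (t (start_perm k x) (gap_mid k)) = chart0 (gap_mid k)"
      using s(1) t(1) by (simp_all add: sheets_def)
    then show "s x (gap_mid k) = t (start_perm k x) (gap_mid k)"
      using real_fibre_unique[OF sl tl[of "start_perm k x", unfolded eq]] gap_mid(2)[of k] by simp
  qed
  then have "frame chart0 s t start_perm"
    unfolding frame_def using chart0_homeo s(1) t(1) by (auto simp: start_perm_def)
  then show ?thesis by blast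
qed

lemma start_tame: "tame (start_perm, \<lambda>j. 3 * int j)"
proof -
  have tr: "A = {} \<or> A = UNIV" if A: "\<forall>k. invariant_set (start_perm k) A" for A
  proof -
    have "slit_label m \<in> A \<longleftrightarrow> 0 \<in> A" for m
    proof -
      have "start_perm (3 * m + 1) = swap 0 (slit_label m)" by (simp add: start_perm_def)
      then have "invariant_set (swap 0 (slit_label m)) A" using A by metis
      then have "swap 0 (slit_label m) 0 \<in> A \<longleftrightarrow> 0 \<in> A" unfolding invariant_set_def by blast
      then show ?thesis by simp
    qed
    then have "u \<in> A \<longleftrightarrow> 0 \<in> A" for u using slit_label_surj[of u] by (cases "u = 0") auto
    then show ?thesis by blast
  qed
  have st: "standard_at start_perm (\<lambda>j. 3 * int j) m" for m
  proof -
    have "start_perm k (slit_label m) = slit_label m" if k: "k \<noteq> 3 * m + 1" for k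
    proof (cases "k mod 3 = 1")
      case True
      then have "k div 3 \<noteq> m" using k by presburger
      then show ?thesis using slit_label_simps[of m] slit_label_simps(2)[of m "k div 3"]
        by (simp add: start_perm_def Transposition.transpose_def)
    qed (simp add: start_perm_def)
    moreover have "3 * int c \<noteq> 3 * m + 1 \<and> 3 * int c \<noteq> 3 * m + 2" for c by presburger
    then have "3 * m + 1 \<notin> range (\<lambda>j. 3 * int j)" "3 * m + 2 \<notin> range (\<lambda>j. 3 * int j)"
      by (auto simp del: not_less intro!: notin_rangeI)
    ultimately show ?thesis by (simp add: standard_at_def start_perm_def)
  qed
  have "bij (start_perm k)" for k by (simp add: start_perm_def)
  moreover have "inj (\<lambda>j. 3 * int j)" by (rule injI) simp
  moreover have "transitive_gaps start_perm" unfolding transitive_gaps_def using tr by blast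
  ultimately show ?thesis unfolding tame_def using st by simp
qed

section \<open>Digging the lakes\<close>

text \<open>Moves of configurations are realised by frames: lakes never shrink, and the sheet with label
\<open>y\<close> above the lake \<open>j\<close> stays joined to its successor of the same label.\<close>

lemma frame_move:
  assumes m: "move j (\<pi>, pos) (\<pi>', pos')" and f: "frame \<phi> s t \<pi>"
  shows "\<exists>\<phi>' s' t'. frame \<phi>' s' t' \<pi>' \<and> (\<forall>c. \<phi> ` square (pos c) \<subseteq> \<phi>' ` square (pos' c)) \<and>
    (\<forall>y. connected_component (preim (\<phi>' ` square (pos' j))) (t y (mark 1 (pos j))) (t' y (mark 1 (pos' j))))"
  using m
proof cases
  case (twist k)
  obtain \<phi>' s' t' where 1: "frame \<phi>' s' t' (twist k \<pi>)" "\<And>l. \<phi>' ` square (swap k (k + 1) l) = \<phi> ` square l"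
    "\<And>i y. i \<noteq> k \<Longrightarrow> connected_component (preim (\<phi> ` square i)) (t y (mark 1 i)) (t' y (mark 1 (swap k (k + 1) i)))"
    using frame_twist[OF f, of k] by blast
  have "\<phi>' ` square (pos' c) = \<phi> ` square (pos c)" for c using 1(2) twist by simp
  moreover have "connected_component (preim (\<phi> ` square (pos j))) (t y (mark 1 (pos j))) (t' y (mark 1 (pos' j)))" for y
    using 1(3)[of "pos j" y] twist by simp
  ultimately show ?thesis using 1(1) twist(1) by (intro exI[of _ \<phi>'] exI[of _ s'] exI[of _ t']) simp
next
  case merge
  obtain \<phi>' s' t' where 1: "frame \<phi>' s' t' (\<pi>(pos j := \<pi> (pos j + 1))) \<and> \<phi> ` square (pos j) \<subseteq> \<phi>' ` square (pos j) \<and>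
    (\<forall>l. l \<noteq> pos j \<and> l \<noteq> pos j + 1 \<longrightarrow> \<phi>' ` square l = \<phi> ` square l) \<and>
    (\<forall>y. connected_component (preim (\<phi>' ` square (pos j))) (t y (mark 1 (pos j))) (t' y (mark 1 (pos j))))"
    using frame_merge[OF f, of "pos j"] by (elim exE)
  have "\<phi> ` square (pos c) \<subseteq> \<phi>' ` square (pos c)" for c
  proof (cases "pos c = pos j")
    case True then show ?thesis using 1 by simp
  next
    case False
    moreover have "pos c \<noteq> pos j + 1" using merge(3) by (metis rangeI)
    ultimately show ?thesis using 1 by simp
  qed
  then show ?thesis using 1 merge(1,2) by (intro exI[of _ \<phi>'] exI[of _ s'] exI[of _ t']) simp
qed

lemma preim_mono: "U \<subseteq> V \<Longrightarrow> preim U \<subseteq> preim V"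
  by (auto simp: preim_def)

lemma component_mono:
  "connected_component (preim U) x y \<Longrightarrow> U \<subseteq> V \<Longrightarrow> connected_component (preim V) x y"
  using connected_component_of_subset preim_mono by metis

lemma frame_moves:
  assumes "moves j (\<pi>, pos) (\<pi>', pos')" and f: "frame \<phi> s t \<pi>"
  shows "\<exists>\<phi>' s' t'. frame \<phi>' s' t' \<pi>' \<and> (\<forall>c. \<phi> ` square (pos c) \<subseteq> \<phi>' ` square (pos' c)) \<and>
    (\<forall>y. connected_component (preim (\<phi>' ` square (pos' j))) (t y (mark 1 (pos j))) (t' y (mark 1 (pos' j))))"
  using assms(1)
proof (induction rule: rtranclp_induct2)
  case refl
  have "t y (mark 1 (pos j)) \<in> preim (\<phi> ` square (pos j))" for y
  proof -
    have "mark 1 (pos j) \<in> side 1" by (simp add: mark_def side_def)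
    then show ?thesis using f by (auto simp: frame_def sheets_def preim_def regular_pts_def mark_def square_def)
  qed
  then show ?case using f by (intro exI[of _ \<phi>] exI[of _ s] exI[of _ t]) simp
next
  case (step \<pi>1 pos1 \<pi>2 pos2)
  obtain \<phi>1 s1 t1 where 1: "frame \<phi>1 s1 t1 \<pi>1" "\<And>c. \<phi> ` square (pos c) \<subseteq> \<phi>1 ` square (pos1 c)"
    "\<And>y. connected_component (preim (\<phi>1 ` square (pos1 j))) (t y (mark 1 (pos j))) (t1 y (mark 1 (pos1 j)))"
    using step.IH by blast
  obtain \<phi>2 s2 t2 where 2: "frame \<phi>2 s2 t2 \<pi>2" "\<And>c. \<phi>1 ` square (pos1 c) \<subseteq> \<phi>2 ` square (pos2 c)"
    "\<And>y. connected_component (preim (\<phi>2 ` square (pos2 j))) (t1 y (mark 1 (pos1 j))) (t2 y (mark 1 (pos2 j)))"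
    using frame_move[OF step.hyps(2) 1(1)] by blast
  have "connected_component (preim (\<phi>2 ` square (pos2 j))) (t y (mark 1 (pos j))) (t2 y (mark 1 (pos2 j)))" for y
    using connected_component_trans[OF component_mono[OF 1(3) 2(2)] 2(3)] .
  moreover have "\<phi> ` square (pos c) \<subseteq> \<phi>2 ` square (pos2 c)" for c using 1(2) 2(2) by (rule subset_trans)
  ultimately show ?case using 2(1) by blast
qed

lemma connect_sheets:
  assumes f: "frame \<phi> s t \<pi>" and "tame (\<pi>, pos)"
  shows "\<exists>\<phi>' s' t' \<pi>' pos'. frame \<phi>' s' t' \<pi>' \<and> tame (\<pi>', pos') \<and>
    (\<forall>c. \<phi> ` square (pos c) \<subseteq> \<phi>' ` square (pos' c)) \<and>
    connected_component (preim (\<phi>' ` square (pos' j))) (t y (mark 1 (pos j))) (t y' (mark 1 (pos j)))"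
proof -
  obtain \<pi>' pos' where 1: "moves j (\<pi>, pos) (\<pi>', pos')" "tame (\<pi>', pos')"
    "y' \<in> orbit_of (\<pi>' (pos' j) \<circ> inv (\<pi>' (pos' j - 1))) y"
    using connect_labels[OF assms(2)] by blast
  obtain \<phi>' s' t' where 2: "frame \<phi>' s' t' \<pi>'" "\<And>c. \<phi> ` square (pos c) \<subseteq> \<phi>' ` square (pos' c)"
    "\<And>y. connected_component (preim (\<phi>' ` square (pos' j))) (t y (mark 1 (pos j))) (t' y (mark 1 (pos' j)))"
    using frame_moves[OF 1(1) f] by blast
  have "connected_component (preim (\<phi>' ` square (pos' j))) (t y (mark 1 (pos j))) (t y' (mark 1 (pos j)))"
    using connected_component_trans[OF connected_component_trans[OF 2(3)[of y] ring[OF 2(1) 1(3)]]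
        connected_component_sym[OF 2(3)[of y']]] .
  then show ?thesis using 1(2) 2(1,2) by blast
qed

lemma countable_crit_vals: "countable crit_vals"
proof (rule countable_subset)
  show "crit_vals \<subseteq> (\<lambda>(k::int, b). Complex ((of_int k + 1/2) * pi) ((if b then 1 else -1) * crit_height)) ` UNIV"
  proof
    fix v assume "v \<in> crit_vals"
    then obtain k s where "s = 1 \<or> s = -1" "v = Complex ((of_int k + 1/2) * pi) (s * crit_height)"
      using crit_vals_form by blast
    then show "v \<in> (\<lambda>(k::int, b). Complex ((of_int k + 1/2) * pi) ((if b then 1 else -1) * crit_height)) ` UNIV"
      by (intro image_eqI[of _ _ "(k, s = 1)"]) auto
  qed
qed simp

lemma countable_crit_pts: "countable {z::complex. (cos z)\<^sup>2 = - 1}"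
proof (rule countable_subset)
  show "{z::complex. (cos z)\<^sup>2 = - 1} \<subseteq> (\<lambda>(k::int, b). Complex ((of_int k + 1/2) * pi) ((if b then 1 else -1) * arsinh 1)) ` UNIV"
  proof
    fix z :: complex assume "z \<in> {z. (cos z)\<^sup>2 = - 1}"
    then obtain k s where "s = 1 \<or> s = -1" "z = Complex ((of_int k + 1/2) * pi) (s * arsinh 1)"
      using crit_pt_eqs[of z] by blast
    then show "z \<in> (\<lambda>(k::int, b). Complex ((of_int k + 1/2) * pi) ((if b then 1 else -1) * arsinh 1)) ` UNIV"
      by (intro image_eqI[of _ _ "(k, s = 1)"]) auto
  qed
qed simp

text \<open>A path between the values that avoids the countably many critical values is lifted.\<close>

lemma lift_to_fibre:
  assumes U: "open U" "connected U" and z: "z \<in> regular_pts" "tanid z \<in> U" and w: "w \<in> U" "w \<notin> crit_vals"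
  shows "\<exists>z'\<in>regular_pts. tanid z' = w \<and> connected_component (preim U) z z'"
proof -
  have "path_connected (U - crit_vals)"
    by (rule path_connected_open_diff_countable[OF _ U countable_crit_vals]) simp
  moreover have "tanid z \<in> U - crit_vals" using z by (simp add: regular_pts_def)
  ultimately obtain g where g: "path g" "path_image g \<subseteq> U - crit_vals" "pathstart g = tanid z" "pathfinish g = w"
    using w unfolding path_connected_def by blast
  obtain h where h: "path h" "path_image h \<subseteq> regular_pts" "pathstart h = z" "\<And>t. t \<in> {0..1} \<Longrightarrow> tanid (h t) = g t"
  proof -
    have "path_image g \<subseteq> - crit_vals" using g(2) by blast
    from covering_space_lift_path_strong[OF tanid_covering z(1) g(1) this g(3)] show ?thesis using that by blast
  qed
  have "h 1 \<in> regular_pts" using h(2) by (auto simp: path_image_def)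
  moreover have "tanid (h 1) = w" using h(4)[of 1] g(4) by (simp add: pathfinish_def)
  moreover have "connected_component (preim U) z (h 1)"
    unfolding connected_component_def
  proof (intro exI conjI)
    show "connected (path_image h)" using h(1) by (rule connected_path_image)
    show "path_image h \<subseteq> preim U"
    proof
      fix x assume x: "x \<in> path_image h"
      then obtain t where t: "t \<in> {0..1}" "x = h t" by (auto simp: path_image_def)
      then have "g t \<in> path_image g" by (auto simp: path_image_def)
      then have "tanid x = g t" "g t \<in> U" using h(4) g(2) t by auto
      then show "x \<in> preim U" using x h(2) by (auto simp: preim_def regular_pts_def)
    qed
    show "z \<in> path_image h" using h(3) pathstart_in_path_image by blast
    show "h 1 \<in> path_image h" by (auto simp: path_image_def)
  qed
  ultimately show ?thesis by blast
qed

lemma open_preim: "open U \<Longrightarrow> open (preim U)"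
proof -
  assume "open U"
  moreover have "preim U = {z. cos z \<noteq> 0} \<inter> tanid -` U" by (auto simp: preim_def)
  ultimately show ?thesis using continuous_open_preimage[OF tanid_cont open_cos_nz] by simp
qed

text \<open>If all values near \<open>z\<close> were critical, then \<open>tanid\<close> would be constant there, since
its values would form a connected countable set; but its derivative has only countably many zeros.\<close>

lemma move_off_crit_vals:
  assumes U: "open U" and z: "z \<in> preim U"
  shows "\<exists>z'\<in>regular_pts. connected_component (preim U) z z'"
proof -
  obtain r where r: "r > 0" "ball z r \<subseteq> preim U" using open_preim[OF U] z openE by blast
  have cnz: "cos w \<noteq> 0" if "w \<in> ball z r" for w using that r(2) by (auto simp: preim_def)
  have "\<exists>w\<in>ball z r. tanid w \<notin> crit_vals"
  proof (rule ccontr)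
    assume "\<not> ?thesis"
    then have sub: "tanid ` ball z r \<subseteq> crit_vals" by blast
    have cont: "continuous_on (ball z r) tanid" using tanid_cont by (rule continuous_on_subset) (use cnz in blast)
    then have con: "connected (tanid ` ball z r)" by (intro connected_continuous_image connected_ball)
    have const: "tanid w = tanid z" if "w \<in> ball z r" for w
    proof (rule ccontr)
      assume "tanid w \<noteq> tanid z"
      then have "uncountable (tanid ` ball z r)"
        using connected_uncountable[OF con, of "tanid w" "tanid z"] that r(1) by auto
      then show False using sub countable_crit_vals countable_subset by blast
    qed
    have "(cos w)\<^sup>2 = - 1" if w: "w \<in> ball z r" for w
    proof -
      have "((\<lambda>_. tanid z) has_field_derivative (1 + 1 / (cos w)\<^sup>2)) (at w)"
        by (rule has_field_derivative_transform_within_open[OF tanid_deriv[OF cnz[OF w]] open_ball w]) (rule const)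
      then have "1 + 1 / (cos w)\<^sup>2 = 0" by (rule DERIV_unique) (rule DERIV_const)
      then have "(cos w)\<^sup>2 * (1 + 1 / (cos w)\<^sup>2) = 0" by simp
      then have "(cos w)\<^sup>2 + 1 = 0" using cnz[OF w] by (simp add: distrib_left)
      then show ?thesis by (simp add: eq_neg_iff_add_eq_0)
    qed
    then have "ball z r \<subseteq> {w. (cos w)\<^sup>2 = - 1}" by blast
    then have "countable (ball z r)" using countable_crit_pts countable_subset by blast
    then show False using uncountable_ball[OF r(1), of z] by blast
  qed
  then obtain w where w: "w \<in> ball z r" "tanid w \<notin> crit_vals" by blast
  have "connected_component (preim U) z w"
    unfolding connected_component_def using r w by (intro exI[of _ "ball z r"]) auto
  then show ?thesis using w cnz by (intro bexI[of _ w]) (auto simp: regular_pts_def)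
qed

lemma increasing_union_absorbs_compact:
  fixes L :: "nat \<Rightarrow> 'a::metric_space set"
  assumes "\<And>n. open (L n)" "\<And>m n. m \<le> n \<Longrightarrow> L m \<subseteq> L n" "compact C" "C \<subseteq> (\<Union>n. L n)"
  obtains n where "C \<subseteq> L n"
proof -
  obtain N where N: "finite N" "C \<subseteq> (\<Union>n\<in>N. L n)"
    by (rule compactE_image[OF assms(3), of UNIV L]) (use assms(1,4) in auto)
  have "L n \<subseteq> L (Max (insert 0 N))" if "n \<in> N" for n using N(1) that by (intro assms(2) Max_ge) auto
  then have "C \<subseteq> L (Max (insert 0 N))" using N(2) by blast
  then show ?thesis by (rule that)
qed

text \<open>Two loops are compact, so they lie in a single member of the sequence.\<close>

lemma simply_connected_increasing_union:
  fixes L :: "nat \<Rightarrow> 'a::real_normed_vector set"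
  assumes op: "\<And>n. open (L n)" and mono: "\<And>m n. m \<le> n \<Longrightarrow> L m \<subseteq> L n" and sc: "\<And>n. simply_connected (L n)"
  shows "simply_connected (\<Union>n. L n)"
  unfolding simply_connected_def
proof (intro allI impI, elim conjE)
  fix p q assume p: "path p" "pathfinish p = pathstart p" "path_image p \<subseteq> (\<Union>n. L n)"
    and q: "path q" "pathfinish q = pathstart q" "path_image q \<subseteq> (\<Union>n. L n)"
  have C: "compact (path_image p \<union> path_image q)" using p(1) q(1) by (intro compact_Un compact_path_image)
  have sub: "path_image p \<union> path_image q \<subseteq> (\<Union>n. L n)" by (rule Un_least[OF p(3) q(3)])
  obtain n where n: "path_image p \<union> path_image q \<subseteq> L n"
    by (rule increasing_union_absorbs_compact[of L, OF op mono C sub])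
  then have "homotopic_loops (L n) p q" using sc[of n] p q unfolding simply_connected_def by simp
  then show "homotopic_loops (\<Union>n. L n) p q" by (rule homotopic_loops_subset) blast
qed

definition lake :: "(complex \<Rightarrow> complex) \<times> (nat \<Rightarrow> int) \<Rightarrow> nat \<Rightarrow> complex set" where
  "lake X c = fst X ` square (snd X c)"

text \<open>Only the frame and the positions of the lakes are remembered; sheets and permutations can be chosen anew.\<close>

definition stage :: "(complex \<Rightarrow> complex) \<times> (nat \<Rightarrow> int) \<Rightarrow> bool" where
  "stage X \<longleftrightarrow> (\<exists>s t \<pi>. frame (fst X) s t \<pi> \<and> tame (\<pi>, snd X))"

lemma convex_square: "convex (square k)"
proof -
  have absd: "\<bar>u - v\<bar> < d \<longleftrightarrow> v - d < u \<and> u < v + d" for u v d :: real by arith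
  have absd0: "\<bar>u\<bar> < d \<longleftrightarrow> - d < u \<and> u < d" for u d :: real by arith
  have "square k = {z. 1 \<bullet> z > of_int k - 3/10} \<inter> {z. 1 \<bullet> z < of_int k + 3/10} \<inter> {z. \<i> \<bullet> z > - (3/10)} \<inter> {z. \<i> \<bullet> z < 3/10}"
    unfolding square_def absd absd0 by (auto simp: inner_complex_def)
  then show ?thesis by (simp only:) (intro convex_Int convex_halfspace_gt convex_halfspace_lt)
qed

lemma open_square: "open (square k)"
  unfolding square_def by (intro open_Collect_conj open_Collect_less continuous_intros)

lemma lake_props:
  assumes "stage X"
  shows "open (lake X c)" "simply_connected (lake X c)" "connected (lake X c)" "c \<noteq> d \<Longrightarrow> lake X c \<inter> lake X d = {}"
proof -
  obtain s t \<pi> h where f: "frame (fst X) s t \<pi>" "tame (\<pi>, snd X)" "homeomorphism UNIV UNIV (fst X) h"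
    using assms unfolding stage_def frame_def by blast
  have cont: "continuous_on UNIV (fst X)" using f(3) by (rule homeomorphism_cont1)
  have inj: "inj (fst X)" using f(3) by (metis UNIV_I homeomorphism_apply1 injI)
  have inj': "inj_on (fst X) (square (snd X c))" for c using inj by (rule inj_on_subset) simp
  have cs: "continuous_on (square (snd X c)) (fst X)" for c using cont by (rule continuous_on_subset) simp
  show "open (lake X c)" unfolding lake_def by (rule invariance_of_domain[OF cs open_square inj'])
  have "homeomorphism (square (snd X c)) (fst X ` square (snd X c)) (fst X) h"
    using f(3) by (rule homeomorphism_of_subsets) auto
  then have "square (snd X c) homeomorphic lake X c" unfolding lake_def homeomorphic_def by blast
  then show sc: "simply_connected (lake X c)"
    using convex_imp_simply_connected[OF convex_square] homeomorphic_simply_connected_eq by blast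
  then show "connected (lake X c)" by (rule simply_connected_imp_connected)
  show "lake X c \<inter> lake X d = {}" if "c \<noteq> d"
  proof (rule ccontr)
    assume "lake X c \<inter> lake X d \<noteq> {}"
    then obtain u v where uv: "u \<in> square (snd X c)" "v \<in> square (snd X d)" "fst X u = fst X v" unfolding lake_def by auto
    then have "u = v" using inj by (simp add: inj_eq)
    then have "\<bar>Re u - of_int (snd X c)\<bar> < 3/10" "\<bar>Re u - of_int (snd X d)\<bar> < 3/10" using uv(1,2) by (simp_all add: square_def)
    then have "real_of_int (snd X c) < of_int (snd X d + 1)" "real_of_int (snd X d) < of_int (snd X c + 1)"
      unfolding of_int_add of_int_1 by linarith+
    then have "snd X c = snd X d" unfolding of_int_less_iff by linarith
    moreover have "inj (snd X)" using f(2) by (simp add: tame_def)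
    ultimately show False using that by (auto dest: injD)
  qed
qed

text \<open>Both points are first joined inside the present lake to points over its mark, which are values of sheets;
the labels of these sheets are then brought into one orbit.\<close>

lemma connect_in_lake:
  assumes X: "stage X" and w: "w \<in> lake X j" and z: "z \<in> regular_pts" "tanid z = w" "z' \<in> regular_pts" "tanid z' = w"
  shows "\<exists>X'. stage X' \<and> (\<forall>c. lake X c \<subseteq> lake X' c) \<and> connected_component (preim (lake X' j)) z z'"
proof -
  obtain s t \<pi> where f: "frame (fst X) s t \<pi>" "tame (\<pi>, snd X)" using X unfolding stage_def by blast
  let ?m = "mark 1 (snd X j)"
  let ?v = "fst X ?m"
  have m: "?m \<in> side 1" "?m \<in> square (snd X j)" by (simp_all add: mark_def side_def square_def)
  have t: "sheets 1 (fst X) t" using f by (simp add: frame_def)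
  have "t 0 ?m \<in> regular_pts" "tanid (t 0 ?m) = ?v" using m(1) t by (simp_all add: sheets_def)
  then have v: "?v \<in> lake X j" "?v \<notin> crit_vals"
    using m(2) by (auto simp: lake_def regular_pts_def)
  have ex: "\<exists>y. connected_component (preim (lake X j)) u (t y ?m)" if u: "u \<in> regular_pts" "tanid u = w" for u
  proof -
    obtain u' where u': "u' \<in> regular_pts" "tanid u' = ?v" "connected_component (preim (lake X j)) u u'"
      using lift_to_fibre[OF lake_props(1,3)[OF X] u(1) _ v] u(2) w by blast
    then obtain y where "t y ?m = u'" using t m(1) unfolding sheets_def by metis
    then show ?thesis using u'(3) by blast
  qed
  obtain y y' where y: "connected_component (preim (lake X j)) z (t y ?m)" "connected_component (preim (lake X j)) z' (t y' ?m)"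
    using ex[OF z(1,2)] ex[OF z(3,4)] by blast
  obtain \<phi>' s' t' \<pi>' pos' where 1: "frame \<phi>' s' t' \<pi>'" "tame (\<pi>', pos')" "\<And>c. fst X ` square (snd X c) \<subseteq> \<phi>' ` square (pos' c)"
    "connected_component (preim (\<phi>' ` square (pos' j))) (t y ?m) (t y' ?m)"
    using connect_sheets[OF f, of j y y'] by blast
  let ?X = "(\<phi>', pos')"
  have "stage ?X" using 1(1,2) by (auto simp: stage_def)
  moreover have sub: "lake X c \<subseteq> lake ?X c" for c using 1(3) by (simp add: lake_def)
  moreover have "connected_component (preim (lake ?X j)) (t y ?m) (t y' ?m)" using 1(4) by (simp add: lake_def)
  then have "connected_component (preim (lake ?X j)) z z'"
    using connected_component_trans[OF connected_component_trans[OF component_mono[OF y(1) sub]]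
        connected_component_sym[OF component_mono[OF y(2) sub]]] by blast
  ultimately show ?thesis by blast
qed

text \<open>All requirements, triples of a class and two labels over its base point, are enumerated and met one after
the other.\<close>

theorem lakes_exist:
  "\<exists>U :: nat \<Rightarrow> complex set. disjoint_family U \<and>
     (\<forall>j. U j \<noteq> {} \<and> open (U j) \<and> simply_connected (U j) \<and> connected (preim (U j)))"
proof -
  obtain s t where f0: "frame chart0 s t start_perm" using start_frame by blast
  define X0 where "X0 = (chart0, \<lambda>j. 3 * int j)"
  have X0: "stage X0" using f0 start_tame by (auto simp: X0_def stage_def)
  define w where "w j = chart0 (mark 1 (3 * int j))" for j
  define \<zeta> where "\<zeta> j y = t y (mark 1 (3 * int j))" for j y
  have m: "mark 1 k \<in> side 1" "mark 1 k \<in> square k" for k by (simp_all add: mark_def side_def square_def)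
  have t: "sheets 1 chart0 t" using f0 by (simp add: frame_def)
  have \<zeta>: "\<zeta> j y \<in> regular_pts" "tanid (\<zeta> j y) = w j" for j y
    using t m(1) by (simp_all add: \<zeta>_def w_def sheets_def)
  have w0: "w j \<in> lake X0 j" for j using m(2) by (simp add: w_def lake_def X0_def)
  have wc: "w j \<notin> crit_vals" for j using \<zeta>[of j 0] by (auto simp: regular_pts_def)
  define joined where "joined n X \<longleftrightarrow> (case from_nat n of (j, y, y') \<Rightarrow> connected_component (preim (lake X j)) (\<zeta> j y) (\<zeta> j y'))"
    for n and X :: "(complex \<Rightarrow> complex) \<times> (nat \<Rightarrow> int)"
  have "\<exists>X. \<forall>n. (stage (X n) \<and> (\<forall>c. lake X0 c \<subseteq> lake (X n) c)) \<and>
     ((\<forall>c. lake (X n) c \<subseteq> lake (X (Suc n)) c) \<and> joined n (X (Suc n)))"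
  proof (rule dependent_nat_choice)
    show "\<exists>X. stage X \<and> (\<forall>c. lake X0 c \<subseteq> lake X c)" using X0 by blast
    fix X n assume X: "stage X \<and> (\<forall>c. lake X0 c \<subseteq> lake X c)"
    obtain j :: nat and y y' :: int where n: "from_nat n = (j, y, y')" by (metis prod_cases3)
    have "w j \<in> lake X j" using X w0 by blast
    then obtain X' where "stage X'" "\<forall>c. lake X c \<subseteq> lake X' c" "connected_component (preim (lake X' j)) (\<zeta> j y) (\<zeta> j y')"
      using connect_in_lake[of X "w j" j "\<zeta> j y" "\<zeta> j y'"] X \<zeta> by blast
    then show "\<exists>X'. (stage X' \<and> (\<forall>c. lake X0 c \<subseteq> lake X' c)) \<and> (\<forall>c. lake X c \<subseteq> lake X' c) \<and> joined n X'"
      using X n by (intro exI[of _ X']) (auto simp: joined_def)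
  qed
  then obtain X where X: "\<And>n. stage (X n)" "\<And>n c. lake X0 c \<subseteq> lake (X n) c"
    "\<And>n c. lake (X n) c \<subseteq> lake (X (Suc n)) c" "\<And>n. joined n (X (Suc n))" by blast
  have mono: "lake (X m) c \<subseteq> lake (X n) c" if "m \<le> n" for m n c
    using that by (rule lift_Suc_mono_le[where f = "\<lambda>n. lake (X n) c", OF X(3)])
  define U where "U j = (\<Union>n. lake (X n) j)" for j
  have wU: "w j \<in> U j" for j using w0 X(2) unfolding U_def by blast
  have opU: "open (U j)" for j unfolding U_def using lake_props(1)[OF X(1)] by blast
  have scU: "simply_connected (U j)" for j
    unfolding U_def by (rule simply_connected_increasing_union[OF lake_props(1)[OF X(1)] mono lake_props(2)[OF X(1)]])
  have "disjoint_family U"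
    unfolding disjoint_family_on_def
  proof (intro ballI impI)
    fix i j :: nat assume ij: "i \<noteq> j"
    have "False" if z: "z \<in> U i" "z \<in> U j" for z
    proof -
      obtain a b where ab: "z \<in> lake (X a) i" "z \<in> lake (X b) j" using z by (auto simp: U_def)
      then have "z \<in> lake (X (max a b)) i" "z \<in> lake (X (max a b)) j"
        using mono[of a "max a b" i] mono[of b "max a b" j] by auto
      then show False using lake_props(4)[OF X(1) ij] by blast
    qed
    then show "U i \<inter> U j = {}" by blast
  qed
  moreover have "connected (preim (U j))" for j
  proof -
    have join: "connected_component (preim (U j)) (\<zeta> j y) (\<zeta> j y')" for y y'
    proof -
      have "joined (to_nat (j, y, y')) (X (Suc (to_nat (j, y, y'))))" by (rule X(4))
      then have "connected_component (preim (lake (X (Suc (to_nat (j, y, y')))) j)) (\<zeta> j y) (\<zeta> j y')"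
        by (simp add: joined_def)
      then show ?thesis by (rule component_mono) (auto simp: U_def)
    qed
    \<comment> \<open>Every point of the preimage is joined to the fibre over the base point.\<close>
    have reach: "\<exists>y. connected_component (preim (U j)) z (\<zeta> j y)" if z: "z \<in> preim (U j)" for z
    proof -
      obtain z1 where z1: "z1 \<in> regular_pts" "connected_component (preim (U j)) z z1"
        using move_off_crit_vals[OF opU z] by blast
      then have "tanid z1 \<in> U j" using connected_component_in[OF z1(2)] by (auto simp: preim_def)
      then obtain z2 where z2: "z2 \<in> regular_pts" "tanid z2 = w j" "connected_component (preim (U j)) z1 z2"
        using lift_to_fibre[OF opU simply_connected_imp_connected[OF scU] z1(1) _ wU wc] by blast
      obtain y where "\<zeta> j y = z2" using t m(1) z2(1,2) unfolding sheets_def \<zeta>_def w_def by metis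
      then show ?thesis using connected_component_trans[OF z1(2) z2(3)] by blast
    qed
    show ?thesis
      unfolding connected_iff_connected_component
    proof (intro ballI)
      fix a b assume "a \<in> preim (U j)" "b \<in> preim (U j)"
      then obtain y y' where "connected_component (preim (U j)) a (\<zeta> j y)" "connected_component (preim (U j)) b (\<zeta> j y')"
        using reach by meson
      then show "connected_component (preim (U j)) a b"
        using connected_component_trans[OF connected_component_trans[OF _ join] connected_component_sym] by blast
    qed
  qed
  moreover have "U j \<noteq> {}" for j using wU by blast
  ultimately show ?thesis using opU scU by blast
qed

theorem theorem1p5:
  fixes f :: "complex \<Rightarrow> complex"
  assumes "f = (\<lambda>z. tan z + z)"
  shows "\<exists>U :: nat \<Rightarrow> complex set.
           disjoint_family U \<and>
           (\<forall>j. complex_domain (U j) \<and> simply_connected (U j) \<and>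
                connected (mero_preimage f (U j)))"
proof -
  have f: "f = tanid" using assms by (simp add: fun_eq_iff tanid_def)
  have "mero_preimage f V = preim V" for V
    by (auto simp: mero_preimage_def preim_def f is_pole_tanid_iff)
  moreover obtain U :: "nat \<Rightarrow> complex set" where "disjoint_family U"
    "\<And>j. U j \<noteq> {} \<and> open (U j) \<and> simply_connected (U j) \<and> connected (preim (U j))"
    using lakes_exist by blast
  ultimately show ?thesis
    by (intro exI[of _ U]) (auto simp: complex_domain_def simply_connected_imp_connected)
qed

end
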